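(* Let $\mathbf{s}_j=(x'_j,y'_j)$, $j=1,\dots,N_S$, and $\mathbf{t}_l=(x_l,y_l)$, $l=1,\dots,N_T$, be sources and targets in the unit cell $\mathcal{C}$. Given a precision $0<\epsilon<1$, let $$M=\left\lceil\frac{d}{2\pi\eta}\log\left(\frac{1}{1-e^{-2\pi\eta/d}}\,\frac1\epsilon\right)\right\rceil ,$$ and for $m=-M,\dots,M$ let $\alpha_m=\frac{2\pi m}{d}$, $Q_m=|\alpha_m|\eta-i\alpha_m\xi$. With $\mathbf{I}_2$ the $2\times2$ identity, define block matrices with $2\times2$ blocks $$\mathbf{L}^{south}(l,m)=e^{-|\alpha_m|y_l}e^{i\alpha_m x_l}\mathbf{I}_2\ (m\ne0),\qquad \mathbf{L}^{south}(l,0)=y_l\,\mathbf{I}_2,$$ $$\mathbf{R}^{south}(m,j)=e^{|\alpha_m|y'_j}e^{-i\alpha_m x'_j}\mathbf{I}_2\ (m\ne0),\qquad \mathbf{R}^{south}(0,j)=y'_j\,\mathbf{I}_2,$$ and block diagonal matrices with $2\times2$ diagonal blocks, for $m\ne0$, $$\mathbf{D}_a^{south}(m,m)=\frac{1}{4d}\frac{e^{-2Q_m}}{1-e^{-Q_m}}\left(\frac{1}{|\alpha_m|}\mathbf{I}_2-\frac{2-e^{-Q_m}}{1-e^{-Q_m}}\,\eta\begin{pmatrix}1&i\operatorname{sign}(m)\\ i\operatorname{sign}(m)&-1\end{pmatrix}\right),$$ $$\mathbf{D}_b^{south}(m,m)=\frac{1}{4d}\frac{e^{-2Q_m}}{1-e^{-Q_m}}\begin{pmatrix}1&i\operatorname{sign}(m)\\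 i\operatorname{sign}(m)&-1\end{pmatrix},$$ $$\mathbf{D}_a^{south}(0,0)=-\frac{1}{2d\eta}\begin{pmatrix}1&0\\0&0\end{pmatrix},\qquad \mathbf{D}_b^{south}(0,0)=\begin{pmatrix}0&0\\0&0\end{pmatrix},$$ $$\mathbf{D}_S(j,j)=y'_j\,\mathbf{I}_2\ (j=1,\dots,N_S),\qquad \mathbf{D}_T(l,l)=y_l\,\mathbf{I}_2\ (l=1,\dots,N_T).$$ Let $$\mathbf{A}=\mathbf{L}^{south}\mathbf{D}_a^{south}\mathbf{R}^{south}-\mathbf{D}_T\mathbf{L}^{south}\mathbf{D}_b^{south}\mathbf{R}^{south}+\mathbf{L}^{south}\mathbf{D}_b^{south}\mathbf{R}^{south}\mathbf{D}_S .$$ Then the periodizing operator for all "south" sources for the Stokes equations satisfies $\mathbf{P}_2^{south}=\mathbf{A}+O(\epsilon)$ on charge-neutral vectors, up to an additive constant vector; that is, for every $\mathbf{q}=(\mathbf{q}_1,\dots,\mathbf{q}_{N_S})$ with $\mathbf{q}_j=(q_{j,1},q_{j,2})\in\mathbb{R}^2$ and $\sum_{j}\mathbf{q}_j=0$, and all $l,l'$, the limit $$\boldsymbol\Delta_{l,l'}=\lim_{\beta\to0^+}\sum_{j=1}^{N_S}\left(\mathbf{K}_{2,\beta}^{south}(\mathbf{t}_l,\mathbf{s}_j)-\mathbf{K}_{2,\beta}^{south}(\mathbf{t}_{l'},\mathbf{s}_j)\right)\mathbf{q}_j\in\mathbb{R}^2$$ exists and each component of $\boldsymbol\Delta_{l,l'}-\left[(\mathbf{A}\mathbf{q})_l-(\mathbf{A}\mathbf{q})_{l'}\right]$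 is bounded in absolute value by $C\epsilon\sum_{j}(|q_{j,1}|+|q_{j,2}|)$, with $C$ independent of $\epsilon$, $\mathbf{q}$ and the number and locations of sources and targets.
   Context: Let $d,\eta>0$ and $\xi\in\mathbb{R}$ with $d\ge\sqrt{\xi^2+\eta^2}$, $\mathbf{e}_1=(d,0)$, $\mathbf{e}_2=(\xi,\eta)$, $\mathcal{C}=\{x_1\mathbf{e}_1+x_2\mathbf{e}_2 : x_1,x_2\in[-\tfrac12,\tfrac12]\}$, $\mathbf{l}_{mn}=m\mathbf{e}_1+n\mathbf{e}_2$. For $\beta>0$ the modified Stokeslet is, for $\mathbf{t}=(x,y)\ne0$, $$\mathbf{G}_\beta^{(\mathrm{MS})}(\mathbf{t})=\begin{pmatrix}-\partial_{yy}&\partial_{xy}\\ \partial_{xy}&-\partial_{xx}\end{pmatrix}G_{\mathrm{MB}}(\mathbf{t}),\qquad G_{\mathrm{MB}}(\mathbf{t})=-\frac{1}{2\pi\beta^2}\left[K_0(\beta|\mathbf{t}|)-\log(1/|\mathbf{t}|)\right]$$ ($K_0$ the modified Bessel function of the second kind), and $$\mathbf{K}_{2,\beta}^{south}(\mathbf{t},\mathbf{s})=\sum_{n=-\infty}^{-2}\ \sum_{m=-\infty}^{\infty}\mathbf{G}_\beta^{(\mathrm{MS})}(\mathbf{t}-(\mathbf{s}+\mathbf{l}_{mn}))$$ (iterated sum, inner sum over $m$ first). The Stokes periodizing operator $\mathbf{P}_2^{south}$ (an $N_T\times N_S$ block matrix with $2\times2$ blocks) is defined as the limit $\beta\to0$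 of the modified Stokes one, invoking charge neutrality $\sum_j\mathbf{q}_j=0$ and determining the velocity only up to an additive constant vector. Block indices: $l=1,\dots,N_T$, $m=-M,\dots,M$, $j=1,\dots,N_S$. The constant $C$ may depend on $d,\xi,\eta$. *)

theory Defs
  imports "HOL-Analysis.Analysis"
begin

section \<open>Lattice and unit cell\<close>

definition e1 :: "real \<Rightarrow> real ^ 2" where
  "e1 d = vector [d, 0]"

definition e2 :: "real \<Rightarrow> real \<Rightarrow> real ^ 2" where
  "e2 \<xi> \<eta> = vector [\<xi>, \<eta>]"

definition unit_cell :: "real \<Rightarrow> real \<Rightarrow> real \<Rightarrow> (real ^ 2) set" where
  "unit_cell d \<xi> \<eta> = {x1 *\<^sub>R e1 d + x2 *\<^sub>R e2 \<xi> \<eta> | x1 x2. x1 \<in> {-1/2..1/2} \<and> x2 \<in> {-1/2..1/2}}"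

definition lattice_pt :: "real \<Rightarrow> real \<Rightarrow> real \<Rightarrow> int \<Rightarrow> int \<Rightarrow> real ^ 2" where
  "lattice_pt d \<xi> \<eta> m n = of_int m *\<^sub>R e1 d + of_int n *\<^sub>R e2 \<xi> \<eta>"

section \<open>The modified Stokeslet\<close>

text \<open>Modified Bessel function of the second kind of order zero, for positive real
  arguments, by its standard integral representation
  (the integral converges absolutely for every \<open>x > 0\<close>).\<close>

definition bessel_K0 :: "real \<Rightarrow> real" where
  "bessel_K0 x = (LBINT t:{0..}. exp (- (x * cosh t)))"

definition G_MB :: "real \<Rightarrow> real ^ 2 \<Rightarrow> real" where
  "G_MB \<beta> t = - (1 / (2 * pi * \<beta>\<^sup>2)) * (bessel_K0 (\<beta> * norm t) - ln (1 / norm t))"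

definition partial_deriv :: "2 \<Rightarrow> (real ^ 2 \<Rightarrow> real) \<Rightarrow> real ^ 2 \<Rightarrow> real" where
  "partial_deriv i f t = deriv (\<lambda>u. f (t + u *\<^sub>R axis i 1)) 0"

definition G_MS :: "real \<Rightarrow> real ^ 2 \<Rightarrow> real ^ 2 ^ 2" where
  "G_MS \<beta> t = vector
     [vector [- partial_deriv 2 (partial_deriv 2 (G_MB \<beta>)) t,
                partial_deriv 1 (partial_deriv 2 (G_MB \<beta>)) t],
      vector [  partial_deriv 1 (partial_deriv 2 (G_MB \<beta>)) t,
              - partial_deriv 1 (partial_deriv 1 (G_MB \<beta>)) t]]"

text \<open>For \<open>t\<close>, \<open>s\<close> in the unit cell and \<open>\<beta> > 0\<close> the inner sums converge absolutely
  (the summands are \<open>O(1 / m\<^sup>2)\<close>), and the row sums decay exponentially in \<open>n\<close>;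
  hence unordered summation gives the iterated series. The double series over \<open>(m, n)\<close>
  is not absolutely convergent, so the order matters.\<close>

definition K2_south :: "real \<Rightarrow> real \<Rightarrow> real \<Rightarrow> real \<Rightarrow> real ^ 2 \<Rightarrow> real ^ 2 \<Rightarrow> real ^ 2 ^ 2" where
  "K2_south d \<xi> \<eta> \<beta> t s =
     (\<Sum>\<^sub>\<infinity>n\<in>{..-2}. \<Sum>\<^sub>\<infinity>m\<in>UNIV. G_MS \<beta> (t - (s + lattice_pt d \<xi> \<eta> m n)))"

section \<open>Block matrices\<close>

text \<open>Block matrices with \<open>2 \<times> 2\<close> complex blocks are functions of the block indices;
  the range of the inner index is an explicit argument of the product.\<close>

type_synonym ('i, 'j) block_mat = "'i \<Rightarrow> 'j \<Rightarrow> complex ^ 2 ^ 2"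

definition block_mult ::
    "'k set \<Rightarrow> ('i, 'k) block_mat \<Rightarrow> ('k, 'j) block_mat \<Rightarrow> ('i, 'j) block_mat" where
  "block_mult I X Y = (\<lambda>i j. \<Sum>k\<in>I. X i k ** Y k j)"

definition block_diag :: "('i \<Rightarrow> complex ^ 2 ^ 2) \<Rightarrow> ('i, 'i) block_mat" where
  "block_diag D = (\<lambda>i j. if i = j then D i else 0)"

definition block_apply ::
    "'j set \<Rightarrow> ('i, 'j) block_mat \<Rightarrow> ('j \<Rightarrow> complex ^ 2) \<Rightarrow> 'i \<Rightarrow> complex ^ 2" where
  "block_apply J X v = (\<lambda>i. \<Sum>j\<in>J. X i j *v v j)"

definition scale_mat :: "complex \<Rightarrow> complex ^ 2 ^ 2 \<Rightarrow> complex ^ 2 ^ 2" where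
  "scale_mat c X = (\<chi> i j. c * X $ i $ j)"

section \<open>The low-rank factors\<close>

definition trunc_M :: "real \<Rightarrow> real \<Rightarrow> real \<Rightarrow> int" where
  "trunc_M d \<eta> \<epsilon> = \<lceil>d / (2 * pi * \<eta>) * ln (1 / (1 - exp (- (2 * pi * \<eta> / d))) * (1 / \<epsilon>))\<rceil>"

definition alpha :: "real \<Rightarrow> int \<Rightarrow> real" where
  "alpha d m = 2 * pi * of_int m / d"

definition Q_south :: "real \<Rightarrow> real \<Rightarrow> real \<Rightarrow> int \<Rightarrow> complex" where
  "Q_south d \<xi> \<eta> m =
     complex_of_real (\<bar>alpha d m\<bar> * \<eta>) - \<i> * complex_of_real (alpha d m * \<xi>)"

definition L_south :: "real \<Rightarrow> (nat \<Rightarrow> real ^ 2) \<Rightarrow> (nat, int) block_mat" where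
  "L_south d t = (\<lambda>l m.
     if m = 0 then mat (complex_of_real (t l $ 2))
     else mat (exp (complex_of_real (- \<bar>alpha d m\<bar> * t l $ 2)) *
               exp (\<i> * complex_of_real (alpha d m * t l $ 1))))"

definition R_south :: "real \<Rightarrow> (nat \<Rightarrow> real ^ 2) \<Rightarrow> (int, nat) block_mat" where
  "R_south d s = (\<lambda>m j.
     if m = 0 then mat (complex_of_real (s j $ 2))
     else mat (exp (complex_of_real (\<bar>alpha d m\<bar> * s j $ 2)) *
               exp (- \<i> * complex_of_real (alpha d m * s j $ 1))))"

definition B_mat :: "int \<Rightarrow> complex ^ 2 ^ 2" where
  "B_mat m = vector [vector [1, \<i> * of_int (sgn m)], vector [\<i> * of_int (sgn m), -1]]"

definition Da_south :: "real \<Rightarrow> real \<Rightarrow> real \<Rightarrow> (int, int) block_mat" where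
  "Da_south d \<xi> \<eta> = block_diag (\<lambda>m. let Q = Q_south d \<xi> \<eta> m in
     if m = 0 then scale_mat (- complex_of_real (1 / (2 * d * \<eta>))) (vector [vector [1, 0], vector [0, 0]])
     else scale_mat (complex_of_real (1 / (4 * d)) * (exp (- 2 * Q) / (1 - exp (- Q))))
            (scale_mat (complex_of_real (1 / \<bar>alpha d m\<bar>)) (mat 1)
             - scale_mat ((2 - exp (- Q)) / (1 - exp (- Q)) * complex_of_real \<eta>) (B_mat m)))"

definition Db_south :: "real \<Rightarrow> real \<Rightarrow> real \<Rightarrow> (int, int) block_mat" where
  "Db_south d \<xi> \<eta> = block_diag (\<lambda>m. let Q = Q_south d \<xi> \<eta> m in
     if m = 0 then 0
     else scale_mat (complex_of_real (1 / (4 * d)) * (exp (- 2 * Q) / (1 - exp (- Q)))) (B_mat m))"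

text \<open>Serves as both \<open>D\<^sub>S\<close> (applied to the sources) and \<open>D\<^sub>T\<close> (applied to the targets).\<close>

definition D_pts :: "(nat \<Rightarrow> real ^ 2) \<Rightarrow> (nat, nat) block_mat" where
  "D_pts p = block_diag (\<lambda>j. mat (complex_of_real (p j $ 2)))"

definition A_south ::
    "real \<Rightarrow> real \<Rightarrow> real \<Rightarrow> real \<Rightarrow> nat \<Rightarrow> nat \<Rightarrow> (nat \<Rightarrow> real ^ 2) \<Rightarrow> (nat \<Rightarrow> real ^ 2)
      \<Rightarrow> (nat, nat) block_mat" where
  "A_south d \<xi> \<eta> \<epsilon> N_T N_S t s =
     (let M = trunc_M d \<eta> \<epsilon>; I = {-M..M};
          L = L_south d t; R = R_south d s;
          Da = Da_south d \<xi> \<eta>; Db = Db_south d \<xi> \<eta>;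
          LDaR = block_mult I (block_mult I L Da) R;
          LDbR = block_mult I (block_mult I L Db) R
      in (\<lambda>l j. LDaR l j - block_mult {1..N_T} (D_pts t) LDbR l j
                 + block_mult {1..N_S} LDbR (D_pts s) l j))"

definition complex_vec :: "real ^ 2 \<Rightarrow> complex ^ 2" where
  "complex_vec v = (\<chi> i. complex_of_real (v $ i))"

end

theory Submission
  imports Defs "HOL-Real_Asymp.Real_Asymp"
begin

text \<open>Shifting the line of integration in its integral representation turns \<open>K\<^sub>0 (\<beta> r)\<close>, for \<open>y > 0\<close>, into a
  superposition of waves \<open>exp (- \<rho> y + \<i> k x)\<close> with \<open>\<rho>\<^sup>2 = k\<^sup>2 + \<beta>\<^sup>2\<close>, and \<open>log (1 / r)\<close> is the case
  \<open>\<beta> = 0\<close> of the same formula. Hence each entry of the modified Stokeslet is a Fourier integral whose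
  symbol is a divided difference in \<open>\<beta>\<^sup>2\<close>, and Poisson summation turns a row of sources into a sum
  over the frequencies \<open>\<alpha>\<^sub>m\<close>. The modes with \<open>m \<noteq> 0\<close> decay exponentially with the height of the row,
  uniformly in \<open>\<beta>\<close>, so the limit can be taken termwise. It replaces the divided differences by
  derivatives, and the sums over the rows become geometric and arithmetic-geometric series in
  \<open>exp (- Q\<^sub>m)\<close>, which are the matrices \<open>D\<^sub>a\<close> and \<open>D\<^sub>b\<close>. The mode \<open>m = 0\<close> is
  \<open>exp (- \<beta> y) / (2 d \<beta>)\<close>, whose sum over the rows is of order \<open>1 / \<beta>\<^sup>2\<close>; charge neutrality and the
  difference of two targets leave only its term \<open>- y\<^sub>l y'\<^sub>j / (2 d \<eta>)\<close>. Cutting off at \<open>\<bar>m\<bar> \<le> M\<close> costs a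
  geometric tail with ratio \<open>exp (- 2 \<pi> \<eta> / d)\<close>.\<close>

section \<open>Dominated sums and integrals\<close>

text \<open>The order of summation is the obstacle. Along a row the kernel decays only like
  \<open>1 / m ^ 2\<close>, the double series is not absolutely convergent, and the zero frequency
  blows up as \<beta> tends to 0. In the frequency variable, however, the pairs of a row N and a
  frequency a \<noteq> 0 have a summable majorant free of \<beta>, so that every exchange reduces to
  dominated convergence; only a = 0 needs a closed form. The rows start at -2, while the heights of
  a target and a source differ by at most \<eta>. Hence every row lies at least \<eta> below the
  target, where the half plane representation holds, and the two factors \<open>exp (- Q)\<close>
  outweigh the possible growth of \<open>exp (- \<bar>\<alpha>\<bar> * Y)\<close>. Poisson summation
  is applied to the Bessel part and the logarithmic part separately, and only after two derivatives,
  since the Fourier integral of the logarithm itself diverges at frequency 0. Summability along a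
  row has a different source for each part: exponential decay in x for \<beta> > 0, an explicit
  rational kernel for \<beta> = 0.\<close>

lemma tendsto_infsum_dominated:
  fixes f :: "'b \<Rightarrow> 'a \<Rightarrow> 'c::banach"
  assumes lim: "\<And>x. x \<in> A \<Longrightarrow> ((\<lambda>y. f y x) \<longlongrightarrow> g x) F"
    and bound: "\<forall>\<^sub>F y in F. \<forall>x\<in>A. norm (f y x) \<le> B x"
    and B: "B summable_on A" and F: "F \<noteq> bot"
  shows "((\<lambda>y. infsum (f y) A) \<longlongrightarrow> infsum g A) F"
proof -
  have gB: "norm (g x) \<le> B x" if "x \<in> A" for x
  proof (rule tendsto_upperbound[OF tendsto_norm[OF lim[OF that]] _ F])
    show "\<forall>\<^sub>F y in F. norm (f y x) \<le> B x"
      using bound by eventually_elim (use that in auto)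
  qed
  have "g abs_summable_on A"
    by (rule summable_on_comparison_test[OF B]) (use gB in auto)
  then have g: "g summable_on A" by (rule abs_summable_summable)
  \<comment> \<open>The bound holds only eventually. On the set \<open>Y\<close> where it holds, the
    M-test makes the finite partial sums converge uniformly, which lets the two limits be
    exchanged.\<close>
  define Y where "Y = {y. \<forall>x\<in>A. norm (f y x) \<le> B x}"
  show ?thesis
  proof (rule swap_uniform_limit')
    show "uniform_limit Y (\<lambda>X y. \<Sum>x\<in>X. f y x) (\<lambda>y. infsum (f y) A) (finite_subsets_at_top A)"
      by (rule Weierstrass_m_test_general[where M = B]) (use B in \<open>auto simp: Y_def\<close>)
    show "((\<lambda>X. \<Sum>x\<in>X. g x) \<longlongrightarrow> infsum g A) (finite_subsets_at_top A)"
      using g by (rule infsum_tendsto)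
    show "\<forall>\<^sub>F X in finite_subsets_at_top A. ((\<lambda>y. \<Sum>x\<in>X. f y x) \<longlongrightarrow> (\<Sum>x\<in>X. g x)) F"
      by (rule eventually_finite_subsets_at_top_weakI) (intro tendsto_sum lim, auto)
    show "\<forall>\<^sub>F y in F. y \<in> Y" using bound by (simp add: Y_def)
  qed (use F in auto)
qed

text \<open>The remainder of the first order expansion, divided by the step, is \<open>q\<close>.
  The mean value inequality bounds it by \<open>2 * B\<close>, so dominated convergence along
  sequences sends its integral to 0.\<close>

lemma has_vector_derivative_integral_dominated:
  fixes F F' :: "real \<Rightarrow> 'a \<Rightarrow> 'b::{banach, second_countable_topology}"
  assumes U: "open U" "convex U" "x0 \<in> U"
    and der: "\<And>x u. x \<in> U \<Longrightarrow> ((\<lambda>x. F x u) has_vector_derivative F' x u) (at x)"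
    and int: "\<And>x. x \<in> U \<Longrightarrow> integrable M (F x)"
    and bd: "\<And>x u. x \<in> U \<Longrightarrow> norm (F' x u) \<le> B u"
    and B: "integrable M B" and meas: "F' x0 \<in> borel_measurable M"
  shows "((\<lambda>x. \<integral>u. F x u \<partial>M) has_vector_derivative (\<integral>u. F' x0 u \<partial>M)) (at x0)"
proof -
  have intF': "integrable M (F' x0)"
    by (rule Bochner_Integration.integrable_bound[OF B meas])
       (use bd[OF U(3)] in \<open>auto intro!: AE_I2 order_trans[OF _ abs_ge_self]\<close>)
  define q where "q y u = (1 / norm (y - x0)) *\<^sub>R (F y u - (F x0 u + (y - x0) *\<^sub>R F' x0 u))" for y u
  have lin: "norm (F y u - F x0 u) \<le> B u * norm (y - x0)" if "y \<in> U" for y u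
  proof (rule differentiable_bound[OF U(2)])
    show "((\<lambda>x. F x u) has_derivative (\<lambda>h. h *\<^sub>R F' x u)) (at x within U)" if "x \<in> U" for x
      using der[OF that] unfolding has_vector_derivative_def by (rule has_derivative_at_withinI)
    show "onorm (\<lambda>h. h *\<^sub>R F' x u) \<le> B u" if "x \<in> U" for x
      by (rule onorm_le) (simp, metis mult.commute mult_right_mono abs_ge_zero bd[OF that, of u])
  qed (use that U in auto)
  have qB: "norm (q y u) \<le> 2 * B u" if "y \<in> U" "y \<noteq> x0" for y u
  proof -
    have "norm (F y u - (F x0 u + (y - x0) *\<^sub>R F' x0 u))
        \<le> norm (F y u - F x0 u) + norm ((y - x0) *\<^sub>R F' x0 u)"
      by (metis diff_diff_eq norm_triangle_ineq4)
    also have "\<dots> \<le> B u * norm (y - x0) + norm (y - x0) * B u"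
      using lin[OF that(1)] bd[OF U(3), of u] by (intro add_mono) (auto simp: mult_left_mono)
    finally show ?thesis
      using that by (simp add: q_def pos_divide_le_eq mult_ac)
  qed
  have "((\<lambda>y. (\<integral>u. q y u \<partial>M)) \<longlongrightarrow> 0) (at x0 within U)"
    unfolding tendsto_at_iff_sequentially
  proof (intro allI impI)
    fix X :: "nat \<Rightarrow> real"
    assume X: "\<forall>i. X i \<in> U - {x0}" "X \<longlonglongrightarrow> x0"
    have "(\<lambda>n. \<integral>u. q (X n) u \<partial>M) \<longlonglongrightarrow> (\<integral>u. 0 \<partial>M)"
    proof (rule integral_dominated_convergence[where w = "\<lambda>u. 2 * B u"])
      show "q (X n) \<in> borel_measurable M" for n
        unfolding q_def using X(1) int[of "X n"] int[OF U(3)] meas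
        by (intro borel_measurable_scaleR borel_measurable_diff borel_measurable_add) auto
      show "AE u in M. (\<lambda>n. q (X n) u) \<longlonglongrightarrow> 0"
      proof (intro AE_I2)
        fix u
        have "((\<lambda>y. q y u) \<longlongrightarrow> 0) (at x0)"
          using der[OF U(3), of u]
          unfolding has_vector_derivative_def has_derivative_within q_def by auto
        then have "((\<lambda>y. q y u) \<longlongrightarrow> 0) (at x0 within U)" by (rule tendsto_within_subset) auto
        then show "(\<lambda>n. q (X n) u) \<longlonglongrightarrow> 0"
          using X unfolding tendsto_at_iff_sequentially comp_def by blast
      qed
      show "AE u in M. norm (q (X n) u) \<le> 2 * B u" for n
        using X(1) qB by auto
    qed (use B in auto)
    then show "((\<lambda>y. \<integral>u. q y u \<partial>M) \<circ> X) \<longlonglongrightarrow> 0" by (simp add: comp_def)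
  qed
  then have lim: "((\<lambda>y. (\<integral>u. q y u \<partial>M)) \<longlongrightarrow> 0) (at x0)"
    unfolding at_within_open[OF U(3,1)] .
  have "\<forall>\<^sub>F y in at x0. y \<in> U" by (rule eventually_at_in_open'[OF U(1,3)])
  then have "\<forall>\<^sub>F y in at x0. (\<integral>u. q y u \<partial>M) = (1 / norm (y - x0)) *\<^sub>R ((\<integral>u. F y u \<partial>M)
       - ((\<integral>u. F x0 u \<partial>M) + (y - x0) *\<^sub>R (\<integral>u. F' x0 u \<partial>M)))"
  proof eventually_elim
    case (elim y)
    show ?case unfolding q_def using int[OF elim] int[OF U(3)] intF' by simp
  qed
  note Lim_transform_eventually[OF lim this]
  then show ?thesis
    unfolding has_vector_derivative_def has_derivative_within
    by (intro conjI bounded_linear_scaleR_left) 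
qed

lemma integrable_exp_neg_abs:
  assumes "c > (0::real)"
  shows "integrable lborel (\<lambda>u::real. exp (- c * \<bar>u\<bar>))"
proof -
  have "(\<lambda>u::real. exp (- c * u)) absolutely_integrable_on {0..}"
    by (subst absolutely_integrable_on_iff_nonneg) (use integrable_on_exp_minus_to_infinity[OF assms] in auto)
  then have "integrable lebesgue (\<lambda>u::real. indicator {0..} u *\<^sub>R exp (- c * u))"
    by (simp add: set_integrable_def)
  then have 1: "integrable lborel (\<lambda>u::real. indicator {0..} u *\<^sub>R exp (- c * u))"
    by (subst (asm) integrable_completion) auto
  then have 2: "integrable lborel (\<lambda>u::real. indicator {0..} (-u) *\<^sub>R exp (- c * (-u)))"
    using lborel_integrable_real_affine[OF 1, of "-1" 0] by simp
  show ?thesis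
    by (rule Bochner_Integration.integrable_bound[OF Bochner_Integration.integrable_add[OF 1 2]])
       (auto simp: indicator_def abs_if)
qed

lemma integrable_lborel_bound:
  fixes f :: "real \<Rightarrow> 'a::{banach, second_countable_topology}"
  assumes "integrable lborel B" "continuous_on UNIV f" "\<And>x. norm (f x) \<le> B x"
  shows "integrable lborel f"
  by (rule Bochner_Integration.integrable_bound[OF assms(1)])
     (use assms(2,3) in \<open>auto intro!: AE_I2 order_trans[OF _ abs_ge_self] borel_measurable_continuous_onI\<close>)

lemma integral_derivative_UNIV:
  fixes F f :: "real \<Rightarrow> 'a::euclidean_space"
  assumes "\<And>x. (F has_vector_derivative f x) (at x)" "\<And>x. isCont f x" "integrable lborel f"
    and "(F \<longlongrightarrow> A) at_bot" "(F \<longlongrightarrow> B) at_top"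
  shows "(\<integral>x. f x \<partial>lborel) = B - A"
proof -
  have "(LBINT x=-\<infinity>..\<infinity>. f x) = B - A"
  proof (rule interval_integral_FTC_integrable[where F = F])
    show "((F \<circ> real_of_ereal) \<longlongrightarrow> A) (at_right (-\<infinity>))"
      using assms(4) by (simp add: ereal_tendsto_simps)
    show "((F \<circ> real_of_ereal) \<longlongrightarrow> B) (at_left \<infinity>)"
      using assms(5) by (simp add: ereal_tendsto_simps)
    show "set_integrable lborel (einterval (- \<infinity>) \<infinity>) f"
      using assms(3) by (simp add: set_integrable_def einterval_def)
  qed (use assms in auto)
  then show ?thesis by (simp add: interval_lebesgue_integral_def einterval_def set_lebesgue_integral_def)
qed

lemma integral_split_Ici:
  fixes f :: "real \<Rightarrow> 'a::{banach, second_countable_topology}"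
  assumes f: "integrable lborel f"
  shows "(LBINT u. f u) = (LBINT u:{0..}. f u) + (LBINT u:{0..}. f (- u))"
proof -
  have i: "integrable lborel (\<lambda>u. indicat_real A u *\<^sub>R f u)" if "A \<in> sets borel" for A
    using that by (intro integrable_mult_indicator f) auto
  have "(LBINT u. f u) = (LBINT u. indicat_real {0..} u *\<^sub>R f u + indicat_real {..0} u *\<^sub>R f u)"
  proof (rule integral_cong_AE)
    show "AE u in lborel. f u = indicat_real {0..} u *\<^sub>R f u + indicat_real {..0} u *\<^sub>R f u"
      by (rule AE_I'[of "{0}"]) (auto simp: indicator_def)
  qed (use i f in auto)
  also have "\<dots> = (LBINT u. indicat_real {0..} u *\<^sub>R f u) + (LBINT u. indicat_real {..0} u *\<^sub>R f u)"
    by (simp add: i)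
  also have "(LBINT u. indicat_real {..0} u *\<^sub>R f u) = (LBINT u. indicat_real {0..} u *\<^sub>R f (- u))"
    by (subst lborel_integral_real_affine[where c = "-1" and t = 0]) (auto simp: indicator_def)
  finally show ?thesis by (simp add: set_lebesgue_integral_def)
qed

lemma integral_derivative_Ici:
  fixes F f :: "real \<Rightarrow> 'a::euclidean_space"
  assumes "\<And>x. (F has_vector_derivative f x) (at x)" "\<And>x. isCont f x"
    and "set_integrable lborel {a..} f" and "(F \<longlongrightarrow> B) at_top"
  shows "(LBINT x:{a..}. f x) = B - F a"
proof -
  have sub: "einterval (ereal a) \<infinity> = {a<..}" by (auto simp: einterval_def)
  have "(LBINT x=a..\<infinity>. f x) = B - F a"
  proof (rule interval_integral_FTC_integrable[where F = F])
    have "continuous (at a) F"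
      using assms(1) has_vector_derivative_continuous by blast
    then have "(F \<longlongrightarrow> F a) (at_right a)" 
      by (simp add: continuous_at filterlim_at_split)
    then show "((F \<circ> real_of_ereal) \<longlongrightarrow> F a) (at_right (ereal a))"
      by (simp add: ereal_tendsto_simps)
    show "((F \<circ> real_of_ereal) \<longlongrightarrow> B) (at_left \<infinity>)"
      using assms(4) by (simp add: ereal_tendsto_simps)
    show "set_integrable lborel (einterval a \<infinity>) f"
      unfolding sub by (rule set_integrable_subset[OF assms(3)]) auto
  qed (use assms in auto)
  then have "(LBINT x:{a<..}. f x) = B - F a"
    by (simp add: interval_lebesgue_integral_def sub)
  moreover have "(LBINT x:{a<..}. f x) = (LBINT x:{a..}. f x)"
    unfolding set_lebesgue_integral_def
  proof (rule integral_cong_AE)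
    have "f \<in> borel_measurable borel"
      using assms(2) by (intro borel_measurable_continuous_onI) (simp add: continuous_at_imp_continuous_on)
    then show "(\<lambda>x. indicat_real {a<..} x *\<^sub>R f x) \<in> borel_measurable lborel"
      "(\<lambda>x. indicat_real {a..} x *\<^sub>R f x) \<in> borel_measurable lborel" by auto
    show "AE x in lborel. indicat_real {a<..} x *\<^sub>R f x = indicat_real {a..} x *\<^sub>R f x"
      by (rule AE_I'[of "{a}"]) (auto simp: indicator_def)
  qed
  ultimately show ?thesis by simp
qed

section \<open>Poisson summation\<close>

lemma has_sum_int_split:
  fixes f :: "int \<Rightarrow> 'a::{topological_comm_monoid_add, t2_space}"
  assumes "((\<lambda>n. f (int n)) has_sum A) UNIV" "((\<lambda>n. f (- int (Suc n))) has_sum B) UNIV"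
  shows "(f has_sum A + B) UNIV"
proof -
  have "(f has_sum A) (range int)"
    by (subst has_sum_reindex) (use assms(1) in \<open>auto simp: comp_def\<close>)
  moreover have "(f has_sum B) (range (\<lambda>n. - int (Suc n)))"
    by (subst has_sum_reindex) (use assms(2) in \<open>auto simp: comp_def inj_on_def\<close>)
  moreover have "range int \<inter> range (\<lambda>n. - int (Suc n)) = {}" by auto
  ultimately have "(f has_sum A + B) (range int \<union> range (\<lambda>n. - int (Suc n)))"
    by (rule has_sum_Un_disjoint)
  moreover have "range int \<union> range (\<lambda>n. - int (Suc n)) = UNIV"
  proof (intro set_eqI iffI UNIV_I)
    fix m :: int
    show "m \<in> range int \<union> range (\<lambda>n. - int (Suc n))"
    proof (cases "m \<ge> 0")
      case True
      then have "m = int (nat m)" by simp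
      then show ?thesis by blast
    next
      case False
      then have "m = - int (Suc (nat (- m - 1)))" by simp
      then show ?thesis by blast
    qed
  qed
  ultimately show ?thesis by simp
qed

lemma has_sum_geometric:
  fixes z :: "'a::{real_normed_field, banach}"
  assumes "norm z < 1"
  shows "((\<lambda>n. z ^ n) has_sum 1 / (1 - z)) UNIV"
  by (rule norm_summable_imp_has_sum)
     (use assms geometric_sums in \<open>auto simp: norm_power intro!: summable_geometric\<close>)

lemma summable_on_exp_neg_abs_int:
  assumes "c > 0"
  shows "(\<lambda>j::int. exp (- c * \<bar>real_of_int j\<bar>)) summable_on UNIV"
proof -
  have *: "((\<lambda>n. exp (- c) ^ n) has_sum 1 / (1 - exp (- c))) UNIV"
    by (rule has_sum_geometric) (use assms in auto)
  have 1: "((\<lambda>n. exp (- c * \<bar>real_of_int (int n)\<bar>)) has_sum 1 / (1 - exp (- c))) UNIV"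
    using * by (simp add: exp_of_nat_mult[symmetric] mult.commute)
  have 2: "((\<lambda>n. exp (- c * \<bar>real_of_int (- int (Suc n))\<bar>)) has_sum exp (-c) * (1 / (1 - exp (- c)))) UNIV"
    using has_sum_cmult_right[OF *, of "exp (- c)"]
    by (simp add: exp_of_nat_mult[symmetric] algebra_simps flip: exp_add)
  show ?thesis
    using has_sum_int_split[OF 1 2] by (rule has_sum_imp_summable)
qed

lemma summable_on_power_abs_int:
  assumes "0 < r" "r < (1::real)"
  shows "(\<lambda>m::int. r ^ nat \<bar>m\<bar>) summable_on UNIV"
proof -
  have "r ^ nat \<bar>m\<bar> = exp (- (- ln r) * \<bar>real_of_int m\<bar>)" for m :: int
    using assms by (simp add: exp_of_nat_mult[symmetric] powr_realpow[symmetric] powr_def mult.commute)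
  then show ?thesis using summable_on_exp_neg_abs_int[of "- ln r"] assms by simp
qed

text \<open>Fubini for a series: enumerating the integers by \<open>int_decode\<close> reduces this
  to termwise integration of an ordinary series, and absolute convergence makes the result
  independent of the enumeration.\<close>

lemma has_sum_integral_int:
  fixes f :: "int \<Rightarrow> 'a \<Rightarrow> complex"
  assumes int: "\<And>i. integrable M (f i)"
    and sumI: "(\<lambda>i. \<integral>x. norm (f i x) \<partial>M) summable_on UNIV"
    and pt: "\<And>x. x \<in> space M \<Longrightarrow> ((\<lambda>i. f i x) has_sum S x) UNIV"
  shows "((\<lambda>i. \<integral>x. f i x \<partial>M) has_sum (\<integral>x. S x \<partial>M)) UNIV"
proof -
  let ?h = "int_decode"
  have h: "bij_betw ?h UNIV UNIV" by (rule bij_int_decode)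
  have pt': "(\<lambda>n. f (?h n) x) sums S x" "summable (\<lambda>n. norm (f (?h n) x))" if "x \<in> space M" for x
  proof -
    have "((\<lambda>n. f (?h n) x) has_sum S x) UNIV"
      using pt[OF that] by (subst has_sum_reindex_bij_betw[OF h])
    then show "(\<lambda>n. f (?h n) x) sums S x" by (rule has_sum_imp_sums)
    have "(\<lambda>i. norm (f i x)) summable_on UNIV"
      using has_sum_imp_summable[OF pt[OF that]] by (simp add: summable_on_iff_abs_summable_on_complex)
    then have "(\<lambda>n. norm (f (?h n) x)) summable_on UNIV"
      by (subst summable_on_reindex_bij_betw[OF h])
    then show "summable (\<lambda>n. norm (f (?h n) x))" by (rule summable_on_imp_summable)
  qed
  have "(\<lambda>n. \<integral>x. norm (f (?h n) x) \<partial>M) summable_on UNIV"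
    using sumI by (subst summable_on_reindex_bij_betw[OF h])
  then have sumI': "summable (\<lambda>n. \<integral>x. norm (f (?h n) x) \<partial>M)" by (rule summable_on_imp_summable)
  have "(\<lambda>n. \<integral>x. f (?h n) x \<partial>M) sums (\<integral>x. (\<Sum>n. f (?h n) x) \<partial>M)"
    by (rule sums_integral) (use int pt' sumI' in auto)
  also have "(\<integral>x. (\<Sum>n. f (?h n) x) \<partial>M) = (\<integral>x. S x \<partial>M)"
    by (rule Bochner_Integration.integral_cong) (use pt' in \<open>auto simp: sums_iff\<close>)
  finally have "(\<lambda>n. \<integral>x. f (?h n) x \<partial>M) sums (\<integral>x. S x \<partial>M)" .
  moreover have "summable (\<lambda>n. norm (\<integral>x. f (?h n) x \<partial>M))"
    by (rule summable_comparison_test'[OF sumI', of 0]) (auto intro: integral_norm_bound)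
  ultimately have "((\<lambda>n. \<integral>x. f (?h n) x \<partial>M) has_sum (\<integral>x. S x \<partial>M)) UNIV"
    by (intro norm_summable_imp_has_sum)
  then show ?thesis by (subst (asm) has_sum_reindex_bij_betw[OF h])
qed

section \<open>The Poisson kernel of the unit disc as an approximate identity\<close>

definition poisson_kernel :: "real \<Rightarrow> real \<Rightarrow> real" where
  "poisson_kernel r v = (1 - r\<^sup>2) / (1 - 2 * r * cos v + r\<^sup>2)"

text \<open>For \<open>r > 0\<close> both summands are nonnegative: the first alone gives the
  uniform bound of the kernel, the second alone its smallness away from
  \<open>v = 0\<close>.\<close>

lemma poisson_kernel_denom:
  "1 - 2 * r * cos v + r\<^sup>2 = (1 - r :: real)\<^sup>2 + 2 * r * (1 - cos v)"
  by (simp add: power2_eq_square algebra_simps)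

text \<open>Two geometric series, in \<open>w\<close> over m \<ge> 0 and in its conjugate
  \<open>w'\<close> over m < 0; the sum simplifies through \<open>w * w' = r\<^sup>2\<close> and
  \<open>w + w' = 2 * r * cos v\<close>.\<close>

lemma poisson_kernel_has_sum:
  assumes r: "0 < r" "r < 1"
  shows "((\<lambda>m::int. of_real (r ^ nat \<bar>m\<bar>) * cis (- of_int m * v)) has_sum of_real (poisson_kernel r v)) UNIV"
proof -
  define w where "w = of_real r * cis (- v)"
  define w' where "w' = of_real r * cis v"
  have nw: "norm w < 1" "norm w' < 1" using r by (auto simp: w_def w'_def norm_mult)
  then have ne: "w \<noteq> 1" "w' \<noteq> 1" by auto
  have pw: "w ^ n = of_real (r ^ n) * cis (- of_int (int n) * v)" for n
    by (simp add: w_def power_mult_distrib Complex.DeMoivre)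
  have pw': "w' ^ n = of_real (r ^ n) * cis (- of_int (- int n) * v)" for n
    by (simp add: w'_def power_mult_distrib Complex.DeMoivre)
  have 1: "((\<lambda>n. of_real (r ^ nat \<bar>int n\<bar>) * cis (- of_int (int n) * v)) has_sum 1 / (1 - w)) UNIV"
    using has_sum_geometric[OF nw(1)] by (simp only: pw) simp
  have 2: "((\<lambda>n. of_real (r ^ nat \<bar>- int (Suc n)\<bar>) * cis (- of_int (- int (Suc n)) * v)) has_sum w' * (1 / (1 - w'))) UNIV"
  proof -
    have "((\<lambda>n. w' ^ Suc n) has_sum w' * (1 / (1 - w'))) UNIV"
      using has_sum_cmult_right[OF has_sum_geometric[OF nw(2)], of w'] by simp
    moreover have "w' ^ Suc n = of_real (r ^ nat \<bar>- int (Suc n)\<bar>) * cis (- of_int (- int (Suc n)) * v)" for n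
    proof -
      have "nat \<bar>- int (Suc n)\<bar> = Suc n" by simp
      then show ?thesis using pw'[of "Suc n"] by simp
    qed
    ultimately show ?thesis by simp
  qed
  have ww: "w * w' = of_real (r\<^sup>2)"
    by (simp add: w_def w'_def cis_mult power2_eq_square mult.assoc mult.left_commute)
  have wpw: "w + w' = of_real (2 * r * cos v)"
    by (simp add: w_def w'_def complex_eq_iff)
  have "1 / (1 - w) + w' * (1 / (1 - w')) = (1 - w * w') / (1 - (w + w') + w * w')"
    using ne by (simp add: field_simps)
  also have "\<dots> = of_real (poisson_kernel r v)"
    unfolding ww wpw poisson_kernel_def by simp
  finally show ?thesis using has_sum_int_split[OF 1 2] by simp
qed

lemma poisson_kernel_props:
  assumes r: "0 < r" "r < 1"
  shows "0 \<le> poisson_kernel r v" "poisson_kernel r v \<le> 2 / (1 - r)"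
    "0 < 1 - 2 * r * cos v + r\<^sup>2"
proof -
  show *: "0 < 1 - 2 * r * cos v + r\<^sup>2"
    unfolding poisson_kernel_denom using r by (intro add_pos_nonneg) auto
  show "0 \<le> poisson_kernel r v"
    unfolding poisson_kernel_def using * r by (intro divide_nonneg_pos) (auto simp: power_le_one)
  have "(1 - r\<^sup>2) / (1 - 2 * r * cos v + r\<^sup>2) \<le> (1 - r\<^sup>2) / (1 - r)\<^sup>2"
    using * r unfolding poisson_kernel_denom
    by (intro divide_left_mono mult_pos_pos add_pos_nonneg) (auto simp: power_le_one)
  also have "\<dots> = (1 + r) / (1 - r)"
  proof -
    have "1 - r\<^sup>2 = (1 - r) * (1 + r)" by (simp add: power2_eq_square algebra_simps)
    then show ?thesis using r by (simp add: power2_eq_square)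
  qed
  also have "\<dots> \<le> 2 / (1 - r)" using r by (intro divide_right_mono) auto
  finally show "poisson_kernel r v \<le> 2 / (1 - r)" by (simp add: poisson_kernel_def)
qed

lemma poisson_kernel_measurable [measurable]: "poisson_kernel r \<in> borel_measurable borel"
  unfolding poisson_kernel_def by measurable

lemma integral_cis_period:
  "(LBINT v. indicator {-pi..<pi} v *\<^sub>R cis (- of_int m * v)) = (if m = 0 then of_real (2 * pi) else 0)"
proof -
  have "(LBINT v. indicator {-pi..<pi} v *\<^sub>R cis (- of_int m * v))
      = (LBINT v. indicator {-pi..pi} v *\<^sub>R cis (- of_int m * v))"
  proof (rule integral_cong_AE)
    have "(\<lambda>v. cis (- of_int m * v)) \<in> borel_measurable borel"
      by (intro borel_measurable_continuous_onI continuous_intros)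
    then show "(\<lambda>v. indicat_real {-pi..<pi} v *\<^sub>R cis (- of_int m * v)) \<in> borel_measurable lborel"
      "(\<lambda>v. indicat_real {-pi..pi} v *\<^sub>R cis (- of_int m * v)) \<in> borel_measurable lborel"
      by auto
    show "AE v in lborel. indicat_real {-pi..<pi} v *\<^sub>R cis (- of_int m * v) = indicat_real {-pi..pi} v *\<^sub>R cis (- of_int m * v)"
      by (rule AE_I'[of "{pi}"]) (auto simp: indicator_def)
  qed
  also have "\<dots> = (if m = 0 then of_real (2 * pi) else 0)"
  proof (cases "m = 0")
    case True
    then show ?thesis by (simp add: scaleR_conv_of_real)
  next
    case False
    define F where "F = (\<lambda>v. cis (- of_int m * v) / (- \<i> * of_int m))"
    have "(LBINT v. indicator {-pi..pi} v *\<^sub>R cis (- of_int m * v)) = F pi - F (-pi)"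
    proof (rule integral_FTC_atLeastAtMost)
      show "(F has_vector_derivative cis (- of_int m * x)) (at x within {-pi..pi})" for x
      proof -
        have "- (\<i> * (z * \<i>)) = z" for z by (simp add: complex_eq_iff)
        then show ?thesis
          unfolding F_def cis_conv_exp using False
          by (auto intro!: derivative_eq_intros has_vector_derivative_real_field)
      qed
    qed (use pi_gt_zero in \<open>auto intro!: continuous_intros\<close>)
    also have "F pi = F (- pi)"
    proof -
      have "sin (of_int m * pi) = 0" by (simp add: sin_times_pi_eq_0)
      then show ?thesis by (simp add: F_def cis.ctr)
    qed
    finally show ?thesis using False by simp
  qed
  finally show ?thesis .
qed

text \<open>Termwise integration of the Fourier series leaves only the frequency 0. The period is
  taken half open because its translates will tile the line.\<close>

lemma integral_poisson_kernel:
  assumes r: "0 < r" "r < 1"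
  shows "(LBINT v. indicator {-pi..<pi} v * poisson_kernel r v) = 2 * pi"
proof -
  define f where "f m v = indicator {-pi..<pi} v *\<^sub>R (of_real (r ^ nat \<bar>m\<bar>) * cis (- of_int m * v))" for m :: int and v
  have int1: "integrable lborel (\<lambda>v. indicat_real {-pi..<pi} v *\<^sub>R cis (- of_int m * v))" for m :: int
  proof -
    have "set_integrable lborel {-pi..pi} (\<lambda>v. cis (- of_int m * v))"
      by (intro borel_integrable_atLeastAtMost' continuous_intros)
    then have "set_integrable lborel {-pi..<pi} (\<lambda>v. cis (- of_int m * v))"
      by (rule set_integrable_subset) auto
    then show ?thesis by (simp add: set_integrable_def)
  qed
  have feq: "f m v = of_real (r ^ nat \<bar>m\<bar>) * (indicat_real {-pi..<pi} v *\<^sub>R cis (- of_int m * v))" for m v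
    by (simp add: f_def)
  have intf: "integrable lborel (f m)" for m
    unfolding feq by (intro integrable_mult_right int1)
  have If: "(LBINT v. f m v) = (if m = 0 then of_real (2 * pi) else 0)" for m
    unfolding feq integral_mult_right_zero integral_cis_period by simp
  have nf: "(LBINT v. norm (f m v)) = r ^ nat \<bar>m\<bar> * (2 * pi)" for m
  proof -
    have "(LBINT v. norm (f m v)) = (LBINT v. r ^ nat \<bar>m\<bar> * indicat_real {-pi..<pi} v)"
      by (rule Bochner_Integration.integral_cong) (use r in \<open>auto simp: f_def norm_mult norm_power\<close>)
    then show ?thesis by simp
  qed
  have "((\<lambda>m. LBINT v. f m v) has_sum (LBINT v. indicator {-pi..<pi} v *\<^sub>R of_real (poisson_kernel r v))) UNIV"
  proof (rule has_sum_integral_int[OF intf])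
    show "(\<lambda>m. LBINT v. norm (f m v)) summable_on UNIV"
      unfolding nf by (rule summable_on_cmult_left[OF summable_on_power_abs_int[OF r]])
    show "((\<lambda>m. f m v) has_sum indicator {-pi..<pi} v *\<^sub>R of_real (poisson_kernel r v)) UNIV" for v
      unfolding f_def by (intro has_sum_scaleR poisson_kernel_has_sum r)
  qed
  moreover have "((\<lambda>m. LBINT v. f m v) has_sum of_real (2 * pi)) UNIV"
  proof -
    have "((\<lambda>m. LBINT v. f m v) has_sum of_real (2 * pi)) {0}"
      by (simp add: If has_sum_finiteI)
    then show ?thesis by (subst (asm) has_sum_cong_neutral[where T = UNIV]) (auto simp: If)
  qed
  ultimately have "(LBINT v. indicator {-pi..<pi} v *\<^sub>R complex_of_real (poisson_kernel r v)) = of_real (2 * pi)"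
    by (rule has_sum_unique)
  also have "(\<lambda>v. indicator {-pi..<pi} v *\<^sub>R complex_of_real (poisson_kernel r v))
      = (\<lambda>v. complex_of_real (indicator {-pi..<pi} v * poisson_kernel r v))"
    by (simp add: fun_eq_iff scaleR_conv_of_real)
  finally show ?thesis by (simp only: integral_complex_of_real of_real_eq_iff)
qed

section \<open>Periodization and Abel summation\<close>

lemma integrable_exp_dominated:
  fixes k :: "real \<Rightarrow> complex"
  assumes "k \<in> borel_measurable borel" "c > 0" "\<And>x. norm (k x) \<le> C * exp (- c * \<bar>x\<bar>)"
  shows "integrable lborel k"
proof (rule Bochner_Integration.integrable_bound)
  show "integrable lborel (\<lambda>x. C * exp (- c * \<bar>x\<bar>))"
    using integrable_exp_neg_abs[OF assms(2)] by (rule integrable_mult_right)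
qed (use assms in \<open>auto intro!: AE_I2 order_trans[OF _ abs_ge_self]\<close>)

lemma exp_translate_bound:
  assumes "c > 0" "\<bar>v\<bar> \<le> R"
  shows "exp (- c * \<bar>v + 2 * pi * of_int j\<bar>) \<le> exp (c * R) * exp (- (2 * pi * c) * \<bar>real_of_int j\<bar>)"
proof -
  have "\<bar>v + 2 * pi * of_int j\<bar> \<ge> 2 * pi * \<bar>real_of_int j\<bar> - R"
    using assms(2) abs_triangle_ineq2[of "2 * pi * of_int j" "-v"] by (simp add: abs_mult)
  then have "c * \<bar>v + 2 * pi * of_int j\<bar> \<ge> c * (2 * pi * \<bar>real_of_int j\<bar> - R)"
    using assms(1) by (intro mult_left_mono) auto
  then show ?thesis by (simp add: algebra_simps flip: exp_add)
qed

text \<open>One family of integrals is summed in two ways: as integrals of \<open>k\<close> over the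
  tiles \<open>P j\<close> of the line, and, shifted back to a single period, as integrals whose
  integrands add up to the periodization.\<close>

lemma integral_periodization:
  fixes k :: "real \<Rightarrow> complex"
  assumes meas: "k \<in> borel_measurable borel" and c: "c > 0"
    and bd: "\<And>x. norm (k x) \<le> C * exp (- c * \<bar>x\<bar>)"
  shows "(LBINT x. k x) = (LBINT v. indicator {-pi..<pi} v *\<^sub>R (\<Sum>\<^sub>\<infinity>j::int. k (v + 2 * pi * of_int j)))"
proof -
  define I where "I = {-pi..<pi}"
  have int: "integrable lborel k" by (rule integrable_exp_dominated[OF meas c bd])
  have C0: "C \<ge> 0" using bd[of 0] norm_ge_zero[of "k 0"] by (simp del: norm_ge_zero)
  define P where "P j = {2 * pi * real_of_int j - pi..<2 * pi * real_of_int j + pi}" for j :: int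
  define g where "g j x = indicat_real (P j) x *\<^sub>R k x" for j x
  define f where "f j v = indicat_real I v *\<^sub>R k (v + 2 * pi * of_int j)" for j :: int and v
  define B where "B j = C * (exp (c * pi) * exp (- (2 * pi * c) * \<bar>real_of_int j\<bar>))" for j
  have f_shift: "f j v = g j (2 * pi * of_int j + 1 * v)" for j v
    by (simp add: f_def g_def I_def P_def indicator_def add.commute)
  have intg: "integrable lborel (g j)" for j
    unfolding g_def by (rule integrable_mult_indicator[OF _ int]) (simp add: P_def)
  have intf: "integrable lborel (f j)" for j
    unfolding f_shift by (rule lborel_integrable_real_affine[OF intg]) simp
  have If: "(LBINT v. f j v) = (LBINT x. g j x)"
    "(LBINT v. norm (f j v)) = (LBINT x. norm (g j x))" for j
    unfolding f_shift
    by (subst (2) lborel_integral_real_affine[where c = 1 and t = "2 * pi * of_int j"]; simp)+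
  have fbd: "norm (f j v) \<le> B j * indicat_real I v" for j v
  proof (cases "v \<in> I")
    case True
    then have "\<bar>v\<bar> \<le> pi" by (auto simp: I_def)
    then show ?thesis
      using True order_trans[OF bd mult_left_mono[OF exp_translate_bound[OF c] C0]] by (simp add: f_def B_def)
  qed (simp add: f_def)
  have sE: "(\<lambda>j::int. exp (- (2 * pi * c) * \<bar>real_of_int j\<bar>)) summable_on UNIV"
    by (rule summable_on_exp_neg_abs_int) (use c in auto)
  have sB: "(\<lambda>j. B j * E) summable_on UNIV" for E
    using summable_on_cmult_right[OF sE, of "C * exp (c * pi) * E"] by (simp add: B_def mult_ac)
  have summ: "(\<lambda>j. LBINT v. norm (f j v)) summable_on UNIV"
  proof (rule summable_on_comparison_test[OF sB[of "2 * pi"]])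
    fix j
    have "(LBINT v. norm (f j v)) \<le> (LBINT v. B j * indicat_real I v)"
      by (rule integral_mono) (use intf fbd in \<open>auto simp: I_def\<close>)
    also have "\<dots> = B j * (2 * pi)" by (simp add: I_def)
    finally show "(LBINT v. norm (f j v)) \<le> B j * (2 * pi)" .
  qed auto
  have "((\<lambda>j. f j v) has_sum indicat_real I v *\<^sub>R (\<Sum>\<^sub>\<infinity>j::int. k (v + 2 * pi * of_int j))) UNIV" for v
  proof (cases "v \<in> I")
    case True
    have "(\<lambda>j. norm (f j v)) summable_on UNIV"
      by (rule summable_on_comparison_test[OF sB[of "indicat_real I v"]]) (use fbd in auto)
    then have "(\<lambda>j. f j v) summable_on UNIV" by (rule abs_summable_summable)
    then show ?thesis using True by (simp add: f_def)
  qed (simp add: f_def)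
  note s1 = has_sum_integral_int[OF intf summ this]
  have "((\<lambda>j. g j x) has_sum k x) UNIV" for x
  proof -
    \<comment> \<open>The index of the only tile that contains \<open>x\<close>.\<close>
    define i where "i = \<lfloor>(x + pi) / (2 * pi)\<rfloor>"
    have iff: "x \<in> P j \<longleftrightarrow> j = i" for j :: int
    proof -
      have "x \<in> P j \<longleftrightarrow> of_int j \<le> (x + pi) / (2 * pi) \<and> (x + pi) / (2 * pi) < of_int j + 1"
        unfolding P_def by (auto simp: field_simps)
      also have "\<dots> \<longleftrightarrow> j = i" unfolding i_def by (simp add: floor_eq_iff eq_commute[of j])
      finally show ?thesis .
    qed
    have "((\<lambda>j. g j x) has_sum k x) {i}"
      by (rule has_sum_finiteI) (use iff[of i] in \<open>auto simp: g_def\<close>)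
    then show ?thesis
      by (subst (asm) has_sum_cong_neutral[where T = UNIV]) (auto simp: g_def iff indicator_def)
  qed
  note s2 = has_sum_integral_int[OF intg summ[unfolded If] this]
  from has_sum_unique[OF s2 s1[unfolded If]] show ?thesis by (simp add: I_def)
qed

text \<open>The kernel is nonnegative with mass \<open>2 * pi\<close>, so near \<open>v = 0\<close>
  the continuity of \<open>H\<close> suffices, while for \<open>\<bar>v\<bar> \<ge> \<delta>\<close>
  the kernel is at most \<open>K r\<close>, which tends to 0 as \<open>r\<close> tends to 1.\<close>

lemma tendsto_poisson_kernel_integral:
  fixes H :: "real \<Rightarrow> complex"
  assumes cont: "continuous_on UNIV H" and D: "\<And>v. \<bar>v\<bar> \<le> pi \<Longrightarrow> norm (H v) \<le> D"
  shows "((\<lambda>r. LBINT v. indicator {-pi..<pi} v *\<^sub>R (H v * of_real (poisson_kernel r v))) \<longlongrightarrow> of_real (2 * pi) * H 0) (at_left 1)"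
proof (rule tendstoI)
  fix e :: real assume "e > 0"
  \<comment> \<open>Multiplied by the mass \<open>2 * pi\<close> of the kernel, this is half of the
    allowed error.\<close>
  define e' where "e' = e / (4 * pi)"
  have e': "e' > 0" using \<open>e > 0\<close> by (simp add: e'_def)
  have D0: "D \<ge> 0" using D[of 0] norm_ge_zero[of "H 0"] pi_gt_zero by (simp del: norm_ge_zero pi_gt_zero)
  have Hm[measurable]: "H \<in> borel_measurable borel" using cont by (rule borel_measurable_continuous_onI)
  obtain \<delta>0 where \<delta>0: "\<delta>0 > 0" "\<And>v. dist v 0 < \<delta>0 \<Longrightarrow> dist (H v) (H 0) < e'"
    using cont e' unfolding continuous_on_iff by (metis UNIV_I)
  define \<delta> where "\<delta> = min \<delta>0 pi"
  have \<delta>: "0 < \<delta>" "\<delta> \<le> pi" "\<And>v. \<bar>v\<bar> < \<delta> \<Longrightarrow> norm (H v - H 0) \<le> e'"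
    using \<delta>0 by (auto simp: \<delta>_def dist_norm less_imp_le)
  have cd: "cos \<delta> < 1" using cos_monotone_0_pi[of 0 \<delta>] \<delta> by simp
  define K where "K r = (1 - r\<^sup>2) / (2 * r * (1 - cos \<delta>))" for r :: real
  have "((\<lambda>r. 2 * D * K r * (2 * pi)) \<longlongrightarrow> 2 * D * ((1 - 1\<^sup>2) / (2 * 1 * (1 - cos \<delta>))) * (2 * pi)) (at_left 1)"
    unfolding K_def using cd by (intro tendsto_intros) auto
  then have "\<forall>\<^sub>F r in at_left 1. 2 * D * K r * (2 * pi) < e / 2"
    by (rule order_tendstoD(2)) (use \<open>e > 0\<close> in auto)
  moreover have "\<forall>\<^sub>F r in at_left (1::real). r \<in> {0<..<1}"
    by (rule eventually_at_left_real) simp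
  ultimately show "\<forall>\<^sub>F r in at_left 1. dist (LBINT v. indicator {-pi..<pi} v *\<^sub>R (H v * of_real (poisson_kernel r v))) (of_real (2 * pi) * H 0) < e"
  proof eventually_elim
    case (elim r)
    then have r: "0 < r" "r < 1" by auto
    have K0: "K r \<ge> 0" using r cd by (auto simp: K_def power_le_one intro!: divide_nonneg_pos)
    let ?I = "indicat_real {-pi..<pi}" and ?P = "poisson_kernel r"
    have iP: "integrable lborel (\<lambda>v. ?I v * ?P v)"
      using integral_poisson_kernel[OF r] pi_neq_zero not_integrable_integral_eq by fastforce
    have iH: "integrable lborel (\<lambda>v. ?I v *\<^sub>R (H v * of_real (?P v)))"
    proof (rule Bochner_Integration.integrable_bound[OF integrable_mult_right[OF iP, of D]])
      show "AE v in lborel. norm (?I v *\<^sub>R (H v * of_real (?P v))) \<le> norm (D * (?I v * ?P v))"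
        using D D0 poisson_kernel_props(1)[OF r]
        by (intro AE_I2) (auto simp: indicator_def norm_mult intro!: mult_right_mono)
    qed auto
    have iH0: "integrable lborel (\<lambda>v. H 0 * of_real (?I v * ?P v))"
      using iP by (intro integrable_mult_right) (simp only: complex_of_real_integrable_eq)
    have "of_real (2 * pi) * H 0 = H 0 * of_real (LBINT v. ?I v * ?P v)"
      by (simp add: integral_poisson_kernel[OF r])
    also have "\<dots> = (LBINT v. H 0 * of_real (?I v * ?P v))"
      by (simp only: integral_mult_right_zero integral_complex_of_real)
    finally have eq: "(LBINT v. ?I v *\<^sub>R (H v * of_real (?P v))) - of_real (2 * pi) * H 0
       = (LBINT v. ?I v *\<^sub>R (H v * of_real (?P v)) - H 0 * of_real (?I v * ?P v))"
      using iH iH0 by simp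
    have "norm ((LBINT v. ?I v *\<^sub>R (H v * of_real (?P v))) - of_real (2 * pi) * H 0)
      \<le> (LBINT v. e' * (?I v * ?P v) + 2 * D * K r * ?I v)"
      unfolding eq
    proof (rule Bochner_Integration.integral_norm_bound_integral)
      show "integrable lborel (\<lambda>v. e' * (?I v * ?P v) + 2 * D * K r * ?I v)"
        by (intro Bochner_Integration.integrable_add integrable_mult_right iP) auto
      fix v
      show "norm (?I v *\<^sub>R (H v * of_real (?P v)) - H 0 * of_real (?I v * ?P v)) \<le> e' * (?I v * ?P v) + 2 * D * K r * ?I v"
      proof (cases "v \<in> {-pi..<pi}")
        case True
        then have v: "\<bar>v\<bar> \<le> pi" by auto
        have P0: "?P v \<ge> 0" by (rule poisson_kernel_props(1)[OF r])
        have "norm (H v - H 0) * ?P v \<le> e' * ?P v + 2 * D * K r"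
        proof (cases "\<bar>v\<bar> < \<delta>")
          case True
          then show ?thesis using \<delta>(3) P0 D0 K0 by (intro add_increasing2 mult_right_mono) auto
        next
          case False
          have "cos \<bar>v\<bar> \<le> cos \<delta>" using False v \<delta> by (intro cos_monotone_0_pi_le) auto
          then have "2 * r * (1 - cos \<delta>) \<le> 1 - 2 * r * cos v + r\<^sup>2"
            unfolding poisson_kernel_denom using r by (intro add_increasing mult_left_mono) auto
          then have "?P v \<le> K r"
            unfolding poisson_kernel_def K_def using r cd poisson_kernel_props(3)[OF r, of v]
            by (intro divide_left_mono mult_pos_pos) (auto simp: power_le_one)
          moreover have "norm (H v - H 0) \<le> 2 * D"
            using D[OF v] D[of 0] norm_triangle_ineq4[of "H v" "H 0"] by simp
          ultimately have "norm (H v - H 0) * ?P v \<le> 2 * D * K r"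
            using P0 D0 by (intro mult_mono) auto
          then show ?thesis using e' P0 by (simp add: add_increasing)
        qed
        moreover have "?I v *\<^sub>R (H v * of_real (?P v)) - H 0 * of_real (?I v * ?P v) = (H v - H 0) * of_real (?P v)"
          using True by (simp add: algebra_simps)
        ultimately show ?thesis using True P0 by (simp add: norm_mult)
      qed simp
    qed (use iH iH0 in auto)
    also have "\<dots> = e' * (2 * pi) + 2 * D * K r * (2 * pi)"
    proof -
      have j1: "integrable lborel (\<lambda>v. e' * (?I v * ?P v))" by (rule integrable_mult_right[OF iP])
      have j2: "integrable lborel (\<lambda>v. 2 * D * K r * ?I v)" by simp
      have I: "(LBINT v. ?I v) = 2 * pi" by simp
      have "(LBINT v. e' * (?I v * ?P v) + 2 * D * K r * ?I v)
         = (LBINT v. e' * (?I v * ?P v)) + (LBINT v. 2 * D * K r * ?I v)"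
        by (rule Bochner_Integration.integral_add[OF j1 j2])
      then show ?thesis
        by (simp only: integral_mult_right_zero integral_poisson_kernel[OF r] I)
    qed
    also have "\<dots> < e" using elim pi_gt_zero by (simp add: e'_def)
    finally show ?case by (simp add: dist_norm)
  qed
qed

text \<open>Abel summation. With the damping factor \<open>r ^ nat \<bar>m\<bar>\<close> the sum
  moves inside the integral and becomes the Poisson kernel. The kernel has period
  \<open>2 * pi\<close>, so folding the line into one period leaves the periodization
  \<open>H\<close> against the kernel. As \<open>r\<close> tends to 1, the damped sum tends to the
  undamped one, dominated by the hypothesis \<open>summ\<close>, and the integral tends to
  \<open>2 * pi * H 0\<close>.\<close>

lemma poisson_summation_2pi:
  fixes g :: "real \<Rightarrow> complex"
  assumes cont: "continuous_on UNIV g" and c: "c > 0"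
    and bd: "\<And>x. norm (g x) \<le> C * exp (- c * \<bar>x\<bar>)"
    and summ: "(\<lambda>m::int. LBINT x. g x * cis (- of_int m * x)) summable_on UNIV"
  shows "(\<Sum>\<^sub>\<infinity>m::int. LBINT x. g x * cis (- of_int m * x)) = of_real (2 * pi) * (\<Sum>\<^sub>\<infinity>j::int. g (2 * pi * of_int j))"
proof -
  define f where "f m x = g x * cis (- of_int m * x)" for m :: int and x
  define a where "a m = integral\<^sup>L lborel (f m)" for m
  define H where "H x = (\<Sum>\<^sub>\<infinity>j::int. g (x + 2 * pi * of_int j))" for x
  define P where "P r x = complex_of_real (poisson_kernel r x)" for r x
  have gm[measurable]: "g \<in> borel_measurable borel" using cont by (rule borel_measurable_continuous_onI)
  have C0: "C \<ge> 0" using bd[of 0] norm_ge_zero[of "g 0"] by (simp del: norm_ge_zero)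
  have sE: "(\<lambda>j::int. exp (- (2 * pi * c) * \<bar>real_of_int j\<bar>)) summable_on UNIV"
    by (rule summable_on_exp_neg_abs_int) (use c in auto)
  define E where "E R j = C * (exp (c * R) * exp (- (2 * pi * c) * \<bar>real_of_int j\<bar>))" for R j
  have sEE: "E R summable_on UNIV" for R
    using summable_on_cmult_right[OF sE, of "C * exp (c * R)"] by (simp add: E_def[abs_def] mult_ac)
  have gE: "norm (g (x + 2 * pi * of_int j)) \<le> E R j" if "\<bar>x\<bar> \<le> R" for x R j
    unfolding E_def by (rule order_trans[OF bd mult_left_mono[OF exp_translate_bound[OF c that] C0]])
  have contH: "continuous_on UNIV H"
    unfolding continuous_on_def
  proof (intro ballI)
    fix x :: real
    show "(H \<longlongrightarrow> H x) (at x within UNIV)"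
      unfolding H_def
    proof (rule tendsto_infsum_dominated[where B = "E (\<bar>x\<bar> + 1)"])
      show "((\<lambda>x. g (x + 2 * pi * of_int j)) \<longlongrightarrow> g (x + 2 * pi * of_int j)) (at x)" for j :: int
        by (rule continuous_on_tendsto_compose[OF cont]) (auto intro!: tendsto_intros)
      have "\<forall>\<^sub>F y in at x. dist y x < 1"
        by (rule eventually_at_ball'[THEN eventually_mono, of 1 x UNIV]) (auto simp: dist_commute)
      then show "\<forall>\<^sub>F y in at x. \<forall>j\<in>UNIV. norm (g (y + 2 * pi * of_int j)) \<le> E (\<bar>x\<bar> + 1) j"
        by eventually_elim (intro ballI gE, auto simp: dist_norm)
    qed (auto simp: sEE)
  qed
  have HD: "norm (H x) \<le> infsum (E pi) UNIV" if "\<bar>x\<bar> \<le> pi" for x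
    unfolding H_def by (rule norm_infsum_le[OF has_sum_infsum has_sum_infsum])
      (use gE[OF that] sEE in \<open>auto intro!: abs_summable_summable[OF summable_on_comparison_test[OF sEE[of pi]]]\<close>)
  have L: "(\<Sum>\<^sub>\<infinity>m. of_real (r ^ nat \<bar>m\<bar>) * a m) = (LBINT x. indicator {-pi..<pi} x *\<^sub>R (H x * P r x))"
    if r: "0 < r" "r < 1" for r
  proof -
    have "((\<lambda>m. LBINT x. of_real (r ^ nat \<bar>m\<bar>) * f m x) has_sum (LBINT x. g x * P r x)) UNIV"
    proof (rule has_sum_integral_int)
      have "integrable lborel (f m)" for m
      proof (rule integrable_exp_dominated[OF _ c, of _ C])
        have "(\<lambda>x. cis (- of_int m * x)) \<in> borel_measurable borel"
          by (intro borel_measurable_continuous_onI continuous_intros)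
        then show "f m \<in> borel_measurable borel" unfolding f_def[abs_def] by measurable
      qed (use bd in \<open>auto simp: f_def norm_mult\<close>)
      then show "integrable lborel (\<lambda>x. of_real (r ^ nat \<bar>m\<bar>) * f m x)" for m
        by (rule integrable_mult_right)
      have "(LBINT x. norm (of_real (r ^ nat \<bar>m\<bar>) * f m x)) = r ^ nat \<bar>m\<bar> * (LBINT x. norm (g x))" for m
        using r by (simp add: f_def norm_mult norm_power)
      then show "(\<lambda>m. LBINT x. norm (of_real (r ^ nat \<bar>m\<bar>) * f m x)) summable_on UNIV"
        using summable_on_cmult_left[OF summable_on_power_abs_int[OF r]] by simp
      show "((\<lambda>m. of_real (r ^ nat \<bar>m\<bar>) * f m x) has_sum g x * P r x) UNIV" for x
        using has_sum_cmult_right[OF poisson_kernel_has_sum[OF r, of x], of "g x"] by (simp add: f_def P_def mult_ac)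
    qed
    then have "(\<Sum>\<^sub>\<infinity>m. of_real (r ^ nat \<bar>m\<bar>) * a m) = (LBINT x. g x * P r x)"
      by (simp add: a_def has_sum_iff)
    also have "\<dots> = (LBINT x. indicator {-pi..<pi} x *\<^sub>R
        (\<Sum>\<^sub>\<infinity>j::int. g (x + 2 * pi * of_int j) * P r (x + 2 * pi * of_int j)))"
    proof (rule integral_periodization[OF _ c])
      show "norm (g x * P r x) \<le> (C * (2 / (1 - r))) * exp (- c * \<bar>x\<bar>)" for x
        using mult_mono[OF bd[of x] poisson_kernel_props(2)[OF r, of x]] poisson_kernel_props(1)[OF r, of x] C0
        by (simp add: P_def norm_mult mult_ac)
      show "(\<lambda>x. g x * P r x) \<in> borel_measurable borel" unfolding P_def by measurable
    qed
    also have "(\<lambda>x. \<Sum>\<^sub>\<infinity>j::int. g (x + 2 * pi * of_int j) * P r (x + 2 * pi * of_int j)) = (\<lambda>x. H x * P r x)"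
    proof -
      have "P r (x + 2 * pi * of_int j) = P r x" for x and j :: int
        by (simp add: P_def poisson_kernel_def cos_add sin_int_2pin cos_int_2pin)
      then show ?thesis by (simp add: H_def infsum_cmult_left')
    qed
    finally show ?thesis .
  qed
  have ev: "\<forall>\<^sub>F r in at_left (1::real). r \<in> {0<..<1}"
    by (rule eventually_at_left_real) simp
  have lim1: "((\<lambda>r. \<Sum>\<^sub>\<infinity>m. of_real (r ^ nat \<bar>m\<bar>) * a m) \<longlongrightarrow> (\<Sum>\<^sub>\<infinity>m. a m)) (at_left 1)"
  proof (rule tendsto_infsum_dominated[where B = "\<lambda>m. norm (a m)"])
    show "((\<lambda>r. of_real (r ^ nat \<bar>m\<bar>) * a m) \<longlongrightarrow> a m) (at_left 1)" for m
      by (rule tendsto_eq_intros refl | simp)+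
    show "\<forall>\<^sub>F r in at_left 1. \<forall>m\<in>UNIV. norm (of_real (r ^ nat \<bar>m\<bar>) * a m) \<le> norm (a m)"
      using ev by eventually_elim (auto simp: norm_mult norm_power power_le_one intro!: mult_left_le_one_le)
    show "(\<lambda>m. norm (a m)) summable_on UNIV"
      using summ by (simp add: a_def f_def[abs_def] summable_on_iff_abs_summable_on_complex)
  qed simp
  have "\<forall>\<^sub>F r in at_left 1. (LBINT x. indicator {-pi..<pi} x *\<^sub>R (H x * P r x)) = (\<Sum>\<^sub>\<infinity>m. of_real (r ^ nat \<bar>m\<bar>) * a m)"
    using ev by eventually_elim (rule L[symmetric], auto)
  from Lim_transform_eventually[OF tendsto_poisson_kernel_integral[OF contH HD, folded P_def] this]
  have "((\<lambda>r. \<Sum>\<^sub>\<infinity>m. of_real (r ^ nat \<bar>m\<bar>) * a m) \<longlongrightarrow> of_real (2 * pi) * H 0) (at_left 1)" .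
  from tendsto_unique[OF _ lim1 this] show ?thesis by (simp add: a_def f_def[abs_def] H_def)
qed

theorem poisson_summation:
  fixes h :: "real \<Rightarrow> complex"
  assumes d: "d > 0" and cont: "continuous_on UNIV h" and c: "c > 0"
    and bd: "\<And>x. norm (h x) \<le> C * exp (- c * \<bar>x\<bar>)"
    and summ: "(\<lambda>m::int. LBINT x. h x * cis (- (of_int m * d * x))) summable_on UNIV"
  shows "(\<Sum>\<^sub>\<infinity>m::int. LBINT x. h x * cis (- (of_int m * d * x))) = of_real (2 * pi / d) * (\<Sum>\<^sub>\<infinity>j::int. h (2 * pi * of_int j / d))"
proof -
  define g where "g x = h (x / d)" for x
  have a: "(LBINT x. g x * cis (- of_int m * x)) = of_real d * (LBINT x. h x * cis (- (of_int m * d * x)))" for m :: int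
    by (subst lborel_integral_real_affine[where c = d and t = 0])
       (use d in \<open>auto simp: g_def scaleR_conv_of_real mult.assoc\<close>)
  have "(\<Sum>\<^sub>\<infinity>m::int. LBINT x. g x * cis (- of_int m * x)) = of_real (2 * pi) * (\<Sum>\<^sub>\<infinity>j::int. g (2 * pi * of_int j))"
  proof (rule poisson_summation_2pi[where c = "c / d"])
    show "continuous_on UNIV g" unfolding g_def
      by (rule continuous_on_compose2[OF cont]) (use d in \<open>auto intro!: continuous_intros\<close>)
    show "norm (g x) \<le> C * exp (- (c / d) * \<bar>x\<bar>)" for x
      using bd[of "x / d"] d by (simp add: g_def)
    show "(\<lambda>m::int. LBINT x. g x * cis (- of_int m * x)) summable_on UNIV"
      unfolding a by (rule summable_on_cmult_right[OF summ])
  qed (use c d in auto)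
  then show ?thesis
    unfolding a infsum_cmult_right' using d by (simp add: g_def field_simps)
qed

section \<open>Plane wave representation of the Bessel function\<close>

lemma power_le_fact_exp:
  assumes "(x::real) \<ge> 0"
  shows "x ^ n \<le> fact n * exp x"
proof -
  have "x ^ n /\<^sub>R fact n \<le> (\<Sum>k. x ^ k /\<^sub>R fact k)"
    using sum_le_suminf[of "\<lambda>k. x ^ k /\<^sub>R fact k" "{n}"] assms summable_exp_generic[of x] by simp
  also have "\<dots> = exp x" by (simp add: exp_def)
  finally show ?thesis by (simp add: field_simps)
qed

lemma exp_abs_le_cosh: "exp \<bar>u\<bar> \<le> 2 * cosh (u::real)"
  by (cases "u \<ge> 0") (auto simp: cosh_field_def)

lemma abs_sinh_le_cosh: "\<bar>sinh (u::real)\<bar> \<le> cosh u"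
  using sinh_le_cosh_real[of u] sinh_le_cosh_real[of "-u"] by (simp add: abs_le_iff)

text \<open>The bound from the exponential series is used with exponent \<open>Suc n\<close>, one
  more than the power to be controlled; the spare factor \<open>1 / cosh u\<close> is the
  exponential decay in \<open>u\<close>.\<close>

lemma cosh_power_exp_bound:
  assumes "b > 0"
  shows "cosh (u::real) ^ n * exp (- b * cosh u) \<le> 2 * fact (Suc n) / b ^ Suc n * exp (- 1 * \<bar>u\<bar>)"
proof -
  have "(b * cosh u) ^ Suc n \<le> fact (Suc n) * exp (b * cosh u)"
    using assms by (intro power_le_fact_exp) simp
  then have "cosh u ^ n * exp (- b * cosh u) \<le> fact (Suc n) / b ^ Suc n / cosh u"
    using assms by (simp add: exp_minus field_simps power_mult_distrib)
  also have "\<dots> = fact (Suc n) / b ^ Suc n * (1 / cosh u)" by simp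
  also have "\<dots> \<le> fact (Suc n) / b ^ Suc n * (2 * exp (- \<bar>u\<bar>))"
    using exp_abs_le_cosh[of u] assms by (intro mult_left_mono) (auto simp: exp_minus field_simps)
  also have "\<dots> = 2 * fact (Suc n) / b ^ Suc n * exp (- 1 * \<bar>u\<bar>)" by simp
  finally show ?thesis .
qed

lemma integrable_cosh_exp:
  assumes "b > 0"
  shows "integrable lborel (\<lambda>u::real. cosh u ^ n * exp (- b * cosh u))"
proof (rule integrable_lborel_bound)
  show "integrable lborel (\<lambda>u::real. 2 * fact (Suc n) / b ^ Suc n * exp (- 1 * \<bar>u\<bar>))"
    by (rule integrable_mult_right[OF integrable_exp_neg_abs]) simp
  show "norm (cosh u ^ n * exp (- b * cosh u)) \<le> 2 * fact (Suc n) / b ^ Suc n * exp (- 1 * \<bar>u\<bar>)" for u :: real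
    unfolding real_norm_def abs_mult power_abs[symmetric] abs_exp_cancel
    using cosh_power_exp_bound[OF assms, of u n] by simp
qed (intro continuous_intros)

lemma bessel_K0_eq:
  assumes "z > 0"
  shows "bessel_K0 z = (1/2) * (LBINT u. exp (- z * cosh u))"
proof -
  have int: "integrable lborel (\<lambda>u::real. exp (- z * cosh u))"
    using integrable_cosh_exp[OF assms, of 0] by simp
  have "(LBINT u. exp (- z * cosh u)) = 2 * bessel_K0 z"
    using integral_split_Ici[OF int] by (simp add: bessel_K0_def)
  then show ?thesis by simp
qed

text \<open>The function \<open>exp (a * w - z * cosh w)\<close> on the line
  \<open>Im w = - \<phi>\<close>. On the real line its integral is twice the modified Bessel
  function of order \<open>a\<close> at \<open>z\<close>. Order 0 is the kernel itself; the orders 2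
  and -2 enter through its second derivatives.\<close>

definition cosh_kernel :: "real \<Rightarrow> real \<Rightarrow> real \<Rightarrow> real \<Rightarrow> complex" where
  "cosh_kernel a z \<phi> u = exp (of_real a * (of_real u - \<i> * of_real \<phi>) - of_real z * cosh (of_real u - \<i> * of_real \<phi>))"

lemma norm_cosh_kernel:
  "norm (cosh_kernel a z \<phi> u) = exp (a * u - z * cosh u * cos \<phi>)"
proof -
  have "Re (cosh (of_real u - \<i> * of_real \<phi>)) = cosh u * cos \<phi>"
    by (simp add: cosh_field_def Re_exp field_simps)
  then show ?thesis by (simp add: cosh_kernel_def norm_exp_eq_Re)
qed

lemma norm_sinh_shift_le: "norm (sinh (of_real u - \<i> * of_real \<phi>)) \<le> cosh u"
proof -
  have "norm (sinh (of_real u - \<i> * of_real \<phi>)) = norm (exp (of_real u - \<i> * of_real \<phi>) - exp (- (of_real u - \<i> * of_real \<phi>))) / 2"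
    by (simp add: sinh_field_def norm_divide)
  also have "\<dots> \<le> (norm (exp (of_real u - \<i> * of_real \<phi>)) + norm (exp (- (of_real u - \<i> * of_real \<phi>)))) / 2"
    by (intro divide_right_mono norm_triangle_ineq4) auto
  also have "\<dots> = cosh u" by (simp add: norm_exp_eq_Re cosh_field_def)
  finally show ?thesis .
qed

lemma exp_mult_le_cosh_square:
  assumes "\<bar>a\<bar> \<le> 2"
  shows "exp (a * u) \<le> 4 * cosh (u::real) ^ 2"
proof -
  have "a * u \<le> \<bar>a\<bar> * \<bar>u\<bar>" by (metis abs_ge_self abs_mult)
  also have "\<dots> \<le> 2 * \<bar>u\<bar>" using assms by (intro mult_right_mono) auto
  finally have "exp (a * u) \<le> exp \<bar>u\<bar> ^ 2" by (simp add: exp_of_nat_mult[symmetric] flip: exp_double)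
  also have "\<dots> \<le> (2 * cosh u) ^ 2" by (intro power_mono exp_abs_le_cosh) auto
  finally show ?thesis by (simp add: power2_eq_square)
qed

lemma integrable_cosh_kernel:
  assumes "z > 0" "\<bar>\<phi>\<bar> < pi / 2" "\<bar>a\<bar> \<le> 2"
  shows "integrable lborel (cosh_kernel a z \<phi>)"
proof (rule integrable_lborel_bound)
  have c: "cos \<phi> > 0" using assms(2) by (intro cos_gt_zero_pi) auto
  show "integrable lborel (\<lambda>u::real. 4 * (cosh u ^ 2 * exp (- (z * cos \<phi>) * cosh u)))"
    by (intro integrable_mult_right integrable_cosh_exp) (use c assms in auto)
  show "continuous_on UNIV (cosh_kernel a z \<phi>)"
    unfolding cosh_kernel_def[abs_def] by (intro continuous_intros)
  fix u :: real
  have "exp (a * u - z * cosh u * cos \<phi>) = exp (a * u) * exp (- (z * cos \<phi>) * cosh u)"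
    by (simp add: mult_ac flip: exp_add)
  also have "\<dots> \<le> 4 * cosh u ^ 2 * exp (- (z * cos \<phi>) * cosh u)"
    by (intro mult_right_mono exp_mult_le_cosh_square assms) auto
  finally show "norm (cosh_kernel a z \<phi> u) \<le> 4 * (cosh u ^ 2 * exp (- (z * cos \<phi>) * cosh u))"
    unfolding norm_cosh_kernel by simp
qed

text \<open>Moving the line of integration: the derivative in \<open>\<phi>\<close> is the integral of a \<open>u\<close>-derivative.\<close>

lemma integral_cosh_kernel:
  assumes z: "z > 0" and \<phi>: "\<bar>\<phi>\<bar> < pi / 2" and a: "\<bar>a\<bar> \<le> 2"
  shows "(LBINT u. cosh_kernel a z \<phi> u) = of_real (LBINT u. exp (a * u - z * cosh u))"
proof -
  define f where "f = cosh_kernel a z"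
  define g where "g \<phi> u = (of_real a - of_real z * sinh (of_real u - \<i> * of_real \<phi>)) * f \<phi> u" for \<phi> u :: real
  \<comment> \<open>For angles below \<open>\<phi>0\<close> in absolute value the cosine stays above
    \<open>cos \<phi>0 > 0\<close>, so one majorant serves all these lines.\<close>
  obtain \<phi>0 where \<phi>0: "\<bar>\<phi>\<bar> < \<phi>0" "\<phi>0 < pi / 2" using dense[OF \<phi>] by auto
  define U where "U = {-\<phi>0<..<\<phi>0}"
  define c where "c = z * cos \<phi>0"
  have c: "c > 0" unfolding c_def using \<phi>0 z by (intro mult_pos_pos cos_gt_zero_pi) auto
  define B where "B u = 4 * \<bar>a\<bar> * (cosh u ^ 2 * exp (- c * cosh u)) + 4 * z * (cosh u ^ 3 * exp (- c * cosh u))" for u :: real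
  have intB: "integrable lborel B"
    unfolding B_def by (intro Bochner_Integration.integrable_add integrable_mult_right integrable_cosh_exp c)
  have normf: "norm (f \<psi> u) \<le> 4 * cosh u ^ 2 * exp (- c * cosh u)" if "\<psi> \<in> U" for \<psi> u
  proof -
    have "cos \<phi>0 \<le> cos \<bar>\<psi>\<bar>" using that \<phi>0 by (intro cos_monotone_0_pi_le) (auto simp: U_def)
    then have "z * cosh u * cos \<phi>0 \<le> z * cosh u * cos \<psi>" using z by (intro mult_left_mono) auto
    then have "exp (a * u - z * cosh u * cos \<psi>) \<le> exp (a * u) * exp (- c * cosh u)"
      by (simp add: c_def mult_ac flip: exp_add)
    also have "\<dots> \<le> 4 * cosh u ^ 2 * exp (- c * cosh u)"
      by (intro mult_right_mono exp_mult_le_cosh_square a) auto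
    finally show ?thesis unfolding f_def norm_cosh_kernel .
  qed
  have normg: "norm (g \<psi> u) \<le> B u" if "\<psi> \<in> U" for \<psi> u
  proof -
    have "norm (of_real a - of_real z * sinh (of_real u - \<i> * of_real \<psi>)) \<le> \<bar>a\<bar> + z * cosh u"
      by (rule order_trans[OF norm_triangle_ineq4])
         (use z norm_sinh_shift_le[of u \<psi>] in \<open>simp add: norm_mult\<close>)
    then have "norm (g \<psi> u) \<le> (\<bar>a\<bar> + z * cosh u) * (4 * cosh u ^ 2 * exp (- c * cosh u))"
      unfolding g_def norm_mult using normf[OF that, of u] z by (intro mult_mono) auto
    also have "\<dots> = B u" by (simp add: B_def algebra_simps power2_eq_square power3_eq_cube)
    finally show ?thesis .
  qed
  have intf: "integrable lborel (f \<psi>)" if "\<psi> \<in> U" for \<psi>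
    unfolding f_def using integrable_cosh_kernel[OF z _ a, of \<psi>] that \<phi>0 by (auto simp: U_def)
  have contg: "continuous_on UNIV (g \<psi>)" for \<psi>
    unfolding g_def f_def cosh_kernel_def by (intro continuous_intros)
  have intg: "integrable lborel (g \<psi>)" if "\<psi> \<in> U" for \<psi>
    by (rule integrable_lborel_bound[OF intB contg normg[OF that]])
  have g0: "(LBINT u. g \<psi> u) = 0" if "\<psi> \<in> U" for \<psi>
  proof -
    have lim: "(f \<psi> \<longlongrightarrow> 0) F" if F: "((\<lambda>u::real. exp (- 1 * \<bar>u\<bar>)) \<longlongrightarrow> 0) F" for F
    proof (rule Lim_null_comparison)
      show "\<forall>\<^sub>F u in F. norm (f \<psi> u) \<le> 4 * (2 * fact (Suc 2) / c ^ Suc 2) * exp (- 1 * \<bar>u\<bar>)"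
      proof (intro always_eventually allI)
        fix u
        have "norm (f \<psi> u) \<le> 4 * (cosh u ^ 2 * exp (- c * cosh u))"
          using normf[OF \<open>\<psi> \<in> U\<close>, of u] by (simp only: mult.assoc)
        also have "\<dots> \<le> 4 * (2 * fact (Suc 2) / c ^ Suc 2 * exp (- 1 * \<bar>u\<bar>))"
          by (rule mult_left_mono[OF cosh_power_exp_bound[OF c]]) simp
        finally show "norm (f \<psi> u) \<le> 4 * (2 * fact (Suc 2) / c ^ Suc 2) * exp (- 1 * \<bar>u\<bar>)"
          by (simp only: mult.assoc)
      qed
      show "((\<lambda>u. 4 * (2 * fact (Suc 2) / c ^ Suc 2) * exp (- 1 * \<bar>u\<bar>)) \<longlongrightarrow> 0) F"
        using tendsto_mult_right_zero[OF F] .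
    qed
    have "(LBINT u. g \<psi> u) = 0 - 0"
    proof (rule integral_derivative_UNIV[where F = "f \<psi>"])
      show "(f \<psi> has_vector_derivative g \<psi> u) (at u)" for u
        unfolding f_def g_def cosh_kernel_def[abs_def]
        by (rule has_vector_derivative_real_field) (auto intro!: derivative_eq_intros)
      show "isCont (g \<psi>) u" for u using contg by (simp add: continuous_on_eq_continuous_at)
      show "(f \<psi> \<longlongrightarrow> 0) at_top" by (rule lim) real_asymp
      show "(f \<psi> \<longlongrightarrow> 0) at_bot" by (rule lim) real_asymp
    qed (rule intg[OF that])
    then show ?thesis by simp
  qed
  have der: "((\<lambda>\<phi>. LBINT u. f \<phi> u) has_vector_derivative 0) (at \<psi>)" if "\<psi> \<in> U" for \<psi>
  proof -
    \<comment> \<open>The integrand depends only on \<open>u - \<i> * \<phi>\<close>, so its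
      derivative in \<phi> is \<open>- \<i>\<close> times its derivative \<open>g\<close> in
      \<open>u\<close>, and the integral of \<open>g\<close> vanishes by \<open>g0\<close>.\<close>
    have "((\<lambda>\<phi>. LBINT u. f \<phi> u) has_vector_derivative (LBINT u. - \<i> * g \<psi> u)) (at \<psi>)"
    proof (rule has_vector_derivative_integral_dominated[where U = U and B = B])
      show "((\<lambda>x. f x u) has_vector_derivative - \<i> * g x u) (at x)" for x u
        unfolding f_def g_def cosh_kernel_def[abs_def]
        by (rule has_vector_derivative_real_field) (auto intro!: derivative_eq_intros simp: algebra_simps)
      show "(\<lambda>u. - \<i> * g \<psi> u) \<in> borel_measurable lborel"
        using contg by (auto intro!: borel_measurable_continuous_onI continuous_intros)
    qed (use that intf normg intB in \<open>auto simp: U_def norm_mult\<close>)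
    then show ?thesis by (simp add: g0[OF that])
  qed
  have "(LBINT u. f \<phi> u) = (LBINT u. f 0 u)"
  proof (rule has_derivative_zero_unique[where f = "\<lambda>\<phi>. LBINT u. f \<phi> u" and s = U])
    show "convex U" by (simp add: U_def)
    show "((\<lambda>\<phi>. LBINT u. f \<phi> u) has_derivative (\<lambda>h. 0)) (at \<psi> within U)" if "\<psi> \<in> U" for \<psi>
      using der[OF that] by (simp add: has_vector_derivative_def has_derivative_at_withinI)
  qed (use \<phi>0 in \<open>auto simp: U_def\<close>)
  also have "f 0 = (\<lambda>u. complex_of_real (exp (a * u - z * cosh u)))"
    by (simp add: f_def cosh_kernel_def fun_eq_iff exp_of_real[symmetric] cosh_field_def)
  finally show ?thesis by (simp only: f_def integral_complex_of_real)
qed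


text \<open>The hyperbola \<open>\<rho>\<^sup>2 = k\<^sup>2 + \<beta>\<^sup>2\<close> is
  parametrized by \<open>k = \<beta> * sinh u\<close> and \<open>\<rho> = \<beta> * cosh u\<close>;
  the wave is then \<open>exp (- \<rho> * y + \<i> * k * x)\<close>.\<close>

definition wave :: "real \<Rightarrow> real \<Rightarrow> real \<Rightarrow> real \<Rightarrow> complex" where
  "wave \<beta> x y u = exp (of_real (- \<beta> * y * cosh u) + \<i> * of_real (\<beta> * x * sinh u))"

definition wave_integral :: "real \<Rightarrow> (real \<Rightarrow> complex) \<Rightarrow> real \<Rightarrow> real \<Rightarrow> complex" where
  "wave_integral \<beta> p x y = (LBINT u. p u * wave \<beta> x y u)"

lemma norm_wave [simp]: "norm (wave \<beta> x y u) = exp (- (\<beta> * y) * cosh u)"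
  by (simp add: wave_def norm_exp_eq_Re)

lemma continuous_on_wave [continuous_intros]: "continuous_on A (wave \<beta> x y)"
  unfolding wave_def by (intro continuous_intros)

lemma integrable_wave:
  assumes "\<beta> > 0" "y > 0" "continuous_on UNIV p" "\<And>u. norm (p u) \<le> A * cosh u ^ n"
  shows "integrable lborel (\<lambda>u. p u * wave \<beta> x y u)"
proof (rule integrable_lborel_bound)
  show "integrable lborel (\<lambda>u::real. A * (cosh u ^ n * exp (- (\<beta> * y) * cosh u)))"
    by (intro integrable_mult_right integrable_cosh_exp) (use assms in auto)
  show "continuous_on UNIV (\<lambda>u. p u * wave \<beta> x y u)"
    by (intro continuous_intros assms)
  show "norm (p u * wave \<beta> x y u) \<le> A * (cosh u ^ n * exp (- (\<beta> * y) * cosh u))" for u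
    unfolding norm_mult norm_wave mult.assoc[symmetric] by (intro mult_right_mono assms) auto
qed

text \<open>A derivative in x or y only multiplies the weight \<open>p\<close> by the factor that
  the wave releases, so iterated partial derivatives stay within
  \<open>wave_integral\<close>.\<close>

definition wave_dx :: "real \<Rightarrow> (real \<Rightarrow> complex) \<Rightarrow> real \<Rightarrow> complex" where
  "wave_dx \<beta> p u = \<i> * of_real (\<beta> * sinh u) * p u"

definition wave_dy :: "real \<Rightarrow> (real \<Rightarrow> complex) \<Rightarrow> real \<Rightarrow> complex" where
  "wave_dy \<beta> p u = - of_real (\<beta> * cosh u) * p u"

lemma wave_integral_deriv_x:
  assumes \<beta>: "\<beta> > 0" and y: "y > 0" and p: "continuous_on UNIV p" "\<And>u. norm (p u) \<le> A * cosh u ^ n"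
  shows "((\<lambda>x. wave_integral \<beta> p x y) has_vector_derivative wave_integral \<beta> (wave_dx \<beta> p) x y) (at x)"
  unfolding wave_integral_def
proof (rule has_vector_derivative_integral_dominated[where U = UNIV and B = "\<lambda>u. A * \<beta> * (cosh u ^ Suc n * exp (- (\<beta> * y) * cosh u))"])
  have bd: "norm (wave_dx \<beta> p u) \<le> A * \<beta> * cosh u ^ Suc n" for u
  proof -
    have "norm (wave_dx \<beta> p u) = \<beta> * \<bar>sinh u\<bar> * norm (p u)"
      using \<beta> by (simp add: wave_dx_def wave_dy_def norm_mult abs_mult)
    also have "\<dots> \<le> \<beta> * cosh u * (A * cosh u ^ n)"
      using \<beta> by (intro mult_mono abs_sinh_le_cosh p mult_left_mono) auto
    finally show ?thesis by (simp add: mult_ac)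
  qed
  show "((\<lambda>x. p u * wave \<beta> x y u) has_vector_derivative wave_dx \<beta> p u * wave \<beta> x y u) (at x)" for x u
  proof -
    have "((\<lambda>z. p u * exp (of_real (- \<beta> * y * cosh u) + \<i> * (of_real \<beta> * z * of_real (sinh u)))) has_field_derivative
       wave_dx \<beta> p u * wave \<beta> x y u) (at (of_real x))"
      unfolding wave_def wave_dx_def wave_dy_def by (auto intro!: derivative_eq_intros)
    from has_vector_derivative_real_field[OF this] show ?thesis by (simp add: wave_def)
  qed
  show "norm (wave_dx \<beta> p u * wave \<beta> x y u) \<le> A * \<beta> * (cosh u ^ Suc n * exp (- (\<beta> * y) * cosh u))" for x u
    using mult_right_mono[OF bd[of u], of "exp (- (\<beta> * y) * cosh u)"]
    unfolding norm_mult norm_wave by (simp only: mult.assoc) simp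
  show "(\<lambda>u. wave_dx \<beta> p u * wave \<beta> x y u) \<in> borel_measurable lborel"
    using p(1) unfolding wave_dx_def wave_dy_def by (simp, intro borel_measurable_continuous_onI continuous_intros)
  show "integrable lborel (\<lambda>u. A * \<beta> * (cosh u ^ Suc n * exp (- (\<beta> * y) * cosh u)))"
    by (intro integrable_mult_right integrable_cosh_exp) (use \<beta> y in auto)
qed (use integrable_wave[OF \<beta> y p] in auto)

lemma wave_integral_deriv_y:
  assumes \<beta>: "\<beta> > 0" and y: "y > 0" and p: "continuous_on UNIV p" "\<And>u. norm (p u) \<le> A * cosh u ^ n"
  shows "((\<lambda>y. wave_integral \<beta> p x y) has_vector_derivative wave_integral \<beta> (wave_dy \<beta> p) x y) (at y)"
  unfolding wave_integral_def
\<comment> \<open>The majorant has to be uniform in the height, hence the restriction to heights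
  above \<open>y / 2\<close>.\<close>
proof (rule has_vector_derivative_integral_dominated[where U = "{y/2<..}" and B = "\<lambda>u. A * \<beta> * (cosh u ^ Suc n * exp (- (\<beta> * (y/2)) * cosh u))"])
  have bd: "norm (wave_dy \<beta> p u) \<le> A * \<beta> * cosh u ^ Suc n" for u
  proof -
    have "norm (wave_dy \<beta> p u) = \<beta> * cosh u * norm (p u)"
      using \<beta> by (simp add: wave_dx_def wave_dy_def norm_mult abs_mult)
    also have "\<dots> \<le> \<beta> * cosh u * (A * cosh u ^ n)"
      using \<beta> by (intro mult_left_mono p) auto
    finally show ?thesis by (simp add: mult_ac)
  qed
  show "((\<lambda>y. p u * wave \<beta> x y u) has_vector_derivative wave_dy \<beta> p u * wave \<beta> x y u) (at y)" for y u
  proof -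
    have "((\<lambda>z. p u * exp (- (of_real \<beta> * z * of_real (cosh u)) + \<i> * of_real (\<beta> * x * sinh u))) has_field_derivative
       wave_dy \<beta> p u * wave \<beta> x y u) (at (of_real y))"
      unfolding wave_def wave_dx_def wave_dy_def by (auto intro!: derivative_eq_intros)
    from has_vector_derivative_real_field[OF this] show ?thesis by (simp add: wave_def)
  qed
  show "norm (wave_dy \<beta> p u * wave \<beta> x y' u) \<le> A * \<beta> * (cosh u ^ Suc n * exp (- (\<beta> * (y/2)) * cosh u))"
    if "y' \<in> {y/2<..}" for y' u
  proof -
    have A: "0 \<le> A * \<beta> * cosh u ^ Suc n" using bd[of u] norm_ge_zero order_trans by blast
    have "norm (wave_dy \<beta> p u * wave \<beta> x y' u) \<le> A * \<beta> * cosh u ^ Suc n * exp (- (\<beta> * y') * cosh u)"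
      using mult_right_mono[OF bd[of u], of "exp (- (\<beta> * y') * cosh u)"] by (simp only: norm_mult norm_wave exp_ge_zero simp_thms)
    also have "\<dots> \<le> A * \<beta> * cosh u ^ Suc n * exp (- (\<beta> * (y/2)) * cosh u)"
      using that \<beta> A by (intro mult_left_mono) auto
    finally show ?thesis by (simp only: mult.assoc)
  qed
  show "(\<lambda>u. wave_dy \<beta> p u * wave \<beta> x y u) \<in> borel_measurable lborel"
    using p(1) unfolding wave_dx_def wave_dy_def by (simp, intro borel_measurable_continuous_onI continuous_intros)
  show "integrable lborel (\<lambda>u. A * \<beta> * (cosh u ^ Suc n * exp (- (\<beta> * (y/2)) * cosh u)))"
    by (intro integrable_mult_right integrable_cosh_exp) (use \<beta> y in auto)
qed (use integrable_wave[OF \<beta> _ p] y in auto)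

text \<open>The angle is measured from the vertical axis. The half plane is then
  \<open>\<bar>\<phi>\<bar> < pi / 2\<close>, exactly the range in which the line of integration may
  be shifted.\<close>

lemma polar_half_plane:
  assumes "y > (0::real)"
  obtains \<phi> where "\<bar>\<phi>\<bar> < pi / 2" "x = sqrt (x\<^sup>2 + y\<^sup>2) * sin \<phi>" "y = sqrt (x\<^sup>2 + y\<^sup>2) * cos \<phi>"
proof
  define t where "t = x / y"
  have "x\<^sup>2 + y\<^sup>2 = y\<^sup>2 * (1 + t\<^sup>2)" using assms by (simp add: t_def field_simps)
  then have r: "sqrt (x\<^sup>2 + y\<^sup>2) = y * sqrt (1 + t\<^sup>2)" using assms by (simp add: real_sqrt_mult)
  have s: "sqrt (1 + t\<^sup>2) > 0" by (simp add: add_pos_nonneg)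
  show "\<bar>arctan t\<bar> < pi / 2" using arctan_bounded[of t] by auto
  show "x = sqrt (x\<^sup>2 + y\<^sup>2) * sin (arctan t)"
    unfolding r sin_arctan using s assms by (simp add: t_def)
  show "y = sqrt (x\<^sup>2 + y\<^sup>2) * cos (arctan t)"
    unfolding r cos_arctan using s assms by simp
qed

text \<open>In polar coordinates the exponent of the wave is
  \<open>- \<beta> * r * cosh (u - \<i> * \<phi>)\<close>, and \<open>exp (a * u)\<close> is the
  phase \<open>cis (a * \<phi>)\<close> times \<open>exp (a * (u - \<i> * \<phi>))\<close>. Shifting
  the line back to the real axis removes the oscillation. The angle obtained is \<open>a\<close>
  times the polar angle, hence 0 for \<open>a = 0\<close>.\<close>

lemma wave_integral_polar:
  assumes \<beta>: "\<beta> > 0" and y: "y > 0" and a: "\<bar>a\<bar> \<le> 2"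
  obtains \<phi> where "wave_integral \<beta> (\<lambda>u. of_real (exp (a * u))) x y
    = cis \<phi> * of_real (LBINT u. exp (a * u - \<beta> * sqrt (x\<^sup>2 + y\<^sup>2) * cosh u))" "a = 0 \<Longrightarrow> \<phi> = 0"
proof -
  obtain \<phi> where \<phi>: "\<bar>\<phi>\<bar> < pi / 2" "x = sqrt (x\<^sup>2 + y\<^sup>2) * sin \<phi>" "y = sqrt (x\<^sup>2 + y\<^sup>2) * cos \<phi>"
    using polar_half_plane[OF y] by blast
  define r where "r = sqrt (x\<^sup>2 + y\<^sup>2)"
  define z where "z = \<beta> * r"
  have r: "r > 0" using y by (simp add: r_def add_nonneg_pos)
  then have z: "z > 0" using \<beta> by (simp add: z_def)
  have "of_real (exp (a * u)) * wave \<beta> x y u = cis (a * \<phi>) * cosh_kernel a z \<phi> u" for u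
  proof -
    have "x = r * sin \<phi>" "y = r * cos \<phi>" using \<phi> by (simp_all add: r_def)
    then have "of_real (- \<beta> * y * cosh u) + \<i> * of_real (\<beta> * x * sinh u) = - of_real z * cosh (of_real u - \<i> * of_real \<phi>)"
      by (simp add: complex_eq_iff z_def cosh_field_def sinh_field_def Re_exp Im_exp field_simps)
    then have w: "wave \<beta> x y u = exp (- of_real z * cosh (of_real u - \<i> * of_real \<phi>))" by (simp only: wave_def)
    show ?thesis unfolding w cosh_kernel_def
      by (simp add: cis_conv_exp exp_of_real[symmetric] algebra_simps flip: exp_add)
  qed
  then have "wave_integral \<beta> (\<lambda>u. of_real (exp (a * u))) x y = cis (a * \<phi>) * (LBINT u. cosh_kernel a z \<phi> u)"
    unfolding wave_integral_def by simp
  then have "wave_integral \<beta> (\<lambda>u. of_real (exp (a * u))) x y = cis (a * \<phi>) * of_real (LBINT u. exp (a * u - z * cosh u))"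
    by (simp only: integral_cosh_kernel[OF z \<phi>(1) a])
  then show thesis by (intro that[of "a * \<phi>"]) (auto simp: z_def r_def mult.assoc)
qed

lemma bessel_K0_wave:
  assumes "\<beta> > 0" "y > 0"
  shows "bessel_K0 (\<beta> * sqrt (x\<^sup>2 + y\<^sup>2)) = Re (wave_integral \<beta> (\<lambda>u. 1) x y) / 2"
proof -
  obtain \<phi> where "wave_integral \<beta> (\<lambda>u. of_real (exp (0 * u))) x y
    = cis \<phi> * of_real (LBINT u. exp (0 * u - \<beta> * sqrt (x\<^sup>2 + y\<^sup>2) * cosh u))" "0 = (0::real) \<Longrightarrow> \<phi> = 0"
    by (rule wave_integral_polar[OF assms, of 0 x]) auto
  moreover have "sqrt (x\<^sup>2 + y\<^sup>2) > 0" using assms(2) by (simp add: add_nonneg_pos)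
  ultimately show ?thesis using assms by (simp add: bessel_K0_eq)
qed

text \<open>After the shift the exponent contains the full radius \<open>r\<close>. Since
  \<open>r\<close> is at least \<open>\<bar>x\<bar>\<close> and at least \<open>y\<close>, half of
  it supplies the decay in \<open>x\<close> and the other half the integrability in
  \<open>u\<close>.\<close>

lemma norm_wave_integral_exp_le:
  assumes \<beta>: "\<beta> > 0" and y: "y > 0" and a: "\<bar>a\<bar> \<le> 2"
  shows "norm (wave_integral \<beta> (\<lambda>u. of_real (exp (a * u))) x y)
     \<le> exp (- (\<beta> / 2) * \<bar>x\<bar>) * (LBINT u. 4 * (cosh u ^ 2 * exp (- (\<beta> * y / 2) * cosh u)))"
proof -
  define r where "r = sqrt (x\<^sup>2 + y\<^sup>2)"
  have r: "r \<ge> y" "r \<ge> \<bar>x\<bar>" by (auto simp: r_def intro!: real_le_rsqrt)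
  obtain \<phi> where "wave_integral \<beta> (\<lambda>u. of_real (exp (a * u))) x y
    = cis \<phi> * of_real (LBINT u. exp (a * u - \<beta> * r * cosh u))"
    unfolding r_def by (rule wave_integral_polar[OF \<beta> y a])
  then have "norm (wave_integral \<beta> (\<lambda>u. of_real (exp (a * u))) x y) = norm (LBINT u. exp (a * u - \<beta> * r * cosh u))"
    by (simp add: norm_mult)
  also have "\<dots> \<le> (LBINT u. exp (- (\<beta> / 2) * \<bar>x\<bar>) * (4 * (cosh u ^ 2 * exp (- (\<beta> * y / 2) * cosh u))))"
  proof (rule Bochner_Integration.integral_norm_bound_integral)
    show i: "integrable lborel (\<lambda>u. exp (- (\<beta> / 2) * \<bar>x\<bar>) * (4 * (cosh u ^ 2 * exp (- (\<beta> * y / 2) * cosh u))))"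
      by (intro integrable_mult_right integrable_cosh_exp) (use \<beta> y in auto)
    show bd: "norm (exp (a * u - \<beta> * r * cosh u)) \<le> exp (- (\<beta> / 2) * \<bar>x\<bar>) * (4 * (cosh u ^ 2 * exp (- (\<beta> * y / 2) * cosh u)))" for u
    proof -
      have "r * 1 \<le> r * cosh u" using r y cosh_real_ge_1[of u] by (intro mult_left_mono) auto
      moreover have "y * cosh u \<le> r * cosh u" using r by (intro mult_right_mono) auto
      ultimately have "\<bar>x\<bar> + y * cosh u \<le> 2 * (r * cosh u)" using r by linarith
      then have "\<beta> / 2 * (\<bar>x\<bar> + y * cosh u) \<le> \<beta> / 2 * (2 * (r * cosh u))" using \<beta> by (intro mult_left_mono) auto
      then have "exp (a * u - \<beta> * r * cosh u) \<le> exp (a * u + (- (\<beta> / 2) * \<bar>x\<bar> - (\<beta> * y / 2) * cosh u))"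
        by (simp add: algebra_simps)
      also have "\<dots> = exp (- (\<beta> / 2) * \<bar>x\<bar>) * (exp (a * u) * exp (- (\<beta> * y / 2) * cosh u))"
        by (simp flip: exp_add)
      also have "\<dots> \<le> exp (- (\<beta> / 2) * \<bar>x\<bar>) * (4 * cosh u ^ 2 * exp (- (\<beta> * y / 2) * cosh u))"
        by (intro mult_left_mono mult_right_mono exp_mult_le_cosh_square a) auto
      finally show ?thesis by (simp add: mult.assoc)
    qed
    show "integrable lborel (\<lambda>u. exp (a * u - \<beta> * r * cosh u))"
      by (rule integrable_lborel_bound[OF i _ bd]) (intro continuous_intros)
  qed
  finally show ?thesis by simp
qed

section \<open>Fourier modes and their row sums\<close>

definition rho :: "real \<Rightarrow> real \<Rightarrow> real" where
  "rho \<beta> k = sqrt (k\<^sup>2 + \<beta>\<^sup>2)"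

text \<open>The entries (1,1), (1,2) = (2,1) and (2,2) of the Fourier symbol of the modified Stokeslet are
  indexed by 0, 1 and 2. At \<open>\<beta> = k = 0\<close> the third one is 0 because of \<open>0 / 0 = 0\<close>.\<close>

definition symb :: "nat \<Rightarrow> real \<Rightarrow> real \<Rightarrow> complex" where
  "symb n \<beta> k = (if n = 0 then of_real (rho \<beta> k) else if n = 1 then \<i> * of_real k
     else - of_real (k\<^sup>2 / rho \<beta> k))"

definition mode :: "nat \<Rightarrow> real \<Rightarrow> real \<Rightarrow> real \<Rightarrow> complex" where
  "mode n \<beta> y k = symb n \<beta> k * of_real (exp (- (rho \<beta> k * y)))"

definition mode_integral :: "nat \<Rightarrow> real \<Rightarrow> real \<Rightarrow> real \<Rightarrow> complex" where
  "mode_integral n \<beta> x y = (LBINT k. mode n \<beta> y k * cis (k * x))"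

lemma rho_nonneg [simp]: "rho \<beta> k \<ge> 0"
  by (simp add: rho_def)

lemma rho_0 [simp]: "rho 0 k = \<bar>k\<bar>"
  by (simp add: rho_def)

lemma abs_le_rho: "\<bar>k\<bar> \<le> rho \<beta> k"
  by (simp add: rho_def real_le_rsqrt)

lemma rho_pos: "\<beta> > 0 \<Longrightarrow> rho \<beta> k > 0"
  by (simp add: rho_def add_nonneg_pos)

lemma rho_minus [simp]: "rho \<beta> (- k) = rho \<beta> k"
  by (simp add: rho_def)

lemma rho_sinh:
  assumes "\<beta> > 0"
  shows "rho \<beta> (\<beta> * sinh u) = \<beta> * cosh u"
proof -
  have "(\<beta> * sinh u)\<^sup>2 + \<beta>\<^sup>2 = (\<beta> * cosh u)\<^sup>2"
    by (simp add: power_mult_distrib cosh_square_eq algebra_simps)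
  then show ?thesis using assms by (simp add: rho_def)
qed

lemma continuous_on_rho [continuous_intros]: "continuous_on A (rho \<beta>)"
  unfolding rho_def by (intro continuous_intros)

lemma norm_symb_le: "norm (symb n \<beta> k) \<le> rho \<beta> k"
proof -
  have "k\<^sup>2 / rho \<beta> k \<le> rho \<beta> k"
  proof (cases "rho \<beta> k = 0")
    case False
    then have "rho \<beta> k > 0" using rho_nonneg[of \<beta> k] by linarith
    moreover have "k\<^sup>2 \<le> (rho \<beta> k)\<^sup>2" using abs_le_rho[of k \<beta>] by (simp add: abs_le_square_iff[symmetric])
    ultimately show ?thesis by (simp add: divide_le_eq power2_eq_square)
  qed simp
  then show ?thesis using abs_le_rho[of k \<beta>] by (simp add: symb_def norm_mult norm_divide norm_power)
qed

text \<open>Half of the exponent absorbs the growth of the symbol, the other half remains. The bound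
  is uniform in \<beta>.\<close>

lemma norm_mode_le:
  assumes y: "y > 0"
  shows "norm (mode n \<beta> y k) \<le> 2 / y * exp (- (y / 2) * \<bar>k\<bar>)"
proof -
  let ?r = "rho \<beta> k"
  have "?r * y / 2 \<le> exp (?r * y / 2)" using exp_ge_add_one_self[of "?r * y / 2"] by linarith
  then have 1: "?r \<le> 2 / y * exp (?r * y / 2)" using y by (simp add: field_simps)
  have "norm (mode n \<beta> y k) \<le> ?r * exp (- (?r * y))"
    unfolding mode_def norm_mult using norm_symb_le[of n \<beta> k] by (intro mult_mono) auto
  also have "\<dots> \<le> 2 / y * exp (?r * y / 2) * exp (- (?r * y))"
    using 1 by (intro mult_right_mono) auto
  also have "\<dots> = 2 / y * exp (- (y / 2) * ?r)" by (simp add: mult.assoc field_simps flip: exp_add)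
  also have "\<dots> \<le> 2 / y * exp (- (y / 2) * \<bar>k\<bar>)"
    using abs_le_rho[of k \<beta>] y by (intro mult_left_mono) auto
  finally show ?thesis .
qed

lemma continuous_on_mode: 
  assumes "\<beta> \<ge> 0"
  shows "continuous_on UNIV (mode n \<beta> y)"
proof (cases "\<beta> = 0 \<and> n \<noteq> 0 \<and> n \<noteq> 1")
  case True
  have "k\<^sup>2 / \<bar>k\<bar> = \<bar>k\<bar>" for k :: real
    by (cases "k = 0") (auto simp: power2_eq_square abs_if)
  then have "mode n \<beta> y = (\<lambda>k. - of_real \<bar>k\<bar> * of_real (exp (- (\<bar>k\<bar> * y))))"
    using True by (simp add: fun_eq_iff mode_def symb_def)
  then show ?thesis by (auto intro!: continuous_intros)
next
  case False
  show ?thesis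
  proof (cases "n = 0 \<or> n = 1")
    case True
    then show ?thesis unfolding mode_def[abs_def] symb_def[abs_def]
      by (auto intro!: continuous_intros)
  next
    case n: False
    with False assms have "\<beta> > 0" by auto
    then have "rho \<beta> k \<noteq> 0" for k using rho_pos[of \<beta> k] by simp
    then show ?thesis using n unfolding mode_def[abs_def] symb_def[abs_def]
      by (auto intro!: continuous_intros)
  qed
qed

lemma integrable_mode_cis:
  assumes "\<beta> \<ge> 0" "y > 0"
  shows "integrable lborel (\<lambda>k. mode n \<beta> y k * cis (k * x))"
proof (rule integrable_exp_dominated[where c = "y / 2" and C = "2 / y"])
  show "(\<lambda>k. mode n \<beta> y k * cis (k * x)) \<in> borel_measurable borel"
    by (intro borel_measurable_continuous_onI continuous_intros continuous_on_mode assms)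
qed (use assms norm_mode_le[of y n \<beta>] in \<open>auto simp: norm_mult\<close>)

lemma mode_minus: "mode n \<beta> y (- k) = cnj (mode n \<beta> y k)"
  by (simp add: mode_def symb_def)

lemma mode_integral_real: "Im (mode_integral n \<beta> x y) = 0"
proof -
  have "cnj (mode_integral n \<beta> x y) = (LBINT k. cnj (mode n \<beta> y k * cis (k * x)))"
    unfolding mode_integral_def by (rule Bochner_Integration.integral_cnj[symmetric])
  also have "\<dots> = mode_integral n \<beta> x y"
    unfolding mode_integral_def
    by (subst (2) lborel_integral_real_affine[where c = "-1" and t = 0]) (auto simp: mode_minus cis_cnj)
  finally show ?thesis by (simp add: complex_eq_iff)
qed

text \<open>Substitution \<open>k = \<beta> * sinh u\<close>; the Jacobian
  \<open>\<beta> * cosh u\<close> joins the symbol in the weight.\<close>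

lemma mode_integral_eq_wave_integral:
  assumes \<beta>: "\<beta> > 0" and y: "y > 0"
  shows "mode_integral n \<beta> x y = wave_integral \<beta> (\<lambda>u. symb n \<beta> (\<beta> * sinh u) * of_real (\<beta> * cosh u)) x y"
proof -
  define f where "f k = mode n \<beta> y k * cis (k * x)" for k
  have int: "integrable lborel f" unfolding f_def using integrable_mode_cis[of \<beta> y] assms by auto
  have surj: "range (\<lambda>u. \<beta> * sinh u) = UNIV"
  proof -
    have "k = \<beta> * sinh (arsinh (k / \<beta>))" for k using \<beta> by simp
    then show ?thesis by blast
  qed
  have fabs: "f absolutely_integrable_on UNIV \<and> integral UNIV f = mode_integral n \<beta> x y"
  proof
    show "f absolutely_integrable_on UNIV"
      unfolding set_integrable_def using int by (subst integrable_completion) auto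
    show "integral UNIV f = mode_integral n \<beta> x y"
      unfolding integral_lborel[OF int] by (simp add: mode_integral_def f_def[abs_def])
  qed
  have sub: "\<bar>\<beta> * cosh u\<bar> *\<^sub>R f (\<beta> * sinh u) = symb n \<beta> (\<beta> * sinh u) * of_real (\<beta> * cosh u) * wave \<beta> x y u" for u
    using \<beta> by (simp add: f_def mode_def wave_def rho_sinh[OF \<beta>] scaleR_conv_of_real cis_conv_exp abs_mult mult_exp_exp exp_of_real[symmetric] mult_ac)
  have "(\<lambda>u. \<bar>\<beta> * cosh u\<bar> *\<^sub>R f (\<beta> * sinh u)) absolutely_integrable_on UNIV \<and>
     integral UNIV (\<lambda>u. \<bar>\<beta> * cosh u\<bar> *\<^sub>R f (\<beta> * sinh u)) = mode_integral n \<beta> x y"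
  proof (subst has_absolute_integral_change_of_variables_real)
    show "inj (\<lambda>u. \<beta> * sinh u)" using \<beta> by (auto simp: inj_on_def)
  qed (use fabs in \<open>auto simp: surj intro!: derivative_eq_intros\<close>)
  then have I: "integral UNIV (\<lambda>u. symb n \<beta> (\<beta> * sinh u) * of_real (\<beta> * cosh u) * wave \<beta> x y u) = mode_integral n \<beta> x y"
    unfolding sub by blast
  have "integrable lborel (\<lambda>u. symb n \<beta> (\<beta> * sinh u) * of_real (\<beta> * cosh u) * wave \<beta> x y u)"
  proof (rule integrable_wave[OF \<beta> y])
    show "continuous_on UNIV (\<lambda>u. symb n \<beta> (\<beta> * sinh u) * of_real (\<beta> * cosh u))"
      using rho_pos[OF \<beta>] unfolding symb_def
      by (cases "n = 0"; cases "n = 1")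
         (auto intro!: continuous_intros continuous_on_compose2[OF continuous_on_rho[of UNIV \<beta>]] simp: less_imp_neq[symmetric])
    show "norm (symb n \<beta> (\<beta> * sinh u) * of_real (\<beta> * cosh u)) \<le> \<beta>\<^sup>2 * cosh u ^ 2" for u
      using mult_right_mono[OF norm_symb_le[of n \<beta> "\<beta> * sinh u"], of "\<beta> * cosh u"] \<beta> rho_sinh[OF \<beta>, of u]
      by (simp add: norm_mult power2_eq_square mult_ac)
  qed
  from integral_lborel[OF this] I show ?thesis by (simp add: wave_integral_def)
qed

text \<open>For k \<ge> 0 the integrand is \<open>s * k * exp (- k * w)\<close> with
  \<open>w = y - \<i> * x\<close>, whose integral over the half line is
  \<open>s / w\<^sup>2\<close>; the negative frequencies add the conjugate. The three values are
  twice the second derivatives -dyy, dxy and -dxx of log r, which is how the logarithmic part will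
  be recognized.\<close>

lemma mode_integral_0:
  assumes y: "y > 0"
  shows "mode_integral n 0 x y = of_real (if n = 0 then 2 * (y\<^sup>2 - x\<^sup>2) / (x\<^sup>2 + y\<^sup>2)\<^sup>2
     else if n = 1 then - 4 * x * y / (x\<^sup>2 + y\<^sup>2)\<^sup>2 else - 2 * (y\<^sup>2 - x\<^sup>2) / (x\<^sup>2 + y\<^sup>2)\<^sup>2)"
proof -
  define w where "w = Complex y (- x)"
  have wne: "w \<noteq> 0" using y by (simp add: w_def complex_eq_iff)
  define s where "s = (if n = 0 then 1 else if n = 1 then \<i> else -1)"
  define F where "F k = - s * (of_real k / w + 1 / w\<^sup>2) * exp (- of_real k * w)" for k :: real
  define f where "f k = mode n 0 y k * cis (k * x)" for k
  define g where "g k = s * of_real k * exp (- of_real k * w)" for k :: real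
  have int: "integrable lborel f" unfolding f_def using integrable_mode_cis[of 0 y] y by auto
  have k2: "k\<^sup>2 / \<bar>k\<bar> = \<bar>k\<bar>" for k :: real by (cases "k = 0") (auto simp: power2_eq_square abs_if)
  have fg: "f k = g k" if "k \<ge> 0" for k
  proof -
    have "of_real (exp (- (k * y))) * cis (k * x) = exp (- of_real k * w)"
      by (simp add: w_def cis_conv_exp exp_of_real[symmetric] complex_eq_iff Re_exp Im_exp flip: exp_add)
    then show ?thesis using that
      by (simp add: f_def g_def mode_def symb_def s_def power2_eq_square mult.assoc)
  qed
  have "(LBINT k:{0..}. g k) = 0 - F 0"
  proof (rule integral_derivative_Ici)
    show "(F has_vector_derivative g k) (at k)" for k
      unfolding F_def g_def
      by (rule has_vector_derivative_real_field)
         (use wne in \<open>auto intro!: derivative_eq_intros simp: field_simps power2_eq_square\<close>)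
    show "isCont g k" for k unfolding g_def by (intro continuous_intros)
    have "set_integrable lborel {0..} f" unfolding set_integrable_def by (rule integrable_mult_indicator[OF _ int]) simp
    then show "set_integrable lborel {0..} g"
      by (rule set_integrable_cong[THEN iffD1, rotated -1]) (auto simp: fg)
    show "(F \<longlongrightarrow> 0) at_top"
    proof (rule Lim_null_comparison)
      have ns: "norm s = 1" by (simp add: s_def)
      have Rw: "Re w = y" by (simp add: w_def)
      show "\<forall>\<^sub>F k in at_top. norm (F k) \<le> (k / norm w + 1 / (norm w)\<^sup>2) * exp (- k * y)"
        using eventually_ge_at_top[of 0]
      proof eventually_elim
        case (elim k)
        have "norm (of_real k / w + 1 / w\<^sup>2) \<le> k / norm w + 1 / (norm w)\<^sup>2"
          by (rule order_trans[OF norm_triangle_ineq]) (use elim in \<open>simp add: norm_divide norm_power\<close>)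
        moreover have "norm (exp (- of_real k * w)) = exp (- k * y)"
          by (simp add: norm_exp_eq_Re Rw)
        ultimately show ?case unfolding F_def norm_mult
          using ns by (simp add: mult_right_mono Rw)
      qed
      show "((\<lambda>k. (k / norm w + 1 / (norm w)\<^sup>2) * exp (- k * y)) \<longlongrightarrow> 0) at_top"
        using y wne by real_asymp
    qed
  qed
  then have half: "(LBINT k:{0..}. f k) = s / w\<^sup>2"
    by (subst set_lebesgue_integral_cong[where g = g]) (auto simp: fg F_def)
  have "(LBINT k. f k) = s / w\<^sup>2 + cnj (s / w\<^sup>2)"
  proof -
    have "f (- k) = cnj (f k)" for k by (simp add: f_def mode_minus cis_cnj)
    moreover have "(LBINT k:{0..}. cnj (f k)) = cnj (LBINT k:{0..}. f k)"
      unfolding set_lebesgue_integral_def Bochner_Integration.integral_cnj[symmetric] by simp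
    ultimately show ?thesis using integral_split_Ici[OF int] half by simp
  qed
  also have "\<dots> = of_real (2 * Re (s / w\<^sup>2))" by (rule complex_add_cnj)
  also have "s / w\<^sup>2 = s * Complex (y\<^sup>2 - x\<^sup>2) (2 * x * y) / of_real ((x\<^sup>2 + y\<^sup>2)\<^sup>2)"
  proof -
    have "Complex (y\<^sup>2 - x\<^sup>2) (2 * x * y) * w\<^sup>2 = of_real ((x\<^sup>2 + y\<^sup>2)\<^sup>2)"
      by (simp add: w_def complex_eq_iff power2_eq_square algebra_simps)
    moreover have "complex_of_real ((x\<^sup>2 + y\<^sup>2)\<^sup>2) \<noteq> 0"
      using y by (simp only: of_real_eq_0_iff) (simp add: add_nonneg_eq_0_iff)
    ultimately show ?thesis using wne by (simp add: frac_eq_eq mult_ac)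
  qed
  also have "2 * Re (s * Complex (y\<^sup>2 - x\<^sup>2) (2 * x * y) / of_real ((x\<^sup>2 + y\<^sup>2)\<^sup>2)) = (if n = 0 then 2 * (y\<^sup>2 - x\<^sup>2) / (x\<^sup>2 + y\<^sup>2)\<^sup>2
     else if n = 1 then - 4 * x * y / (x\<^sup>2 + y\<^sup>2)\<^sup>2 else - 2 * (y\<^sup>2 - x\<^sup>2) / (x\<^sup>2 + y\<^sup>2)\<^sup>2)"
    unfolding Re_divide_of_real s_def by simp
  finally show ?thesis by (simp add: mode_integral_def f_def)
qed


section \<open>Decay and summability along a row of sources\<close>

lemma summable_on_inverse_square_int: "(\<lambda>m::int. 1 / (1 + (real_of_int m)\<^sup>2)) summable_on UNIV"
proof -
  have s: "summable (\<lambda>n. inverse ((real (Suc n))\<^sup>2))"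
    using inverse_power_summable[of 2, where 'a = real] by (subst summable_Suc_iff) auto
  have "summable (\<lambda>n. 1 / (1 + (real n)\<^sup>2))"
  proof (subst summable_Suc_iff[symmetric], rule summable_comparison_test'[OF s, of 0])
    show "norm (1 / (1 + (real (Suc n))\<^sup>2)) \<le> inverse ((real (Suc n))\<^sup>2)" for n
      by (simp add: divide_simps add_nonneg_pos add_pos_nonneg)
  qed
  then have 1: "(\<lambda>n. 1 / (1 + (real n)\<^sup>2)) summable_on UNIV"
    by (intro summable_nonneg_imp_summable_on) auto
  have "summable (\<lambda>n. 1 / (1 + (real (Suc n))\<^sup>2))"
    using \<open>summable (\<lambda>n. 1 / (1 + (real n)\<^sup>2))\<close> by (subst summable_Suc_iff)
  then have 2: "(\<lambda>n. 1 / (1 + (real (Suc n))\<^sup>2)) summable_on UNIV"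
    by (intro summable_nonneg_imp_summable_on) auto
  have "((\<lambda>m::int. 1 / (1 + (real_of_int m)\<^sup>2)) has_sum (\<Sum>\<^sub>\<infinity>n. 1 / (1 + (real n)\<^sup>2)) + (\<Sum>\<^sub>\<infinity>n. 1 / (1 + (real (Suc n))\<^sup>2))) UNIV"
  proof (rule has_sum_int_split)
    have "(real_of_int (- int (Suc n)))\<^sup>2 = (real (Suc n))\<^sup>2" for n
      by (simp only: of_int_minus of_int_of_nat_eq power2_minus)
    then show "((\<lambda>n. 1 / (1 + (real_of_int (- int (Suc n)))\<^sup>2)) has_sum (\<Sum>\<^sub>\<infinity>n. 1 / (1 + (real (Suc n))\<^sup>2))) UNIV"
      by (simp only: has_sum_infsum[OF 2])
    show "((\<lambda>n. 1 / (1 + (real_of_int (int n))\<^sup>2)) has_sum (\<Sum>\<^sub>\<infinity>n. 1 / (1 + (real n)\<^sup>2))) UNIV"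
      by (simp only: of_int_of_nat_eq has_sum_infsum[OF 1])
  qed
  then show ?thesis by (rule has_sum_imp_summable)
qed

lemma summable_on_lattice_row:
  fixes d x y :: real
  assumes d: "d > 0" and y: "y > 0"
  shows "(\<lambda>m::int. 1 / ((x - of_int m * d)\<^sup>2 + y\<^sup>2)) summable_on UNIV"
proof (rule summable_on_comparison_test)
  define K where "K = (1 + 2 * x\<^sup>2 / d\<^sup>2) / y\<^sup>2 + 2 / d\<^sup>2"
  show "(\<lambda>m::int. K * (1 / (1 + (real_of_int m)\<^sup>2))) summable_on UNIV"
    by (rule summable_on_cmult_right[OF summable_on_inverse_square_int])
  fix m :: int
  define v where "v = x - of_int m * d"
  \<comment> \<open>Here \<open>of_int m * d = x - v\<close>, and \<open>(x - v)\<^sup>2 + (x +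
    v)\<^sup>2 = 2 * x\<^sup>2 + 2 * v\<^sup>2\<close>.\<close>
  have "(of_int m * d)\<^sup>2 \<le> 2 * x\<^sup>2 + 2 * v\<^sup>2"
    using zero_le_power2[of "x + v"] by (simp add: v_def power2_eq_square algebra_simps)
  then have "(real_of_int m)\<^sup>2 \<le> 2 * x\<^sup>2 / d\<^sup>2 + 2 / d\<^sup>2 * v\<^sup>2"
    using d by (simp add: field_simps)
  then have "1 + (real_of_int m)\<^sup>2 \<le> (1 + 2 * x\<^sup>2 / d\<^sup>2) + 2 / d\<^sup>2 * v\<^sup>2" by simp
  also have "(1 + 2 * x\<^sup>2 / d\<^sup>2) = (1 + 2 * x\<^sup>2 / d\<^sup>2) / y\<^sup>2 * y\<^sup>2" using y by simp
  also have "\<dots> \<le> (1 + 2 * x\<^sup>2 / d\<^sup>2) / y\<^sup>2 * (v\<^sup>2 + y\<^sup>2)"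
    by (intro mult_left_mono) auto
  also have "(1 + 2 * x\<^sup>2 / d\<^sup>2) / y\<^sup>2 * (v\<^sup>2 + y\<^sup>2) + 2 / d\<^sup>2 * v\<^sup>2 \<le> (1 + 2 * x\<^sup>2 / d\<^sup>2) / y\<^sup>2 * (v\<^sup>2 + y\<^sup>2) + 2 / d\<^sup>2 * (v\<^sup>2 + y\<^sup>2)"
    by (intro add_left_mono mult_left_mono) auto
  also have "\<dots> = K * (v\<^sup>2 + y\<^sup>2)" by (simp add: K_def algebra_simps)
  finally have "1 + (real_of_int m)\<^sup>2 \<le> K * (v\<^sup>2 + y\<^sup>2)" by simp
  moreover have "v\<^sup>2 + y\<^sup>2 > 0" using y by (simp add: add_nonneg_pos)
  moreover have "1 + (real_of_int m)\<^sup>2 > 0" by (simp add: add_pos_nonneg)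
  ultimately show "1 / ((x - of_int m * d)\<^sup>2 + y\<^sup>2) \<le> K * (1 / (1 + (real_of_int m)\<^sup>2))"
    unfolding v_def[symmetric] by (simp add: field_simps)
qed auto

lemma norm_mode_integral_0_le:
  assumes "y > 0"
  shows "norm (mode_integral n 0 x y) \<le> 2 / (x\<^sup>2 + y\<^sup>2)"
proof -
  let ?r = "x\<^sup>2 + y\<^sup>2"
  have r: "?r > 0" using assms by (simp add: add_nonneg_pos)
  have "\<bar>2 * (y\<^sup>2 - x\<^sup>2)\<bar> \<le> 2 * ?r" "\<bar>- 2 * (y\<^sup>2 - x\<^sup>2)\<bar> \<le> 2 * ?r"
    by (auto simp: abs_le_iff)
  moreover have "\<bar>- 4 * x * y\<bar> \<le> 2 * ?r"
    using sum_squares_bound[of x y] sum_squares_bound[of "-x" y] by (auto simp: abs_le_iff)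
  moreover define c where "c = (if n = 0 then 2 * (y\<^sup>2 - x\<^sup>2) else if n = 1 then - 4 * x * y else - 2 * (y\<^sup>2 - x\<^sup>2))"
  ultimately have "\<bar>c\<bar> \<le> 2 * ?r" by simp
  moreover have "mode_integral n 0 x y = of_real (c / ?r\<^sup>2)"
    by (simp add: mode_integral_0[OF assms] c_def)
  ultimately have c: "mode_integral n 0 x y = of_real (c / ?r\<^sup>2)" "\<bar>c\<bar> \<le> 2 * ?r" by auto
  then have "norm (mode_integral n 0 x y) \<le> 2 * ?r / ?r\<^sup>2"
    by (simp only: norm_of_real abs_divide abs_power2) (intro divide_right_mono, auto)
  also have "\<dots> = 2 / ?r"
  proof -
    have "2 * c / c\<^sup>2 = 2 / c" if "c > 0" for c :: real
      using that by (simp add: power2_eq_square)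
    from this[OF r] show ?thesis .
  qed
  finally show ?thesis .
qed

lemma integrable_exp_wave:
  assumes "\<beta> > 0" "y > 0" "\<bar>a\<bar> \<le> 2"
  shows "integrable lborel (\<lambda>u. of_real (exp (a * u)) * wave \<beta> x y u)"
  by (rule integrable_wave[OF assms(1,2), of _ 4 2])
     (use exp_mult_le_cosh_square[OF assms(3)] in \<open>auto intro!: continuous_intros\<close>)

text \<open>The squares and products of \<open>cosh\<close> and \<open>sinh\<close> in the weight
  are combinations of \<open>exp (a * u)\<close> with \<open>a\<close> in {-2, 0, 2}, and each of
  these decays in \<open>x\<close> by the polar form; the norm of the wave alone shows no such
  decay. The constant may depend on \<beta> and \<open>y\<close>, since it serves only the
  convergence of a single row.\<close>

lemma mode_integral_exp_decay:
  assumes \<beta>: "\<beta> > 0" and y: "y > 0"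
  obtains C where "\<And>x. norm (mode_integral n \<beta> x y) \<le> C * exp (- (\<beta> / 2) * \<bar>x\<bar>)"
proof -
  define K where "K = (LBINT u. 4 * (cosh u ^ 2 * exp (- (\<beta> * y / 2) * cosh u)))"
  define e where "e a = (\<lambda>u. complex_of_real (exp (a * u)))" for a :: real
  note rho = rho_sinh[OF \<beta>]
  \<comment> \<open>The coefficients of \<open>exp (a * u)\<close> in \<open>\<beta>\<^sup>2\<close>
    times \<open>cosh u ^ 2\<close>, \<open>\<i> * sinh u * cosh u\<close> and
    \<open>- (sinh u ^ 2)\<close>.\<close>
  define C where "C a = (if n = 0 then \<beta>\<^sup>2 / (if a = 0 then 2 else 4) else if n = 1 then \<i> * \<beta>\<^sup>2 / 4 * of_real (sgn a)
    else \<beta>\<^sup>2 / (if a = 0 then 2 else - 4) :: complex)" for a :: real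
  have exp2: "exp (2 * u) = exp u * exp u" "exp (u * 2) = exp u * exp u" "exp (- 2 * u) = exp (- u) * exp (- u)"
    "exp (- (2 * u)) = exp (- u) * exp (- u)" "exp (- (u * 2)) = exp (- u) * exp (- u)" for u :: real
    by (simp_all flip: exp_add)
  have ee: "exp u * exp (- u) = 1" for u :: real by (simp flip: exp_add)
  have c2: "of_real (cosh u * cosh u) = (e 2 u + 2 * e 0 u + e (-2) u) / 4" for u
    unfolding e_def exp2 using ee[of u] by (simp add: cosh_field_def exp2 algebra_simps flip: of_real_mult)
  have s2: "of_real (sinh u * sinh u) = (e 2 u - 2 * e 0 u + e (-2) u) / 4" for u
    unfolding e_def exp2 using ee[of u] by (simp add: sinh_field_def exp2 algebra_simps flip: of_real_mult)
  have sc: "of_real (sinh u * cosh u) = (e 2 u - e (-2) u) / 4" for u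
    unfolding e_def exp2 using ee[of u] by (simp add: sinh_field_def cosh_field_def exp2 algebra_simps flip: of_real_mult)
  have symb: "symb n \<beta> (\<beta> * sinh u) * of_real (\<beta> * cosh u) = (\<Sum>a\<in>{-2, 0, 2}. C a * e a u)" for u
  proof -
    consider "n = 0" | "n = 1" | "n \<noteq> 0" "n \<noteq> 1" by auto
    then show ?thesis
    proof cases
      case 1
      have "symb n \<beta> (\<beta> * sinh u) * of_real (\<beta> * cosh u) = of_real (\<beta>\<^sup>2) * of_real (cosh u * cosh u)"
        using 1 by (simp add: symb_def rho power2_eq_square)
      then show ?thesis unfolding c2 using 1 by (simp add: C_def field_simps)
    next
      case 2
      have "symb n \<beta> (\<beta> * sinh u) * of_real (\<beta> * cosh u) = \<i> * of_real (\<beta>\<^sup>2) * of_real (sinh u * cosh u)"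
        using 2 by (simp add: symb_def power2_eq_square)
      then show ?thesis unfolding sc using 2 by (simp add: C_def field_simps)
    next
      case 3
      have "symb n \<beta> (\<beta> * sinh u) * of_real (\<beta> * cosh u) = - of_real (\<beta>\<^sup>2) * of_real (sinh u * sinh u)"
        using 3 \<beta> by (simp add: symb_def rho power2_eq_square field_simps)
      also have "\<dots> = (\<Sum>a\<in>{-2, 0, 2}. C a * e a u)"
        unfolding s2 using 3 by (simp add: C_def field_simps)
      finally show ?thesis .
    qed
  qed
  show thesis
  proof
    fix x
    have i: "integrable lborel (\<lambda>u. C a * (e a u * wave \<beta> x y u))" if "a \<in> {-2, 0, 2}" for a
      unfolding e_def using that by (intro integrable_mult_right integrable_exp_wave[OF \<beta> y]) auto
    have "mode_integral n \<beta> x y = (LBINT u. \<Sum>a\<in>{-2, 0, 2}. C a * (e a u * wave \<beta> x y u))"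
      unfolding mode_integral_eq_wave_integral[OF \<beta> y] wave_integral_def symb sum_distrib_right mult.assoc ..
    also have "\<dots> = (\<Sum>a\<in>{-2, 0, 2}. C a * wave_integral \<beta> (e a) x y)"
      unfolding wave_integral_def integral_mult_right_zero[symmetric] by (rule Bochner_Integration.integral_sum[OF i])
    also have "norm \<dots> \<le> (\<Sum>a\<in>{-2, 0, 2}. norm (C a) * (exp (- (\<beta> / 2) * \<bar>x\<bar>) * K))"
    proof (intro order_trans[OF norm_sum] sum_mono)
      fix a :: real assume "a \<in> {-2, 0, 2}"
      then show "norm (C a * wave_integral \<beta> (e a) x y) \<le> norm (C a) * (exp (- (\<beta> / 2) * \<bar>x\<bar>) * K)"
        unfolding e_def K_def norm_mult by (intro mult_left_mono norm_wave_integral_exp_le[OF \<beta> y]) auto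
    qed
    also have "\<dots> = (\<Sum>a\<in>{-2, 0, 2}. norm (C a) * K) * exp (- (\<beta> / 2) * \<bar>x\<bar>)"
      unfolding sum_distrib_right by (intro sum.cong refl) (simp only: mult_ac)
    finally show "norm (mode_integral n \<beta> x y) \<le> (\<Sum>a\<in>{-2, 0, 2}. norm (C a) * K) * exp (- (\<beta> / 2) * \<bar>x\<bar>)" .
  qed
qed

text \<open>For \<open>\<beta> = 0\<close> the kernel decays only quadratically in \<open>x\<close>,
  for \<open>\<beta> > 0\<close> exponentially, so the two cases have separate majorants.\<close>

lemma mode_integral_row_summable:
  assumes d: "d > 0" and \<beta>: "\<beta> \<ge> 0" and y: "y > 0"
  shows "(\<lambda>m::int. mode_integral n \<beta> (x - of_int m * d) y) summable_on UNIV"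
proof (rule abs_summable_summable, cases "\<beta> = 0")
  case True
  show "(\<lambda>m::int. norm (mode_integral n \<beta> (x - of_int m * d) y)) summable_on UNIV"
    unfolding True
    by (rule summable_on_comparison_test[OF summable_on_cmult_right[OF summable_on_lattice_row[OF d y, of x], of 2]])
       (use norm_mode_integral_0_le[OF y] in auto)
next
  case False
  with \<beta> have \<beta>: "\<beta> > 0" by simp
  obtain C where C: "\<And>x. norm (mode_integral n \<beta> x y) \<le> C * exp (- (\<beta> / 2) * \<bar>x\<bar>)"
    using mode_integral_exp_decay[OF \<beta> y] by blast
  have C0: "C \<ge> 0" using C[of 0] norm_ge_zero[of "mode_integral n \<beta> 0 y"] by (simp del: norm_ge_zero)
  show "(\<lambda>m::int. norm (mode_integral n \<beta> (x - of_int m * d) y)) summable_on UNIV"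
  proof (rule summable_on_comparison_test)
    show "(\<lambda>m::int. C * exp (\<beta> / 2 * \<bar>x\<bar>) * exp (- (\<beta> / 2 * d) * \<bar>real_of_int m\<bar>)) summable_on UNIV"
      by (intro summable_on_cmult_right summable_on_exp_neg_abs_int) (use \<beta> d in auto)
    fix m :: int
    have "\<bar>real_of_int m\<bar> * d - \<bar>x\<bar> \<le> \<bar>x - of_int m * d\<bar>"
      using abs_triangle_ineq2[of "of_int m * d" x] d by (simp add: abs_mult abs_minus_commute)
    then have "\<beta> / 2 * (\<bar>real_of_int m\<bar> * d - \<bar>x\<bar>) \<le> \<beta> / 2 * \<bar>x - of_int m * d\<bar>"
      using \<beta> by (intro mult_left_mono) auto
    then have "exp (- (\<beta> / 2) * \<bar>x - of_int m * d\<bar>) \<le> exp (\<beta> / 2 * \<bar>x\<bar>) * exp (- (\<beta> / 2 * d) * \<bar>real_of_int m\<bar>)"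
      by (simp add: algebra_simps flip: exp_add)
    then show "norm (mode_integral n \<beta> (x - of_int m * d) y) \<le> C * exp (\<beta> / 2 * \<bar>x\<bar>) * exp (- (\<beta> / 2 * d) * \<bar>real_of_int m\<bar>)"
      using order_trans[OF C mult_left_mono[OF _ C0]] by (simp add: mult.assoc)
  qed auto
qed

text \<open>Translation by \<open>m * d\<close> multiplies the integrand by
  \<open>cis (- (m * d * k))\<close>, so the row consists of values of a Fourier transform on a
  lattice; the dual lattice is that of the frequencies \<open>alpha d j\<close>.\<close>

lemma mode_integral_row_sum:
  assumes d: "d > 0" and \<beta>: "\<beta> \<ge> 0" and y: "y > 0"
  shows "((\<lambda>m::int. mode_integral n \<beta> (x - of_int m * d) y) has_sum
     of_real (2 * pi / d) * (\<Sum>\<^sub>\<infinity>j::int. mode n \<beta> y (alpha d j) * cis (alpha d j * x))) UNIV"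
proof -
  define h where "h k = mode n \<beta> y k * cis (k * x)" for k
  have eq: "(LBINT k. h k * cis (- (of_int m * d * k))) = mode_integral n \<beta> (x - of_int m * d) y" for m :: int
    unfolding h_def mode_integral_def
    by (rule Bochner_Integration.integral_cong) (auto simp: mult.assoc cis_mult algebra_simps)
  note summ = mode_integral_row_summable[OF assms, of n x]
  have "(\<Sum>\<^sub>\<infinity>m::int. LBINT k. h k * cis (- (of_int m * d * k))) = of_real (2 * pi / d) * (\<Sum>\<^sub>\<infinity>j::int. h (2 * pi * of_int j / d))"
  proof (rule poisson_summation[OF d, where c = "y / 2" and C = "2 / y"])
    show "continuous_on UNIV h" unfolding h_def
      by (intro continuous_intros continuous_on_mode \<beta>)
    show "norm (h k) \<le> 2 / y * exp (- (y / 2) * \<bar>k\<bar>)" for k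
      using norm_mode_le[OF y, of n \<beta> k] by (simp add: h_def norm_mult)
  qed (use y summ in \<open>auto simp: eq\<close>)
  then show ?thesis using summ unfolding eq by (simp add: has_sum_iff h_def alpha_def)
qed

section \<open>The modified Stokeslet in the upper half plane\<close>

lemma partial_deriv_1_eq:
  assumes f: "\<And>t :: real ^ 2. t $ 2 > 0 \<Longrightarrow> f t = F (t $ 1) (t $ 2)"
    and t: "t $ 2 > 0" and der: "((\<lambda>x. F x (t $ 2)) has_real_derivative D) (at (t $ 1))"
  shows "partial_deriv 1 f t = D"
proof -
  have eq: "(\<lambda>u. f (t + u *\<^sub>R axis 1 1)) = (\<lambda>u. F (t $ 1 + u) (t $ 2))"
    using t by (simp add: fun_eq_iff f axis_def)
  have "((\<lambda>u. F (t $ 1 + u) (t $ 2)) has_real_derivative D) (at 0)"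
    using DERIV_shift[of "\<lambda>x. F x (t $ 2)" D 0 "t $ 1"] der by (simp add: add.commute)
  then show ?thesis unfolding partial_deriv_def eq by (rule DERIV_imp_deriv)
qed

text \<open>Unlike a horizontal step, a vertical one may leave the half plane where \<open>f\<close>
  is known, so \<open>f\<close> is compared with \<open>F\<close> only for steps shorter than the
  height.\<close>

lemma partial_deriv_2_eq:
  assumes f: "\<And>t :: real ^ 2. t $ 2 > 0 \<Longrightarrow> f t = F (t $ 1) (t $ 2)"
    and t: "t $ 2 > 0" and der: "((\<lambda>y. F (t $ 1) y) has_real_derivative D) (at (t $ 2))"
  shows "partial_deriv 2 f t = D"
proof -
  have 1: "((\<lambda>u. F (t $ 1) (t $ 2 + u)) has_real_derivative D) (at 0)"
    using DERIV_shift[of "F (t $ 1)" D 0 "t $ 2"] der by (simp add: add.commute)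
  have "((\<lambda>u. f (t + u *\<^sub>R axis 2 1)) has_real_derivative D) (at 0)"
  proof (rule has_field_derivative_transform_within[OF 1 t])
    fix u :: real assume "dist u 0 < t $ 2"
    then have "(t + u *\<^sub>R axis 2 1) $ 2 > 0" by (auto simp: axis_def)
    from f[OF this] show "F (t $ 1) (t $ 2 + u) = f (t + u *\<^sub>R axis 2 1)"
      by (simp add: axis_def)
  qed auto
  then show ?thesis unfolding partial_deriv_def by (rule DERIV_imp_deriv)
qed

lemma norm_vec2: "norm (t :: real ^ 2) = sqrt ((t $ 1)\<^sup>2 + (t $ 2)\<^sup>2)"
  by (simp add: norm_vec_def L2_set_def UNIV_2)

lemma G_MB_wave:
  assumes "\<beta> > 0" "t $ 2 > 0"
  shows "G_MB \<beta> t = - (1 / (2 * pi * \<beta>\<^sup>2)) *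
     (Re (wave_integral \<beta> (\<lambda>u. 1) (t $ 1) (t $ 2)) / 2 + ln ((t $ 1)\<^sup>2 + (t $ 2)\<^sup>2) / 2)"
proof -
  have r: "(t $ 1)\<^sup>2 + (t $ 2)\<^sup>2 > 0" using assms(2) by (simp add: add_nonneg_pos)
  then have "ln (1 / norm t) = - (ln ((t $ 1)\<^sup>2 + (t $ 2)\<^sup>2) / 2)"
    by (simp add: norm_vec2 ln_div ln_sqrt)
  then show ?thesis
    using bessel_K0_wave[OF assms(1) assms(2), of "t $ 1"] by (simp add: G_MB_def norm_vec2)
qed

lemma has_real_derivative_Re:
  assumes "(f has_vector_derivative D) (at x)"
  shows "((\<lambda>x. Re (f x)) has_real_derivative Re D) (at x)"
  using bounded_linear.has_vector_derivative[OF bounded_linear_Re assms]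
  by (simp add: has_real_derivative_iff_has_vector_derivative)

lemma has_real_derivative_half_ln:
  assumes "x\<^sup>2 + c > (0::real)"
  shows "((\<lambda>x. ln (x\<^sup>2 + c) / 2) has_real_derivative x / (x\<^sup>2 + c)) (at x)"
proof -
  have "((\<lambda>x. x\<^sup>2 + c) has_real_derivative 2 * x) (at x)"
    by (auto intro!: derivative_eq_intros)
  note D = DERIV_cdivide[OF DERIV_chain2[OF DERIV_ln_divide[OF assms] this], of 2]
  have "1 / r * (2 * x) / 2 = x / r" for r :: real by simp
  with D show ?thesis by metis
qed

text \<open>The shape \<open>c * (Re (wave_integral \<beta> p x y) / 2 + L x y)\<close> is stable
  under both partial derivatives, so that it can be differentiated twice, starting from
  \<open>G_MB\<close>.\<close>

lemma partial_deriv_wave: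
  fixes L :: "real \<Rightarrow> real \<Rightarrow> real"
  assumes \<beta>: "\<beta> > 0" and t: "(t :: real ^ 2) $ 2 > 0"
    and p: "continuous_on UNIV p" "\<And>u. norm (p u) \<le> A * cosh u ^ n"
    and f: "\<And>t. t $ 2 > 0 \<Longrightarrow> f t = c * (Re (wave_integral \<beta> p (t $ 1) (t $ 2)) / 2 + L (t $ 1) (t $ 2))"
  shows "((\<lambda>x. L x (t $ 2)) has_real_derivative D) (at (t $ 1)) \<Longrightarrow>
      partial_deriv 1 f t = c * (Re (wave_integral \<beta> (wave_dx \<beta> p) (t $ 1) (t $ 2)) / 2 + D)"
    and "((\<lambda>y. L (t $ 1) y) has_real_derivative D) (at (t $ 2)) \<Longrightarrow>
      partial_deriv 2 f t = c * (Re (wave_integral \<beta> (wave_dy \<beta> p) (t $ 1) (t $ 2)) / 2 + D)"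
proof -
  let ?F = "\<lambda>x y. c * (Re (wave_integral \<beta> p x y) / 2 + L x y)"
  note F1 = partial_deriv_1_eq[where F = ?F, OF f t] and F2 = partial_deriv_2_eq[where F = ?F, OF f t]
  note W1 = DERIV_cdivide[OF has_real_derivative_Re[OF wave_integral_deriv_x[OF \<beta> t p]]]
    and W2 = DERIV_cdivide[OF has_real_derivative_Re[OF wave_integral_deriv_y[OF \<beta> t p]]]
  show "partial_deriv 1 f t = c * (Re (wave_integral \<beta> (wave_dx \<beta> p) (t $ 1) (t $ 2)) / 2 + D)"
    if "((\<lambda>x. L x (t $ 2)) has_real_derivative D) (at (t $ 1))"
    by (rule F1[OF _ DERIV_cmult[OF DERIV_add[OF W1 that]]])
  show "partial_deriv 2 f t = c * (Re (wave_integral \<beta> (wave_dy \<beta> p) (t $ 1) (t $ 2)) / 2 + D)"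
    if "((\<lambda>y. L (t $ 1) y) has_real_derivative D) (at (t $ 2))"
    by (rule F2[OF _ DERIV_cmult[OF DERIV_add[OF W2 that]]])
qed

lemma G_MB_partials:
  fixes \<beta> :: real
  assumes \<beta>: "\<beta> > 0" and t: "(t :: real ^ 2) $ 2 > 0"
  defines "c \<equiv> - (1 / (2 * pi * \<beta>\<^sup>2))"
  defines "x \<equiv> t $ 1" and "y \<equiv> t $ 2"
  defines "r \<equiv> x\<^sup>2 + y\<^sup>2"
  shows "partial_deriv 2 (partial_deriv 2 (G_MB \<beta>)) t =
      c * (Re (wave_integral \<beta> (wave_dy \<beta> (wave_dy \<beta> (\<lambda>u. 1))) x y) / 2 + (x\<^sup>2 - y\<^sup>2) / r\<^sup>2)"
    and "partial_deriv 1 (partial_deriv 2 (G_MB \<beta>)) t =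
      c * (Re (wave_integral \<beta> (wave_dx \<beta> (wave_dy \<beta> (\<lambda>u. 1))) x y) / 2 + - (2 * x * y) / r\<^sup>2)"
    and "partial_deriv 1 (partial_deriv 1 (G_MB \<beta>)) t =
      c * (Re (wave_integral \<beta> (wave_dx \<beta> (wave_dx \<beta> (\<lambda>u. 1))) x y) / 2 + (y\<^sup>2 - x\<^sup>2) / r\<^sup>2)"
proof -
  have rpos: "x\<^sup>2 + y\<^sup>2 > 0" if "y > 0" for x y :: real using that by (simp add: add_nonneg_pos)
  have p0: "continuous_on UNIV (\<lambda>u::real. 1::complex)" "norm (1::complex) \<le> 1 * cosh u ^ 0" for u :: real
    by auto
  have py: "continuous_on UNIV (wave_dy \<beta> (\<lambda>u. 1))" "norm (wave_dy \<beta> (\<lambda>u. 1) u) \<le> \<beta> * cosh u ^ 1" for u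
    using \<beta> unfolding wave_dy_def by (auto intro!: continuous_intros simp: norm_mult)
  have px: "continuous_on UNIV (wave_dx \<beta> (\<lambda>u. 1))" "norm (wave_dx \<beta> (\<lambda>u. 1) u) \<le> \<beta> * cosh u ^ 1" for u
    using \<beta> abs_sinh_le_cosh[of u] unfolding wave_dx_def by (auto intro!: continuous_intros simp: norm_mult)
  have d1: "((\<lambda>x. ln (x\<^sup>2 + y\<^sup>2) / 2) has_real_derivative x / (x\<^sup>2 + y\<^sup>2)) (at x)" if "y > 0" for x y :: real
    by (rule has_real_derivative_half_ln[OF rpos[OF that]])
  have d2: "((\<lambda>y. ln (x\<^sup>2 + y\<^sup>2) / 2) has_real_derivative y / (x\<^sup>2 + y\<^sup>2)) (at y)" if "y > 0" for x y :: real
    using has_real_derivative_half_ln[of y "x\<^sup>2"] rpos[OF that, of x] by (simp only: add.commute)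
  have G: "G_MB \<beta> t = c * (Re (wave_integral \<beta> (\<lambda>u. 1) (t $ 1) (t $ 2)) / 2 + ln ((t $ 1)\<^sup>2 + (t $ 2)\<^sup>2) / 2)"
    if "t $ 2 > 0" for t
    using G_MB_wave[OF \<beta> that] by (simp add: c_def)
  note G1 = partial_deriv_wave(1)[OF \<beta> _ p0 G d1] and G2 = partial_deriv_wave(2)[OF \<beta> _ p0 G d2]
  have r0: "x\<^sup>2 + y\<^sup>2 \<noteq> 0" using rpos[of y x] t by (auto simp: y_def)
  have "((\<lambda>y. y / (x\<^sup>2 + y\<^sup>2)) has_real_derivative (x\<^sup>2 - y\<^sup>2) / r\<^sup>2) (at y)"
    "((\<lambda>x. y / (x\<^sup>2 + y\<^sup>2)) has_real_derivative - (2 * x * y) / r\<^sup>2) (at x)"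
    "((\<lambda>x. x / (x\<^sup>2 + y\<^sup>2)) has_real_derivative (y\<^sup>2 - x\<^sup>2) / r\<^sup>2) (at x)"
    using r0 unfolding r_def by (auto intro!: derivative_eq_intros simp: power2_eq_square algebra_simps)
  note d = this[unfolded x_def y_def]
  show "partial_deriv 2 (partial_deriv 2 (G_MB \<beta>)) t =
      c * (Re (wave_integral \<beta> (wave_dy \<beta> (wave_dy \<beta> (\<lambda>u. 1))) x y) / 2 + (x\<^sup>2 - y\<^sup>2) / r\<^sup>2)"
    unfolding x_def y_def by (rule partial_deriv_wave(2)[OF \<beta> t py G2 d(1)])
  show "partial_deriv 1 (partial_deriv 2 (G_MB \<beta>)) t =
      c * (Re (wave_integral \<beta> (wave_dx \<beta> (wave_dy \<beta> (\<lambda>u. 1))) x y) / 2 + - (2 * x * y) / r\<^sup>2)"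
    unfolding x_def y_def by (rule partial_deriv_wave(1)[OF \<beta> t py G2 d(2)])
  show "partial_deriv 1 (partial_deriv 1 (G_MB \<beta>)) t =
      c * (Re (wave_integral \<beta> (wave_dx \<beta> (wave_dx \<beta> (\<lambda>u. 1))) x y) / 2 + (y\<^sup>2 - x\<^sup>2) / r\<^sup>2)"
    unfolding x_def y_def by (rule partial_deriv_wave(1)[OF \<beta> t px G1 d(3)])
qed

definition mode_index :: "2 \<Rightarrow> 2 \<Rightarrow> nat" where
  "mode_index i j = (if i \<noteq> j then 1 else if i = 1 then 0 else 2)"

text \<open>The weights produced by two derivatives of the Bessel part are the symbols up to sign,
  and the second derivatives of the logarithm are the same mode integrals at
  \<open>\<beta> = 0\<close>. The factor is \<open>1 / (2 * pi * \<beta>\<^sup>2)\<close> times the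
  1/2 in front of the wave integral.\<close>

lemma G_MS_modes:
  assumes \<beta>: "\<beta> > 0" and t: "(t :: real ^ 2) $ 2 > 0"
  shows "complex_of_real (G_MS \<beta> t $ i $ j) = of_real (1 / (4 * pi * \<beta>\<^sup>2)) *
     (mode_integral (mode_index i j) \<beta> (t $ 1) (t $ 2) - mode_integral (mode_index i j) 0 (t $ 1) (t $ 2))"
proof -
  define x y where "x = t $ 1" and "y = t $ 2"
  have y: "y > 0" using t by (simp add: y_def)
  define W where "W n = Re (mode_integral n \<beta> x y)" for n
  have WM: "mode_integral n \<beta> x y = of_real (W n)" for n
    using mode_integral_real[of n \<beta> x y] by (simp add: W_def complex_eq_iff)
  note rho = rho_sinh[OF \<beta>]
  have w0: "wave_dy \<beta> (wave_dy \<beta> (\<lambda>u. 1)) = (\<lambda>u. symb 0 \<beta> (\<beta> * sinh u) * of_real (\<beta> * cosh u) :: complex)"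
    by (simp add: wave_dy_def symb_def rho fun_eq_iff)
  have w1: "wave_dx \<beta> (wave_dy \<beta> (\<lambda>u. 1)) = (\<lambda>u. - (symb 1 \<beta> (\<beta> * sinh u) * of_real (\<beta> * cosh u)))"
    by (simp add: wave_dx_def wave_dy_def symb_def fun_eq_iff)
  have w2: "wave_dx \<beta> (wave_dx \<beta> (\<lambda>u. 1)) = (\<lambda>u. symb 2 \<beta> (\<beta> * sinh u) * of_real (\<beta> * cosh u))"
    using \<beta> by (simp add: wave_dx_def symb_def rho fun_eq_iff power2_eq_square field_simps)
  have R0: "Re (wave_integral \<beta> (wave_dy \<beta> (wave_dy \<beta> (\<lambda>u. 1))) x y) = W 0"
    unfolding w0 W_def mode_integral_eq_wave_integral[OF \<beta> y] ..
  have R1: "Re (wave_integral \<beta> (wave_dx \<beta> (wave_dy \<beta> (\<lambda>u. 1))) x y) = - W 1"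
    unfolding w1 W_def mode_integral_eq_wave_integral[OF \<beta> y] wave_integral_def by simp
  have R2: "Re (wave_integral \<beta> (wave_dx \<beta> (wave_dx \<beta> (\<lambda>u. 1))) x y) = W 2"
    unfolding w2 W_def mode_integral_eq_wave_integral[OF \<beta> y] ..
  note P = G_MB_partials[OF \<beta> t, folded x_def y_def, unfolded R0 R1 R2]
  define r where "r = (x\<^sup>2 + y\<^sup>2)\<^sup>2"
  have r0: "r > 0" using y by (simp add: r_def add_nonneg_pos)
  define V where "V n = (if n = 0 then 2 * (y\<^sup>2 - x\<^sup>2) / r else if n = 1 then - 4 * x * y / r else - 2 * (y\<^sup>2 - x\<^sup>2) / r)" for n :: nat
  have VM: "mode_integral n 0 x y = of_real (V n)" for n
    unfolding mode_integral_0[OF y] r_def V_def ..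
  have "G_MS \<beta> t $ 1 $ 1 = 1 / (4 * pi * \<beta>\<^sup>2) * (W 0 - 2 * (y\<^sup>2 - x\<^sup>2) / r)"
    unfolding G_MS_def vector_2 P r_def[symmetric] using r0 \<beta> by (simp add: field_simps)
  moreover have "G_MS \<beta> t $ 1 $ 2 = 1 / (4 * pi * \<beta>\<^sup>2) * (W 1 - (- 4 * x * y / r))"
    "G_MS \<beta> t $ 2 $ 1 = 1 / (4 * pi * \<beta>\<^sup>2) * (W 1 - (- 4 * x * y / r))"
    unfolding G_MS_def vector_2 P r_def[symmetric] using r0 \<beta> by (simp_all add: field_simps)
  moreover have "G_MS \<beta> t $ 2 $ 2 = 1 / (4 * pi * \<beta>\<^sup>2) * (W 2 - (- 2 * (y\<^sup>2 - x\<^sup>2) / r))"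
    unfolding G_MS_def vector_2 P r_def[symmetric] using r0 \<beta> by (simp add: field_simps)
  moreover have "i = 1 \<or> i = 2" "j = 1 \<or> j = 2" using exhaust_2 by auto
  ultimately have "G_MS \<beta> t $ i $ j = 1 / (4 * pi * \<beta>\<^sup>2) * (W (mode_index i j) - V (mode_index i j))"
    by (elim disjE) (simp_all add: mode_index_def V_def)
  then show ?thesis
    unfolding x_def[symmetric] y_def[symmetric] WM VM by simp
qed

section \<open>The sum over the rows and its limit\<close>

text \<open>For \<open>k \<noteq> 0\<close> this is the derivative of
  \<open>mode n \<beta> y k\<close> with respect to \<open>\<beta>\<^sup>2\<close> at 0.\<close>

definition mode_limit :: "nat \<Rightarrow> real \<Rightarrow> real \<Rightarrow> complex" where
  "mode_limit n y k = of_real (exp (- (\<bar>k\<bar> * y)) / 2) * (if n = 0 then of_real (1 / \<bar>k\<bar> - y)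
     else if n = 1 then - \<i> * of_real (sgn k * y) else of_real (1 / \<bar>k\<bar> + y))"

text \<open>The divided difference in \<open>b = \<beta>\<^sup>2\<close> is controlled by the derivative in \<open>b\<close>, uniformly in \<open>\<beta>\<close>.\<close>

lemma mode_difference:
  assumes k: "k \<noteq> 0" and y: "y \<ge> 0"
  shows "((\<lambda>\<beta>. (mode n \<beta> y k - mode n 0 y k) / of_real (\<beta>\<^sup>2)) \<longlongrightarrow> mode_limit n y k) (at_right 0)"
    and "\<beta> > 0 \<Longrightarrow> norm ((mode n \<beta> y k - mode n 0 y k) / of_real (\<beta>\<^sup>2)) \<le> (1 / \<bar>k\<bar> + y) * exp (- (\<bar>k\<bar> * y)) / 2"
proof -
  define r where "r b = sqrt (k\<^sup>2 + b)" for b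
  define c :: complex where "c = (if n = 0 then 1 else if n = 1 then \<i> else -1)"
  define m where "m b = (if n = 0 then r b else if n = 1 then k else k\<^sup>2 / r b) * exp (- (r b * y))" for b
  \<comment> \<open>The derivative of \<open>m\<close> in \<open>b\<close>; the common factor 1/2
    stems from the derivative \<open>1 / (2 * r b)\<close> of \<open>r\<close>.\<close>
  define m' where "m' b = (if n = 0 then 1 / r b - y else if n = 1 then - k * y / r b
     else - (k\<^sup>2 / (r b)\<^sup>2) * (1 / r b + y)) * exp (- (r b * y)) / 2" for b
  have mm: "mode n \<beta> y k = c * of_real (m (\<beta>\<^sup>2))" for \<beta>
    by (simp add: mode_def symb_def c_def m_def r_def rho_def)
  have r: "r b > 0" "\<bar>k\<bar> \<le> r b" "k\<^sup>2 \<le> (r b)\<^sup>2" if "b \<ge> 0" for b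
  proof -
    show "r b > 0" using k that by (simp add: r_def add_pos_nonneg)
    show "\<bar>k\<bar> \<le> r b" using that by (simp add: r_def real_le_rsqrt)
    then show "k\<^sup>2 \<le> (r b)\<^sup>2" by (metis abs_ge_zero power2_abs power_mono)
  qed
  have dr: "(r has_real_derivative 1 / (2 * r b)) (at b)" if "b \<ge> 0" for b
  proof -
    have "k\<^sup>2 + b > 0" using k that by (simp add: add_pos_nonneg)
    then show ?thesis unfolding r_def[abs_def] by (auto intro!: derivative_eq_intros simp: field_simps)
  qed
  have dm: "(m has_real_derivative m' b) (at b)" if b: "b \<ge> 0" for b
  proof -
    have e: "((\<lambda>b. exp (- (r b * y))) has_real_derivative exp (- (r b * y)) * (- (1 / (2 * r b) * y))) (at b)"
      by (rule DERIV_fun_exp, rule DERIV_minus, rule DERIV_cmult_right, rule dr[OF b])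
    consider "n = 0" | "n = 1" | "n \<noteq> 0" "n \<noteq> 1" by auto
    then show ?thesis
    proof cases
      case 1
      have "(m has_real_derivative 1 / (2 * r b) * exp (- (r b * y)) + exp (- (r b * y)) * (- (1 / (2 * r b) * y)) * r b) (at b)"
        using DERIV_mult[OF dr[OF b] e] 1 by (simp add: m_def[abs_def])
      then show ?thesis by (rule DERIV_cong) (use 1 r(1)[OF b] in \<open>simp add: m'_def field_simps\<close>)
    next
      case 2
      have "(m has_real_derivative k * (exp (- (r b * y)) * (- (1 / (2 * r b) * y)))) (at b)"
        using DERIV_cmult[OF e, of k] 2 by (simp add: m_def[abs_def])
      then show ?thesis by (rule DERIV_cong) (use 2 r(1)[OF b] in \<open>simp add: m'_def field_simps\<close>)
    next
      case 3
      have "((\<lambda>b. k\<^sup>2 / r b) has_real_derivative - (k\<^sup>2 / (r b)\<^sup>2) * (1 / (2 * r b))) (at b)"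
        using DERIV_divide[OF DERIV_const dr[OF b], of "k\<^sup>2"] r(1)[OF b]
        by (simp add: power2_eq_square mult_ac)
      from DERIV_mult[OF this e]
      have "(m has_real_derivative - (k\<^sup>2 / (r b)\<^sup>2) * (1 / (2 * r b)) * exp (- (r b * y)) + exp (- (r b * y)) * (- (1 / (2 * r b) * y)) * (k\<^sup>2 / r b)) (at b)"
        using 3 by (simp add: m_def[abs_def])
      then show ?thesis by (rule DERIV_cong) (use 3 r(1)[OF b] in \<open>simp add: m'_def field_simps power2_eq_square\<close>)
    qed
  qed
  have bm: "\<bar>m' b\<bar> \<le> (1 / \<bar>k\<bar> + y) * exp (- (\<bar>k\<bar> * y)) / 2" if b: "b \<ge> 0" for b
  proof -
    have kr: "k\<^sup>2 / (r b)\<^sup>2 \<le> 1" "\<bar>k\<bar> / r b \<le> 1" using r[OF b] by (auto simp: divide_le_eq_1)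
    have ri: "1 / r b > 0" using r[OF b] by simp
    have "\<bar>if n = 0 then 1 / r b - y else if n = 1 then - k * y / r b else - (k\<^sup>2 / (r b)\<^sup>2) * (1 / r b + y)\<bar> \<le> 1 / r b + y"
    proof -
      have "\<bar>1 / r b - y\<bar> \<le> 1 / r b + y" using ri y by linarith
      moreover have "\<bar>- k * y / r b\<bar> \<le> 1 / r b + y"
      proof -
        have "\<bar>- k * y / r b\<bar> = \<bar>k\<bar> / r b * y" using r(1)[OF b] y by (simp add: abs_mult)
        also have "\<dots> \<le> 1 * y" using kr y by (intro mult_right_mono) auto
        finally show ?thesis using ri by linarith
      qed
      moreover have "\<bar>- (k\<^sup>2 / (r b)\<^sup>2) * (1 / r b + y)\<bar> \<le> 1 / r b + y"
      proof -
        have "\<bar>- (k\<^sup>2 / (r b)\<^sup>2) * (1 / r b + y)\<bar> = k\<^sup>2 / (r b)\<^sup>2 * (1 / r b + y)"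
          using ri y by (simp add: abs_mult)
        also have "\<dots> \<le> 1 * (1 / r b + y)" using kr ri y by (intro mult_right_mono) auto
        finally show ?thesis by simp
      qed
      ultimately show ?thesis by (simp split: if_split)
    qed
    then have "\<bar>m' b\<bar> \<le> (1 / r b + y) * exp (- (r b * y)) / 2"
      unfolding m'_def abs_mult abs_divide abs_exp_cancel abs_numeral
      by (intro divide_right_mono mult_right_mono) (assumption | simp)+
    also have "\<dots> \<le> (1 / \<bar>k\<bar> + y) * exp (- (\<bar>k\<bar> * y)) / 2"
      using r[OF b] k y by (intro divide_right_mono mult_mono add_right_mono) (auto intro: divide_left_mono mult_right_mono)
    finally show ?thesis .
  qed
  have nc: "norm c = 1" by (simp add: c_def)
  show "norm ((mode n \<beta> y k - mode n 0 y k) / of_real (\<beta>\<^sup>2)) \<le> (1 / \<bar>k\<bar> + y) * exp (- (\<bar>k\<bar> * y)) / 2" if \<beta>: "\<beta> > 0"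
  proof -
    \<comment> \<open>Mean value inequality in \<open>b\<close>; the end point \<open>b = 0\<close>
      is admissible because \<open>k \<noteq> 0\<close> keeps \<open>r\<close> positive
      there.\<close>
    have "norm (m (\<beta>\<^sup>2) - m 0) \<le> (1 / \<bar>k\<bar> + y) * exp (- (\<bar>k\<bar> * y)) / 2 * norm (\<beta>\<^sup>2 - 0)"
    proof (rule field_differentiable_bound[where S = "{0..}"])
      show "(m has_real_derivative m' b) (at b within {0..})" if "b \<in> {0..}" for b
        using dm that by (auto intro: has_field_derivative_at_within)
    qed (use bm in auto)
    moreover have eq: "(mode n \<beta> y k - mode n 0 y k) / of_real (\<beta>\<^sup>2) = c * of_real ((m (\<beta>\<^sup>2) - m 0) / \<beta>\<^sup>2)"
      unfolding mm by (simp add: field_simps)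
    ultimately show ?thesis
      unfolding eq norm_mult nc norm_of_real mult_1 abs_divide using \<beta> by (simp add: divide_le_eq)
  qed
  have "((\<lambda>h. (m (0 + h) - m 0) / h) \<longlongrightarrow> m' 0) (at 0)"
    using dm[of 0] by (simp add: DERIV_def)
  moreover have "filterlim (\<lambda>\<beta>::real. \<beta>\<^sup>2) (at 0) (at_right 0)"
    by (rule filterlim_atI) (auto intro!: tendsto_eq_intros simp: eventually_at_filter)
  ultimately have "((\<lambda>\<beta>. (m (0 + \<beta>\<^sup>2) - m 0) / \<beta>\<^sup>2) \<longlongrightarrow> m' 0) (at_right 0)"
    by (rule filterlim_compose)
  then have "((\<lambda>\<beta>. c * of_real ((m (0 + \<beta>\<^sup>2) - m 0) / \<beta>\<^sup>2)) \<longlongrightarrow> c * of_real (m' 0)) (at_right 0)"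
    by (intro tendsto_intros)
  moreover have "c * of_real (m' 0) = mode_limit n y k"
  proof -
    have r0: "r 0 = \<bar>k\<bar>" by (simp add: r_def)
    have "k / \<bar>k\<bar> = sgn k" using k by (simp add: sgn_if abs_if)
    then have m0: "m' 0 = exp (- (\<bar>k\<bar> * y)) / 2 * (if n = 0 then 1 / \<bar>k\<bar> - y else if n = 1 then - (sgn k * y) else - (1 / \<bar>k\<bar> + y))"
      using k by (simp add: m'_def r0 mult.commute flip: times_divide_eq_left)
    show ?thesis unfolding m0 by (simp add: c_def mode_limit_def)
  qed
  moreover have "(mode n \<beta> y k - mode n 0 y k) / of_real (\<beta>\<^sup>2) = c * of_real ((m (0 + \<beta>\<^sup>2) - m 0) / \<beta>\<^sup>2)" for \<beta>
    unfolding mm by (simp add: field_simps)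
  ultimately show "((\<lambda>\<beta>. (mode n \<beta> y k - mode n 0 y k) / of_real (\<beta>\<^sup>2)) \<longlongrightarrow> mode_limit n y k) (at_right 0)"
    by (simp only:)
qed

text \<open>At frequency 0 all symbols vanish except that of entry (1,1), which equals
  \<beta>.\<close>

lemma mode_0_difference:
  assumes "\<beta> > 0"
  shows "(mode n \<beta> y 0 - mode n 0 y 0) / of_real (\<beta>\<^sup>2) = (if n = 0 then of_real (exp (- (\<beta> * y)) / \<beta>) else 0)"
  using assms by (simp add: mode_def symb_def rho_def power2_eq_square)

text \<open>The factor \<open>1 / (2 * d)\<close> is the \<open>1 / (4 * pi)\<close> of
  \<open>G_MS_modes\<close> times the \<open>2 * pi / d\<close> of Poisson summation.\<close>

definition row_term :: "real \<Rightarrow> nat \<Rightarrow> real \<Rightarrow> real \<Rightarrow> real \<Rightarrow> int \<Rightarrow> complex" where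
  "row_term d n \<beta> x y a = of_real (1 / (2 * d)) *
     ((mode n \<beta> y (alpha d a) - mode n 0 y (alpha d a)) / of_real (\<beta>\<^sup>2)) * cis (alpha d a * x)"

lemma alpha_abs: "d > 0 \<Longrightarrow> \<bar>alpha d a\<bar> = 2 * pi / d * \<bar>real_of_int a\<bar>"
  by (simp add: alpha_def abs_mult)

lemma mode_alpha_summable:
  assumes d: "d > 0" and y: "y > 0"
  shows "(\<lambda>a. mode n \<beta> y (alpha d a) * cis (alpha d a * x)) summable_on UNIV"
proof (rule abs_summable_summable, rule summable_on_comparison_test)
  show "(\<lambda>a::int. 2 / y * exp (- (y / 2 * (2 * pi / d)) * \<bar>real_of_int a\<bar>)) summable_on UNIV"
    by (intro summable_on_cmult_right summable_on_exp_neg_abs_int) (use d y in auto)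
  show "norm (mode n \<beta> y (alpha d a) * cis (alpha d a * x)) \<le> 2 / y * exp (- (y / 2 * (2 * pi / d)) * \<bar>real_of_int a\<bar>)" for a
    using norm_mode_le[OF y, of n \<beta> "alpha d a"] by (simp add: norm_mult alpha_abs[OF d] mult.assoc)
qed auto

lemma G_MS_row_has_sum:
  assumes d: "d > 0" and \<beta>: "\<beta> > 0" and t: "(t :: real ^ 2) $ 2 > 0"
  shows "((\<lambda>m::int. complex_of_real (G_MS \<beta> (t - of_int m *\<^sub>R e1 d) $ i $ j)) has_sum
     (\<Sum>\<^sub>\<infinity>a. row_term d (mode_index i j) \<beta> (t $ 1) (t $ 2) a)) UNIV"
    and "(\<lambda>a. row_term d (mode_index i j) \<beta> (t $ 1) (t $ 2) a) summable_on UNIV"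
proof -
  define n where "n = mode_index i j"
  define x y where "x = t $ 1" and "y = t $ 2"
  have y: "y > 0" using t by (simp add: y_def)
  have comp: "(t - of_int m *\<^sub>R e1 d) $ 1 = x - of_int m * d" "(t - of_int m *\<^sub>R e1 d) $ 2 = y" for m :: int
    by (simp_all add: e1_def x_def y_def)
  let ?f = "\<lambda>\<beta> a. mode n \<beta> y (alpha d a) * cis (alpha d a * x)"
  have 1: "((\<lambda>m::int. of_real (1 / (4 * pi * \<beta>\<^sup>2)) * (mode_integral n \<beta> (x - of_int m * d) y + (- 1) * mode_integral n 0 (x - of_int m * d) y)) has_sum
     of_real (1 / (4 * pi * \<beta>\<^sup>2)) * (of_real (2 * pi / d) * infsum (?f \<beta>) UNIV + (- 1) * (of_real (2 * pi / d) * infsum (?f 0) UNIV))) UNIV"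
    by (intro has_sum_cmult_right has_sum_add mode_integral_row_sum d y) (use \<beta> in auto)
  have rt: "row_term d n \<beta> x y a = of_real (1 / (2 * d * \<beta>\<^sup>2)) * (?f \<beta> a + (- 1) * ?f 0 a)" for a
    by (simp add: row_term_def field_simps)
  have 2: "((\<lambda>a. row_term d n \<beta> x y a) has_sum of_real (1 / (2 * d * \<beta>\<^sup>2)) * (infsum (?f \<beta>) UNIV + (- 1) * infsum (?f 0) UNIV)) UNIV"
    unfolding rt by (intro has_sum_cmult_right has_sum_add has_sum_infsum mode_alpha_summable d y)
  then show "(\<lambda>a. row_term d (mode_index i j) \<beta> (t $ 1) (t $ 2) a) summable_on UNIV"
    unfolding n_def x_def y_def by (rule has_sum_imp_summable)
  have "of_real (1 / (4 * pi * \<beta>\<^sup>2)) * (of_real (2 * pi / d) * infsum (?f \<beta>) UNIV + (- 1) * (of_real (2 * pi / d) * infsum (?f 0) UNIV))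
     = infsum (row_term d n \<beta> x y) UNIV"
    using d \<beta> by (subst infsumI[OF 2]) (simp add: field_simps)
  moreover have "complex_of_real (G_MS \<beta> (t - of_int m *\<^sub>R e1 d) $ i $ j) = of_real (1 / (4 * pi * \<beta>\<^sup>2)) * (mode_integral n \<beta> (x - of_int m * d) y + (- 1) * mode_integral n 0 (x - of_int m * d) y)" for m :: int
    using G_MS_modes[OF \<beta>, of "t - of_int m *\<^sub>R e1 d" i j] y unfolding comp n_def by simp
  ultimately show "((\<lambda>m::int. complex_of_real (G_MS \<beta> (t - of_int m *\<^sub>R e1 d) $ i $ j)) has_sum
     (\<Sum>\<^sub>\<infinity>a. row_term d (mode_index i j) \<beta> (t $ 1) (t $ 2) a)) UNIV"
    using 1 unfolding n_def x_def y_def by simp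
qed


definition row_limit :: "real \<Rightarrow> nat \<Rightarrow> real \<Rightarrow> real \<Rightarrow> int \<Rightarrow> complex" where
  "row_limit d n x y a = of_real (1 / (2 * d)) * mode_limit n y (alpha d a) * cis (alpha d a * x)"

text \<open>A product of a function of \<open>N\<close> and a function of \<open>a\<close>. The rate
  \<open>pi * \<eta> / (2 * d)\<close> is a quarter of \<open>2 * pi * \<eta> / d\<close>: one part
  of the loss separates the two indices, another absorbs the factor linear in the height. The
  constants are those produced in \<open>exp_height_bound\<close>.\<close>

definition row_bound :: "real \<Rightarrow> real \<Rightarrow> int \<Rightarrow> int \<Rightarrow> real" where
  "row_bound d \<eta> N a = (1 / (4 * d) * (d / (2 * pi) + \<eta> + 2 * d / pi) * exp (pi * \<eta> / d)) *
     (exp (- (pi * \<eta> / (2 * d)) * \<bar>real_of_int N\<bar>) * exp (- (pi * \<eta> / (2 * d)) * \<bar>real_of_int a\<bar>))"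

lemma row_bound_summable:
  assumes "d > 0" "\<eta> > 0"
  shows "(\<lambda>(N, a). row_bound d \<eta> N a) summable_on A \<times> B"
proof -
  define c where "c = pi * \<eta> / (2 * d)"
  define e where "e = (\<lambda>j::int. exp (- c * \<bar>real_of_int j\<bar>))"
  have c: "c > 0" using assms by (simp add: c_def)
  have e: "e summable_on UNIV" unfolding e_def by (rule summable_on_exp_neg_abs_int[OF c])
  define K where "K = 1 / (4 * d) * (d / (2 * pi) + \<eta> + 2 * d / pi) * exp (pi * \<eta> / d)"
  have K: "K \<ge> 0" using assms by (simp add: K_def)
  have s: "(\<lambda>a. K * (e N * e a)) summable_on UNIV" for N
    by (intro summable_on_cmult_right e)
  have i: "(\<Sum>\<^sub>\<infinity>a. K * (e N * e a)) = K * infsum e UNIV * e N" for N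
    by (simp add: infsum_cmult_right')
  have "(\<lambda>p. norm ((\<lambda>(N, a). K * (e N * e a)) p)) summable_on (UNIV \<times> UNIV)"
  proof (rule Infinite_Sum.abs_summable_on_Sigma_iff[THEN iffD2], intro conjI ballI)
    have e0: "e j \<ge> 0" for j by (simp add: e_def)
    have I0: "infsum e UNIV \<ge> 0" by (rule infsum_nonneg) (rule e0)
    have ab: "norm (K * (e N * e a)) = K * (e N * e a)" for N a using K e0 by simp
    have ab': "norm (K * infsum e UNIV * e N) = K * infsum e UNIV * e N" for N using K e0 I0 by simp
    show "(\<lambda>N. norm (\<Sum>\<^sub>\<infinity>a. norm ((\<lambda>(N, a). K * (e N * e a)) (N, a)))) summable_on UNIV"
      unfolding prod.case ab i ab' by (rule summable_on_cmult_right[OF e])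
    show "(\<lambda>a. norm ((\<lambda>(N, a). K * (e N * e a)) (N, a))) summable_on UNIV" for N
      unfolding prod.case ab by (rule s)
  qed
  then have "(\<lambda>(N, a). K * (e N * e a)) summable_on (UNIV \<times> UNIV)"
    by (rule abs_summable_summable)
  moreover have "(\<lambda>(N, a). row_bound d \<eta> N a) = (\<lambda>(N, a). K * (e N * e a))"
    by (simp add: row_bound_def K_def e_def c_def)
  ultimately show ?thesis by (auto intro: summable_on_subset_banach)
qed

lemma inverse_alpha_le:
  assumes "d > 0" "a \<noteq> 0"
  shows "1 / \<bar>alpha d a\<bar> \<le> d / (2 * pi)"
proof -
  have "2 * pi / d * 1 \<le> 2 * pi / d * \<bar>real_of_int a\<bar>" using assms by (intro mult_left_mono) auto
  then have "2 * pi / d \<le> \<bar>alpha d a\<bar>" by (simp add: alpha_abs[OF assms(1)])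
  from le_imp_inverse_le[OF this] assms(1) show ?thesis by (simp add: inverse_eq_divide)
qed

lemma south_pairs_summable:
  fixes T :: "int \<Rightarrow> int \<Rightarrow> complex"
  assumes "d > 0" "\<eta> > 0" "\<And>N a. a \<noteq> 0 \<Longrightarrow> N \<le> -2 \<Longrightarrow> norm (T N a) \<le> row_bound d \<eta> N a"
  shows "(\<lambda>(N, a). T N a) summable_on ({..-2} \<times> (UNIV - {0}))"
  by (rule abs_summable_summable, rule summable_on_comparison_test[OF row_bound_summable[OF assms(1,2)]])
     (use assms(3) in auto)

text \<open>The decay \<open>exp (- (\<kappa> * (p * q)))\<close> couples the frequency
  \<open>p\<close> and the row \<open>q\<close>. As both are at least 1,
  \<open>2 * (p * q) \<ge> p + q\<close> separates them, and part of the decay in \<open>q\<close>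
  pays for the linear growth of the height.\<close>

lemma exp_height_bound:
  assumes d: "d > 0" and \<eta>: "\<eta> > 0" and a: "a \<noteq> 0" and N: "N \<le> -2" and Y: "\<bar>Y\<bar> \<le> \<eta>"
  shows "1 / (2 * d) * ((1 / \<bar>alpha d a\<bar> + (Y - of_int N * \<eta>)) * exp (- (\<bar>alpha d a\<bar> * (Y - of_int N * \<eta>))) / 2) \<le> row_bound d \<eta> N a"
    and "Y - of_int N * \<eta> \<ge> \<eta>"
proof -
  \<comment> \<open>One row is given away to \<open>Y\<close>, which may be as low as
    \<open>- \<eta>\<close>; \<open>N \<le> -2\<close> still leaves
    \<open>q \<ge> 1\<close>.\<close>
  define p q where "p = \<bar>real_of_int a\<bar>" and "q = \<bar>real_of_int N\<bar> - 1"
  define \<kappa> where "\<kappa> = 2 * pi * \<eta> / d"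
  have \<kappa>: "\<kappa> > 0" using d \<eta> by (simp add: \<kappa>_def)
  have p: "p \<ge> 1" using a by (simp add: p_def)
  have q: "q \<ge> 1" using N by (simp add: q_def)
  have NN: "\<bar>real_of_int N\<bar> = - of_int N" "real_of_int N = - (q + 1)" using N by (auto simp: q_def)
  define D where "D = d / (2 * pi) + \<eta> + 2 * d / pi"
  have D: "D \<ge> 0" using d \<eta> by (simp add: D_def)
  let ?y = "Y - of_int N * \<eta>"
  have y1: "?y \<ge> q * \<eta>" using Y \<eta> by (simp add: NN algebra_simps)
  have y2: "?y \<le> (q + 2) * \<eta>" using Y \<eta> by (simp add: NN algebra_simps)
  have "1 * \<eta> \<le> q * \<eta>" using q \<eta> by (intro mult_right_mono) auto
  then show "?y \<ge> \<eta>" using y1 by linarith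
  have al: "\<bar>alpha d a\<bar> = 2 * pi / d * p" using alpha_abs[OF d] by (simp add: p_def)
  note i = inverse_alpha_le[OF d a]
  have e1: "1 \<le> exp (\<kappa> * (q + 1) / 4)" using \<kappa> q by simp
  have e2: "q + 1 \<le> 4 / \<kappa> * exp (\<kappa> * (q + 1) / 4)"
  proof -
    have "\<kappa> * (q + 1) / 4 \<le> exp (\<kappa> * (q + 1) / 4)" using exp_ge_add_one_self[of "\<kappa> * (q + 1) / 4"] by linarith
    then show ?thesis using \<kappa> by (simp add: field_simps)
  qed
  have "1 / \<bar>alpha d a\<bar> + ?y \<le> (d / (2 * pi) + \<eta>) * 1 + \<eta> * (q + 1)"
    using i y2 by (simp add: algebra_simps)
  also have "\<dots> \<le> (d / (2 * pi) + \<eta>) * exp (\<kappa> * (q + 1) / 4) + \<eta> * (4 / \<kappa> * exp (\<kappa> * (q + 1) / 4))"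
    using d \<eta> e1 e2 by (intro add_mono mult_left_mono) auto
  also have "\<dots> = D * exp (\<kappa> * (q + 1) / 4)"
    using d \<eta> by (simp add: D_def \<kappa>_def field_simps)
  finally have f1: "1 / \<bar>alpha d a\<bar> + ?y \<le> D * exp (\<kappa> * (q + 1) / 4)" .
  have "(p - 1) * (q - 1) \<ge> 0" using p q by simp
  moreover have "p * q \<ge> 1 * 1" using p q by (intro mult_mono) auto
  ultimately have pq: "2 * (p * q) \<ge> p + q" by (simp add: algebra_simps)
  have "\<bar>alpha d a\<bar> * ?y \<ge> (2 * pi / d * p) * (q * \<eta>)"
    unfolding al using y1 d p by (intro mult_left_mono) auto
  moreover have "(2 * pi / d * p) * (q * \<eta>) = \<kappa> * (p * q)" by (simp add: \<kappa>_def)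
  moreover have "\<kappa> * (p * q) \<ge> \<kappa> * ((p + q) / 2)" using pq \<kappa> by (intro mult_left_mono) auto
  ultimately have "- (\<bar>alpha d a\<bar> * ?y) \<le> - (\<kappa> * ((p + q) / 2))" by linarith
  then have f2: "exp (- (\<bar>alpha d a\<bar> * ?y)) \<le> exp (- (\<kappa> * ((p + q) / 2)))" by simp
  have "(1 / \<bar>alpha d a\<bar> + ?y) * exp (- (\<bar>alpha d a\<bar> * ?y)) \<le> (D * exp (\<kappa> * (q + 1) / 4)) * exp (- (\<kappa> * ((p + q) / 2)))"
    using f1 f2 D by (intro mult_mono) auto
  also have "\<dots> = D * exp (\<kappa> * (q + 1) / 4 - \<kappa> * ((p + q) / 2))"
    by (simp only: mult.assoc mult_exp_exp diff_conv_add_uminus)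
  also have "\<dots> \<le> D * exp (\<kappa> / 2 + (- (\<kappa> / 4) * (q + 1)) + (- (\<kappa> / 4) * p))"
    using D \<kappa> p by (intro mult_left_mono) (auto simp: field_simps)
  also have "\<dots> = D * exp (\<kappa> / 2) * (exp (- (\<kappa> / 4) * (q + 1)) * exp (- (\<kappa> / 4) * p))"
    by (simp only: exp_add mult.assoc)
  finally have "1 / (4 * d) * ((1 / \<bar>alpha d a\<bar> + ?y) * exp (- (\<bar>alpha d a\<bar> * ?y))) \<le> 1 / (4 * d) * (D * exp (\<kappa> / 2) * (exp (- (\<kappa> / 4) * (q + 1)) * exp (- (\<kappa> / 4) * p)))"
    using d by (intro mult_left_mono) auto
  also have "\<dots> = row_bound d \<eta> N a"
    by (simp add: row_bound_def D_def \<kappa>_def p_def q_def mult.assoc)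
  finally show "1 / (2 * d) * ((1 / \<bar>alpha d a\<bar> + ?y) * exp (- (\<bar>alpha d a\<bar> * ?y)) / 2) \<le> row_bound d \<eta> N a"
    by simp
qed

lemma alpha_nonzero: "d > 0 \<Longrightarrow> a \<noteq> 0 \<Longrightarrow> alpha d a \<noteq> 0"
  by (simp add: alpha_def)

lemma norm_row_term_le:
  assumes d: "d > 0" and \<eta>: "\<eta> > 0" and a: "a \<noteq> 0" and N: "N \<le> -2" and Y: "\<bar>Y\<bar> \<le> \<eta>" and \<beta>: "\<beta> > 0"
  shows "norm (row_term d n \<beta> x (Y - of_int N * \<eta>) a) \<le> row_bound d \<eta> N a"
proof -
  have y: "Y - of_int N * \<eta> \<ge> 0" using exp_height_bound(2)[OF assms(1-5)] \<eta> by simp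
  have "norm (row_term d n \<beta> x (Y - of_int N * \<eta>) a) = 1 / (2 * d) * norm ((mode n \<beta> (Y - of_int N * \<eta>) (alpha d a) - mode n 0 (Y - of_int N * \<eta>) (alpha d a)) / of_real (\<beta>\<^sup>2))"
    unfolding row_term_def norm_mult norm_of_real norm_cis using d by simp
  also have "\<dots> \<le> 1 / (2 * d) * ((1 / \<bar>alpha d a\<bar> + (Y - of_int N * \<eta>)) * exp (- (\<bar>alpha d a\<bar> * (Y - of_int N * \<eta>))) / 2)"
    using d by (intro mult_left_mono mode_difference(2) alpha_nonzero a y \<beta>) auto
  also have "\<dots> \<le> row_bound d \<eta> N a" by (rule exp_height_bound(1)[OF assms(1-5)])
  finally show ?thesis .
qed

lemma tendsto_row_term:
  assumes "d > 0" "a \<noteq> 0" "y \<ge> 0"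
  shows "((\<lambda>\<beta>. row_term d n \<beta> x y a) \<longlongrightarrow> row_limit d n x y a) (at_right 0)"
  unfolding row_term_def row_limit_def
  by (intro tendsto_intros mode_difference(1) alpha_nonzero assms)

lemma norm_row_limit_le:
  assumes d: "d > 0" and \<eta>: "\<eta> > 0" and a: "a \<noteq> 0" and N: "N \<le> -2" and Y: "\<bar>Y\<bar> \<le> \<eta>"
  shows "norm (row_limit d n x (Y - of_int N * \<eta>) a) \<le> row_bound d \<eta> N a"
proof (rule tendsto_upperbound)
  have y: "Y - of_int N * \<eta> \<ge> 0" using exp_height_bound(2)[OF assms] \<eta> by simp
  show "((\<lambda>\<beta>. norm (row_term d n \<beta> x (Y - of_int N * \<eta>) a)) \<longlongrightarrow> norm (row_limit d n x (Y - of_int N * \<eta>) a)) (at_right 0)"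
    by (intro tendsto_norm tendsto_row_term d a y)
  show "\<forall>\<^sub>F \<beta> in at_right 0. norm (row_term d n \<beta> x (Y - of_int N * \<eta>) a) \<le> row_bound d \<eta> N a"
    using eventually_at_right_less[of "0::real"] by eventually_elim (rule norm_row_term_le[OF assms])
qed simp

section \<open>The double series over rows and frequencies\<close>

lemma has_sum_of_realD:
  assumes "((\<lambda>x. complex_of_real (f x)) has_sum W) A"
  shows "(f has_sum Re W) A" and "W = of_real (Re W)"
proof -
  show "(f has_sum Re W) A" using has_sum_Re[OF assms] by simp
  from has_sum_of_real[OF this] show "W = of_real (Re W)" by (rule has_sum_unique[OF assms])
qed

lemma has_sum_vec:
  fixes f :: "'a \<Rightarrow> ('b :: {topological_comm_monoid_add}) ^ 'n"
  assumes "\<And>i. ((\<lambda>x. f x $ i) has_sum S $ i) A"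
  shows "(f has_sum S) A"
  using assms unfolding has_sum_def by (intro vec_tendstoI) simp

lemma has_sum_atMost_int:
  fixes f :: "int \<Rightarrow> 'a::{topological_comm_monoid_add, t2_space}"
  assumes "((\<lambda>k. f (c - int k)) has_sum S) UNIV"
  shows "(f has_sum S) {..c}"
proof -
  have "range (\<lambda>k. c - int k) = {..c}"
  proof (intro set_eqI iffI)
    fix m assume "m \<in> {..c}"
    then have "m = c - int (nat (c - m))" by simp
    then show "m \<in> range (\<lambda>k. c - int k)" by blast
  qed auto
  moreover have "(f has_sum S) (range (\<lambda>k. c - int k))"
    by (subst has_sum_reindex) (use assms in \<open>auto simp: comp_def inj_on_def\<close>)
  ultimately show ?thesis by simp
qed

text \<open>One unordered sum over all pairs of a row and a nonzero frequency; \<open>T\<close>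
  stands for \<open>row_term\<close> at \<beta> > 0 and for \<open>row_limit\<close> in the
  limit.\<close>

definition south_modes :: "real \<Rightarrow> real \<Rightarrow> real \<Rightarrow> (real \<Rightarrow> real \<Rightarrow> int \<Rightarrow> complex) \<Rightarrow> real \<Rightarrow> real \<Rightarrow> complex" where
  "south_modes d \<xi> \<eta> T X Y = (\<Sum>\<^sub>\<infinity>(N, a)\<in>{..-2} \<times> (UNIV - {0}). T (X - of_int N * \<xi>) (Y - of_int N * \<eta>) a)"

text \<open>The geometric series over n \<ge> 2 of the zero modes
  \<open>exp (- (\<beta> * (Y + n * \<eta>))) / (2 * d * \<beta>)\<close>.\<close>

definition south_zero :: "real \<Rightarrow> real \<Rightarrow> real \<Rightarrow> real \<Rightarrow> real" where
  "south_zero d \<eta> \<beta> Y = exp (- (\<beta> * Y)) * (exp (- 2 * (\<beta> * \<eta>)) / (2 * d * \<beta> * (1 - exp (- (\<beta> * \<eta>)))))"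

text \<open>Frequency 0 is split off every row, because it has no majorant uniform in \<beta>. The
  remaining pairs are absolutely summable, so their iterated sum is the sum over pairs.\<close>

lemma south_rows_has_sum:
  assumes d: "d > 0" and \<eta>: "\<eta> > 0" and \<beta>: "\<beta> > 0" and Y: "\<bar>Y\<bar> \<le> \<eta>"
    and summ: "\<And>N. N \<le> -2 \<Longrightarrow> (\<lambda>a. row_term d n \<beta> (X - of_int N * \<xi>) (Y - of_int N * \<eta>) a) summable_on UNIV"
  shows "((\<lambda>N. \<Sum>\<^sub>\<infinity>a. row_term d n \<beta> (X - of_int N * \<xi>) (Y - of_int N * \<eta>) a) has_sum
    (if n = 0 then of_real (south_zero d \<eta> \<beta> Y) else 0) + south_modes d \<xi> \<eta> (row_term d n \<beta>) X Y) {..-2}"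
proof -
  let ?T = "\<lambda>N a. row_term d n \<beta> (X - of_int N * \<xi>) (Y - of_int N * \<eta>) a"
  have pairs: "(\<lambda>(N, a). ?T N a) summable_on ({..-2} \<times> (UNIV - {0}))"
    by (rule south_pairs_summable[OF d \<eta>]) (rule norm_row_term_le[OF d \<eta> _ _ Y \<beta>])
  have inner: "(?T N) summable_on (UNIV - {0})" if "N \<le> -2" for N
    by (rule summable_on_subset[OF summ[OF that]]) auto
  have "((\<lambda>N. \<Sum>\<^sub>\<infinity>a\<in>UNIV - {0}. ?T N a) has_sum south_modes d \<xi> \<eta> (row_term d n \<beta>) X Y) {..-2}"
  proof (rule has_sum_SigmaD[where f = "\<lambda>(N, a). ?T N a" and B = "\<lambda>_. UNIV - {0}"])
    show "((\<lambda>(N, a). ?T N a) has_sum south_modes d \<xi> \<eta> (row_term d n \<beta>) X Y) ({..-2} \<times> (UNIV - {0}))"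
      unfolding south_modes_def by (rule has_sum_infsum[OF pairs])
  qed (use inner in auto)
  moreover have "((\<lambda>N. ?T N 0) has_sum (if n = 0 then of_real (south_zero d \<eta> \<beta> Y) else 0)) {..-2}"
  proof (cases "n = 0")
    case True
    define r where "r = complex_of_real (exp (- (\<beta> * \<eta>)))"
    have nr: "norm r < 1" using \<beta> \<eta> by (simp add: r_def)
    have "((\<lambda>k. of_real (exp (- (\<beta> * Y)) * exp (- 2 * (\<beta> * \<eta>)) / (2 * d * \<beta>)) * r ^ k) has_sum of_real (exp (- (\<beta> * Y)) * exp (- 2 * (\<beta> * \<eta>)) / (2 * d * \<beta>)) * (1 / (1 - r))) UNIV"
      by (intro has_sum_cmult_right has_sum_geometric nr)
    also have "of_real (exp (- (\<beta> * Y)) * exp (- 2 * (\<beta> * \<eta>)) / (2 * d * \<beta>)) * (1 / (1 - r)) = (of_real (south_zero d \<eta> \<beta> Y) :: complex)"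
      by (simp add: south_zero_def r_def)
    also have "(\<lambda>k. of_real (exp (- (\<beta> * Y)) * exp (- 2 * (\<beta> * \<eta>)) / (2 * d * \<beta>)) * r ^ k) = (\<lambda>k. ?T (-2 - int k) 0)"
    proof
      fix k
      have "exp (- (\<beta> * (Y - of_int (-2 - int k) * \<eta>))) = exp (- (\<beta> * Y)) * exp (- 2 * (\<beta> * \<eta>)) * exp (- (\<beta> * \<eta>)) ^ k"
        by (simp add: exp_of_nat_mult[symmetric] algebra_simps flip: exp_add)
      then show "of_real (exp (- (\<beta> * Y)) * exp (- 2 * (\<beta> * \<eta>)) / (2 * d * \<beta>)) * r ^ k = ?T (-2 - int k) 0"
        unfolding row_term_def
        by (simp add: alpha_def mode_0_difference[OF \<beta>, unfolded of_real_power] True r_def)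
    qed
    finally show ?thesis using True has_sum_atMost_int[where f = "\<lambda>N. ?T N 0" and c = "-2"] by simp
  next
    case False
    then show ?thesis
      unfolding row_term_def by (simp add: alpha_def mode_0_difference[OF \<beta>, unfolded of_real_power])
  qed
  ultimately have "((\<lambda>N. ?T N 0 + (\<Sum>\<^sub>\<infinity>a\<in>UNIV - {0}. ?T N a)) has_sum
     (if n = 0 then of_real (south_zero d \<eta> \<beta> Y) else 0) + south_modes d \<xi> \<eta> (row_term d n \<beta>) X Y) {..-2}"
    by (intro has_sum_add)
  moreover have "?T N 0 + (\<Sum>\<^sub>\<infinity>a\<in>UNIV - {0}. ?T N a) = (\<Sum>\<^sub>\<infinity>a. ?T N a)" if "N \<in> {..-2}" for N
    using infsum_insert[OF inner, of N 0] that by (simp add: insert_absorb)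
  ultimately show ?thesis by (subst has_sum_cong[symmetric]) auto
qed

text \<open>Both levels of summation are established as \<open>has_sum\<close>, entry by entry
  through complex numbers, so that neither \<open>infsum\<close> in \<open>K2_south\<close> falls
  back to its default value 0.\<close>

lemma K2_south_modes:
  assumes d: "d > 0" and \<eta>: "\<eta> > 0" and \<beta>: "\<beta> > 0" and Y: "\<bar>t $ 2 - s $ 2\<bar> \<le> \<eta>"
  shows "complex_of_real (K2_south d \<xi> \<eta> \<beta> t s $ i $ j) =
    (if i = 1 \<and> j = 1 then of_real (south_zero d \<eta> \<beta> (t $ 2 - s $ 2)) else 0) +
    south_modes d \<xi> \<eta> (row_term d (mode_index i j) \<beta>) (t $ 1 - s $ 1) (t $ 2 - s $ 2)"
proof -
  define p where "p N = t - (s + of_int N *\<^sub>R e2 \<xi> \<eta>)" for N :: int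
  have p1: "p N $ 1 = t $ 1 - s $ 1 - of_int N * \<xi>" and p2: "p N $ 2 = t $ 2 - s $ 2 - of_int N * \<eta>" for N
    by (simp_all add: p_def e2_def)
  have pl: "t - (s + lattice_pt d \<xi> \<eta> m N) = p N - of_int m *\<^sub>R e1 d" for m N
    by (simp add: p_def lattice_pt_def algebra_simps)
  \<comment> \<open>The frequency 1 is a dummy: the lower bound of the height does not involve
    it.\<close>
  have pos: "p N $ 2 > 0" if "N \<le> -2" for N
    using exp_height_bound(2)[OF d \<eta> _ that Y, of 1] \<eta> by (simp add: p2)
  define R where "R N = (\<Sum>\<^sub>\<infinity>m\<in>UNIV. G_MS \<beta> (p N - of_int m *\<^sub>R e1 d))" for N
  define T where "T i j N = (\<Sum>\<^sub>\<infinity>a. row_term d (mode_index i j) \<beta> (p N $ 1) (p N $ 2) a)" for i j N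
  have R: "complex_of_real (R N $ i $ j) = T i j N" if "N \<le> -2" for N i j
  proof -
    have hs: "((\<lambda>m::int. complex_of_real (G_MS \<beta> (p N - of_int m *\<^sub>R e1 d) $ i $ j)) has_sum T i j N) UNIV" for i j
      unfolding T_def by (rule G_MS_row_has_sum(1)[OF d \<beta> pos[OF that]])
    then have "((\<lambda>m::int. G_MS \<beta> (p N - of_int m *\<^sub>R e1 d)) has_sum (\<chi> i j. Re (T i j N))) UNIV"
      by (intro has_sum_vec) (simp add: has_sum_of_realD(1))
    then have "R N = (\<chi> i j. Re (T i j N))" unfolding R_def by (rule infsumI)
    then show ?thesis using has_sum_of_realD(2)[OF hs[of i j]] by simp
  qed
  define Z where "Z i j = (if mode_index i j = 0 then of_real (south_zero d \<eta> \<beta> (t $ 2 - s $ 2)) else 0) +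
    south_modes d \<xi> \<eta> (row_term d (mode_index i j) \<beta>) (t $ 1 - s $ 1) (t $ 2 - s $ 2)" for i j
  have "(T i j has_sum Z i j) {..-2}" for i j
    unfolding T_def[abs_def] p1 p2 Z_def
    by (rule south_rows_has_sum[OF d \<eta> \<beta> Y]) (use G_MS_row_has_sum(2)[OF d \<beta> pos] in \<open>simp add: p1 p2\<close>)
  then have hs: "((\<lambda>N. complex_of_real (R N $ i $ j)) has_sum Z i j) {..-2}" for i j
    by (subst has_sum_cong[OF R]) auto
  then have "(R has_sum (\<chi> i j. Re (Z i j))) {..-2}"
    by (intro has_sum_vec) (simp add: has_sum_of_realD(1))
  then have "K2_south d \<xi> \<eta> \<beta> t s = (\<chi> i j. Re (Z i j))"
    unfolding K2_south_def pl R_def[symmetric] by (rule infsumI)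
  then have "complex_of_real (K2_south d \<xi> \<eta> \<beta> t s $ i $ j) = Z i j" using has_sum_of_realD(2)[OF hs[of i j]] by simp
  moreover have "mode_index i j = 0 \<longleftrightarrow> i = 1 \<and> j = 1" by (auto simp: mode_index_def)
  ultimately show ?thesis by (simp add: Z_def)
qed

text \<open>\<open>row_bound\<close> majorizes the terms for all \<beta> > 0 at once, so the limit
  passes inside the double sum.\<close>

lemma tendsto_south_modes:
  assumes d: "d > 0" and \<eta>: "\<eta> > 0" and Y: "\<bar>Y\<bar> \<le> \<eta>"
  shows "((\<lambda>\<beta>. south_modes d \<xi> \<eta> (row_term d n \<beta>) X Y) \<longlongrightarrow> south_modes d \<xi> \<eta> (row_limit d n) X Y) (at_right 0)"
  unfolding south_modes_def
proof (rule tendsto_infsum_dominated[OF _ _ row_bound_summable[OF d \<eta>]])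
  let ?S = "{..-2::int} \<times> (UNIV - {0::int})"
  let ?T = "\<lambda>T :: real \<Rightarrow> real \<Rightarrow> int \<Rightarrow> complex. \<lambda>(N, a). T (X - of_int N * \<xi>) (Y - of_int N * \<eta>) a"
  show "((\<lambda>\<beta>. ?T (row_term d n \<beta>) p) \<longlongrightarrow> ?T (row_limit d n) p) (at_right 0)" if S: "p \<in> ?S" for p
  proof -
    obtain N a where p: "p = (N, a)" "a \<noteq> 0" "N \<le> -2" using S by (cases p) auto
    have "Y - of_int N * \<eta> \<ge> 0" using exp_height_bound(2)[OF d \<eta> p(2,3) Y] \<eta> by simp
    then show ?thesis unfolding p prod.case by (intro tendsto_row_term d p(2))
  qed
  show "\<forall>\<^sub>F \<beta> in at_right 0. \<forall>p\<in>?S. norm (?T (row_term d n \<beta>) p) \<le> (\<lambda>(N, a). row_bound d \<eta> N a) p"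
    using eventually_at_right_less[of "0::real"]
    by eventually_elim (use norm_row_term_le[OF d \<eta> _ _ Y] in auto)
qed simp

section \<open>The limiting modes in closed form\<close>

text \<open>The contribution of frequency \<open>a\<close> after summing its limiting mode over all
  rows. The height \<open>Y\<close> is kept explicit because it splits into target height minus
  source height, the origin of the two terms with \<open>D_pts\<close>.\<close>

definition south_coef :: "real \<Rightarrow> real \<Rightarrow> real \<Rightarrow> 2 \<Rightarrow> 2 \<Rightarrow> real \<Rightarrow> real \<Rightarrow> int \<Rightarrow> complex" where
  "south_coef d \<xi> \<eta> i j X Y a = (let q = exp (- Q_south d \<xi> \<eta> a); b = B_mat a $ i $ j in
     of_real (1 / (4 * d)) * (of_real (exp (- (\<bar>alpha d a\<bar> * Y))) * cis (alpha d a * X)) *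
     (q\<^sup>2 / (1 - q) * ((if i = j then of_real (1 / \<bar>alpha d a\<bar>) else 0) - b * of_real Y)
      - b * of_real \<eta> * (q\<^sup>2 * (2 - q) / (1 - q)\<^sup>2)))"

text \<open>Writing \<open>k + 2\<close> as \<open>Suc k + 1\<close> reduces the second series to
  the geometric series and its derivative. The exponents start at 2 because the rows start at
  -2.\<close>

lemma has_sum_shifted_arith_geometric:
  fixes q :: complex
  assumes "norm q < 1"
  shows "((\<lambda>k. q ^ (k + 2)) has_sum q\<^sup>2 / (1 - q)) UNIV"
    and "((\<lambda>k. of_nat (k + 2) * q ^ (k + 2)) has_sum q\<^sup>2 * (2 - q) / (1 - q)\<^sup>2) UNIV"
proof -
  have q1: "q \<noteq> 1" using assms by auto
  have g: "((\<lambda>k. q ^ k) has_sum 1 / (1 - q)) UNIV" by (rule has_sum_geometric[OF assms])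
  have g': "((\<lambda>k. of_nat (Suc k) * q ^ k) has_sum 1 / (1 - q)\<^sup>2) UNIV"
  proof (rule norm_summable_imp_has_sum)
    have "summable (\<lambda>k. of_nat (Suc k) * norm q ^ k)"
      using geometric_deriv_sums[of "norm q"] assms by (simp add: sums_iff)
    then show "summable (\<lambda>k. norm (of_nat (Suc k) * q ^ k))" by (simp only: norm_mult norm_of_nat norm_power)
  qed (rule geometric_deriv_sums[OF assms])
  show "((\<lambda>k. q ^ (k + 2)) has_sum q\<^sup>2 / (1 - q)) UNIV"
    using has_sum_cmult_right[OF g, of "q\<^sup>2"] by (simp add: power_add power2_eq_square mult_ac)
  have "((\<lambda>k. q\<^sup>2 * (of_nat (Suc k) * q ^ k + q ^ k)) has_sum q\<^sup>2 * (1 / (1 - q)\<^sup>2 + 1 / (1 - q))) UNIV"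
    by (intro has_sum_cmult_right has_sum_add g g')
  also have "q\<^sup>2 * (1 / (1 - q)\<^sup>2 + 1 / (1 - q)) = q\<^sup>2 * (2 - q) / (1 - q)\<^sup>2"
  proof -
    have "1 / w\<^sup>2 + 1 / w = (1 + w) / w\<^sup>2" if "w \<noteq> 0" for w :: complex
      using that by (simp add: field_simps power2_eq_square)
    from this[of "1 - q"] show ?thesis using q1 by simp
  qed
  also have "(\<lambda>k. q\<^sup>2 * (of_nat (Suc k) * q ^ k + q ^ k)) = (\<lambda>k. of_nat (k + 2) * q ^ (k + 2))"
    by (simp add: fun_eq_iff power_add power2_eq_square algebra_simps)
  finally show "((\<lambda>k. of_nat (k + 2) * q ^ (k + 2)) has_sum q\<^sup>2 * (2 - q) / (1 - q)\<^sup>2) UNIV" .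
qed

lemma norm_exp_Q_south:
  "d > 0 \<Longrightarrow> norm (exp (- Q_south d \<xi> \<eta> a)) = exp (- (\<bar>alpha d a\<bar> * \<eta>))"
  by (simp add: Q_south_def norm_exp_eq_Re)

lemma B_mat_entry: "B_mat a $ i $ j = (if i \<noteq> j then \<i> * of_int (sgn a) else if i = 1 then 1 else -1)"
  using exhaust_2[of i] exhaust_2[of j] by (auto simp: B_mat_def)

lemma norm_B_mat_le: "norm (B_mat a $ i $ j) \<le> 1"
  by (simp add: B_mat_entry norm_mult sgn_if)

text \<open>The three limits share one form, an identity part from the derivative of the symbol and
  a part linear in the height; the coefficients of the latter make up \<open>B_mat\<close>.\<close>

lemma mode_limit_index:
  assumes "d > 0"
  shows "mode_limit (mode_index i j) y (alpha d a) = of_real (exp (- (\<bar>alpha d a\<bar> * y)) / 2) *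
     ((if i = j then of_real (1 / \<bar>alpha d a\<bar>) else 0) - B_mat a $ i $ j * of_real y)"
proof -
  have "sgn (alpha d a) = of_int (sgn a)"
    using assms by (auto simp: alpha_def sgn_if mult_less_0_iff zero_less_mult_iff divide_less_0_iff zero_less_divide_iff)
  then have "of_real (sgn (alpha d a)) = (of_int (sgn a) :: complex)" by (metis of_real_of_int_eq)
  then show ?thesis
    using exhaust_2[of i] exhaust_2[of j] unfolding mode_limit_def mode_index_def B_mat_entry by auto
qed

text \<open>Going down one row multiplies the wave by \<open>q = exp (- Q)\<close>. Together with
  the factor linear in the height, which grows by \<eta> per row, this gives a geometric and an
  arithmetic-geometric series.\<close>

lemma row_limit_has_sum:
  assumes d: "d > 0" and \<eta>: "\<eta> > 0" and a: "a \<noteq> 0"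
  shows "((\<lambda>N. row_limit d (mode_index i j) (X - of_int N * \<xi>) (Y - of_int N * \<eta>) a) has_sum south_coef d \<xi> \<eta> i j X Y a) {..-2}"
proof (rule has_sum_atMost_int)
  define q where "q = exp (- Q_south d \<xi> \<eta> a)"
  define b where "b = B_mat a $ i $ j"
  define \<delta> :: complex where "\<delta> = (if i = j then of_real (1 / \<bar>alpha d a\<bar>) else 0)"
  define E where "E = of_real (exp (- (\<bar>alpha d a\<bar> * Y))) * cis (alpha d a * X)"
  have "\<bar>alpha d a\<bar> * \<eta> > 0" using alpha_nonzero[OF d a] \<eta> by simp
  then have nq: "norm q < 1" unfolding q_def norm_exp_Q_south[OF d] by simp
  have "((\<lambda>k. of_real (1 / (4 * d)) * E * ((\<delta> - b * of_real Y) * q ^ (k + 2) + (- b * of_real \<eta>) * (of_nat (k + 2) * q ^ (k + 2))))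
     has_sum of_real (1 / (4 * d)) * E * ((\<delta> - b * of_real Y) * (q\<^sup>2 / (1 - q)) + (- b * of_real \<eta>) * (q\<^sup>2 * (2 - q) / (1 - q)\<^sup>2))) UNIV"
    by (intro has_sum_cmult_right has_sum_add has_sum_shifted_arith_geometric nq)
  also have "of_real (1 / (4 * d)) * E * ((\<delta> - b * of_real Y) * (q\<^sup>2 / (1 - q)) + (- b * of_real \<eta>) * (q\<^sup>2 * (2 - q) / (1 - q)\<^sup>2)) = south_coef d \<xi> \<eta> i j X Y a"
    unfolding south_coef_def Let_def q_def[symmetric] b_def[symmetric] \<delta>_def[symmetric] E_def[symmetric]
    by (simp add: mult.commute)
  also have "(\<lambda>k. of_real (1 / (4 * d)) * E * ((\<delta> - b * of_real Y) * q ^ (k + 2) + (- b * of_real \<eta>) * (of_nat (k + 2) * q ^ (k + 2))))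
     = (\<lambda>k. row_limit d (mode_index i j) (X - of_int (-2 - int k) * \<xi>) (Y - of_int (-2 - int k) * \<eta>) a)"
  proof
    fix k
    define n where "n = real (k + 2)"
    have N: "X - of_int (-2 - int k) * \<xi> = X + n * \<xi>" "Y - of_int (-2 - int k) * \<eta> = Y + n * \<eta>"
      by (simp_all add: n_def algebra_simps)
    have "q ^ (k + 2) = exp (of_real n * (- Q_south d \<xi> \<eta> a))"
      by (simp only: q_def n_def of_real_of_nat_eq exp_of_nat_mult)
    then have Eq: "E * q ^ (k + 2) = of_real (exp (- (\<bar>alpha d a\<bar> * (Y + n * \<eta>)))) * cis (alpha d a * (X + n * \<xi>))"
      unfolding E_def Q_south_def by (simp add: cis_conv_exp exp_of_real[symmetric] mult_exp_exp algebra_simps)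
    have n: "of_nat (k + 2) = (of_real n :: complex)" by (simp add: n_def)
    have "of_real (1 / (4 * d)) * E * ((\<delta> - b * of_real Y) * q ^ (k + 2) + (- b * of_real \<eta>) * (of_nat (k + 2) * q ^ (k + 2)))
      = of_real (1 / (4 * d)) * (E * q ^ (k + 2)) * (\<delta> - b * of_real (Y + n * \<eta>))"
    proof -
      have "A * E * ((u - b * y) * P + (- b * h) * (v * P)) = A * (E * P) * (u - b * (y + v * h))"
        for A u y P h v :: complex by (simp add: algebra_simps)
      then show ?thesis by (simp only: n of_real_add of_real_mult)
    qed
    also have "\<dots> = row_limit d (mode_index i j) (X - of_int (-2 - int k) * \<xi>) (Y - of_int (-2 - int k) * \<eta>) a"
      unfolding N Eq row_limit_def mode_limit_index[OF d] b_def[symmetric] \<delta>_def[symmetric] by simp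
    finally show "of_real (1 / (4 * d)) * E * ((\<delta> - b * of_real Y) * q ^ (k + 2) + (- b * of_real \<eta>) * (of_nat (k + 2) * q ^ (k + 2)))
      = row_limit d (mode_index i j) (X - of_int (-2 - int k) * \<xi>) (Y - of_int (-2 - int k) * \<eta>) a" .
  qed
  finally show "((\<lambda>k. row_limit d (mode_index i j) (X - of_int (-2 - int k) * \<xi>) (Y - of_int (-2 - int k) * \<eta>) a) has_sum south_coef d \<xi> \<eta> i j X Y a) UNIV" .
qed

text \<open>Collected from the estimate of \<open>south_coef\<close>: \<open>w\<close> bounds
  \<open>norm (1 - q)\<close> from below, 3 bounds \<open>norm (2 - q)\<close>,
  \<open>d / (2 * pi)\<close> bounds \<open>1 / \<bar>alpha d a\<bar>\<close>, and \<eta> bounds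
  \<open>\<bar>Y\<bar>\<close>.\<close>

definition south_const :: "real \<Rightarrow> real \<Rightarrow> real" where
  "south_const d \<eta> = (let w = 1 - exp (- (2 * pi * \<eta> / d)) in
     1 / (4 * d) * (1 / w * (d / (2 * pi) + \<eta>) + \<eta> * (3 / w\<^sup>2)))"

lemma south_const_pos:
  assumes "d > 0" "\<eta> > 0"
  shows "south_const d \<eta> > 0"
proof -
  have "1 - exp (- (2 * pi * \<eta> / d)) > 0" using assms by simp
  then show ?thesis using assms unfolding south_const_def Let_def
    by (intro mult_pos_pos add_pos_pos divide_pos_pos) auto
qed

text \<open>Since \<open>Y\<close> may be as low as \<open>- \<eta>\<close>, the factor
  \<open>exp (- (\<bar>alpha d a\<bar> * Y))\<close> may reach \<open>exp (\<kappa> * p)\<close>.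
  The square of \<open>q\<close> brings \<open>exp (- 2 * \<kappa> * p)\<close>, and one factor
  \<open>exp (- \<kappa> * p)\<close> survives.\<close>

lemma norm_south_coef_le:
  assumes d: "d > 0" and \<eta>: "\<eta> > 0" and a: "a \<noteq> 0" and Y: "\<bar>Y\<bar> \<le> \<eta>"
  shows "norm (south_coef d \<xi> \<eta> i j X Y a) \<le> south_const d \<eta> * exp (- (2 * pi * \<eta> / d) * \<bar>real_of_int a\<bar>)"
proof -
  define \<kappa> p where "\<kappa> = 2 * pi * \<eta> / d" and "p = \<bar>real_of_int a\<bar>"
  define q where "q = exp (- Q_south d \<xi> \<eta> a)"
  define b where "b = B_mat a $ i $ j"
  define \<delta> :: complex where "\<delta> = (if i = j then of_real (1 / \<bar>alpha d a\<bar>) else 0)"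
  define w where "w = 1 - exp (- \<kappa>)"
  have \<kappa>: "\<kappa> > 0" using d \<eta> by (simp add: \<kappa>_def)
  have w: "w > 0" using \<kappa> by (simp add: w_def)
  have p: "p \<ge> 1" using a by (simp add: p_def)
  have al: "\<bar>alpha d a\<bar> = 2 * pi / d * p" using alpha_abs[OF d] by (simp add: p_def)
  have al\<eta>: "\<bar>alpha d a\<bar> * \<eta> = \<kappa> * p" by (simp add: al \<kappa>_def)
  have \<delta>: "norm \<delta> \<le> d / (2 * pi)"
    using inverse_alpha_le[OF d a] d by (simp add: \<delta>_def norm_divide)
  have nq: "norm q = exp (- (\<kappa> * p))" by (simp only: q_def norm_exp_Q_south[OF d] al\<eta>)
  have "\<kappa> * 1 \<le> \<kappa> * p" using \<kappa> p by (intro mult_left_mono) auto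
  then have "norm q \<le> exp (- \<kappa>)" by (simp add: nq)
  then have w1: "norm (1 - q) \<ge> w" using norm_triangle_ineq2[of 1 q] by (simp add: w_def)
  have nq1: "norm q \<le> 1" using \<kappa> p by (simp add: nq)
  have b: "norm b \<le> 1" by (simp add: b_def norm_B_mat_le)
  have b1: "norm (\<delta> - b * of_real Y) \<le> d / (2 * pi) + \<eta>"
  proof -
    have "norm (b * of_real Y) \<le> 1 * \<eta>" unfolding norm_mult using b Y by (intro mult_mono) auto
    then show ?thesis using norm_triangle_ineq4[of \<delta> "b * of_real Y"] \<delta> by linarith
  qed
  have b2: "norm (1 / (1 - q) * (\<delta> - b * of_real Y)) \<le> 1 / w * (d / (2 * pi) + \<eta>)"
    unfolding norm_mult norm_divide using b1 w w1 by (intro mult_mono divide_mono) auto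
  have b3: "norm (b * of_real \<eta> * ((2 - q) / (1 - q)\<^sup>2)) \<le> \<eta> * (3 / w\<^sup>2)"
  proof -
    have "norm (2 - q) \<le> 3" using norm_triangle_ineq4[of 2 q] nq1 by simp
    then have "norm ((2 - q) / (1 - q)\<^sup>2) \<le> 3 / w\<^sup>2"
      unfolding norm_divide norm_power using w w1 by (intro divide_mono power_mono) auto
    moreover have "norm (b * of_real \<eta>) \<le> \<eta>" using b \<eta> by (simp add: norm_mult)
    ultimately show ?thesis unfolding norm_mult[of "b * of_real \<eta>"] using \<eta> by (intro mult_mono) auto
  qed
  have "exp (- (\<bar>alpha d a\<bar> * Y)) \<le> exp (\<kappa> * p)"
  proof -
    have "\<bar>alpha d a\<bar> * (- Y) \<le> \<bar>alpha d a\<bar> * \<eta>" using Y by (intro mult_left_mono) auto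
    then show ?thesis by (simp add: al\<eta>)
  qed
  then have "exp (- (\<bar>alpha d a\<bar> * Y)) * exp (- (\<kappa> * p)) ^ 2 \<le> exp (\<kappa> * p) * exp (- (\<kappa> * p)) ^ 2"
    by (intro mult_right_mono) auto
  also have "\<dots> = exp (- \<kappa> * p)" by (simp add: power2_eq_square mult_exp_exp)
  finally have e: "exp (- (\<bar>alpha d a\<bar> * Y)) * exp (- (\<kappa> * p)) ^ 2 \<le> exp (- \<kappa> * p)" .
  have "south_coef d \<xi> \<eta> i j X Y a = of_real (1 / (4 * d)) * (of_real (exp (- (\<bar>alpha d a\<bar> * Y))) * q\<^sup>2) * cis (alpha d a * X) *
     (1 / (1 - q) * (\<delta> - b * of_real Y) - b * of_real \<eta> * ((2 - q) / (1 - q)\<^sup>2))"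
  proof -
    have "A * (E * c) * (q2 / v * u - h * (q2 * z / v2)) = A * (E * q2) * c * (1 / v * u - h * (z / v2))"
      for A E c q2 v u h z v2 :: complex by (simp add: algebra_simps)
    then show ?thesis
      unfolding south_coef_def Let_def q_def[symmetric] b_def[symmetric] \<delta>_def[symmetric] .
  qed
  then have "norm (south_coef d \<xi> \<eta> i j X Y a) = 1 / (4 * d) * (exp (- (\<bar>alpha d a\<bar> * Y)) * exp (- (\<kappa> * p)) ^ 2) *
     norm (1 / (1 - q) * (\<delta> - b * of_real Y) - b * of_real \<eta> * ((2 - q) / (1 - q)\<^sup>2))"
    using d by (simp only: norm_mult norm_of_real norm_cis norm_power nq) simp
  also have "\<dots> \<le> 1 / (4 * d) * exp (- \<kappa> * p) * (1 / w * (d / (2 * pi) + \<eta>) + \<eta> * (3 / w\<^sup>2))"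
    using d e b2 b3 by (intro mult_mono mult_left_mono order_trans[OF norm_triangle_ineq4] add_mono) auto
  also have "\<dots> = south_const d \<eta> * exp (- (2 * pi * \<eta> / d) * \<bar>real_of_int a\<bar>)"
    by (simp add: south_const_def Let_def \<kappa>_def w_def p_def)
  finally show ?thesis .
qed

section \<open>Truncation of the frequencies\<close>

lemma exp_neg_abs_tail:
  assumes "\<kappa> > 0" "M \<ge> 0"
  shows "((\<lambda>a::int. exp (- \<kappa> * \<bar>real_of_int a\<bar>)) has_sum 2 * exp (- \<kappa> * (of_int M + 1)) / (1 - exp (- \<kappa>))) {a. \<bar>a\<bar> > M}"
proof -
  define f where "f = (\<lambda>a::int. exp (- \<kappa> * \<bar>real_of_int a\<bar>))"
  have "f (- M - 1 - int k) = exp (- \<kappa> * (of_int M + 1)) * exp (- \<kappa>) ^ k" for k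
  proof -
    have "\<bar>real_of_int (- M - 1 - int k)\<bar> = of_int M + 1 + real k" using assms(2) by simp
    then show ?thesis unfolding f_def by (simp add: exp_of_nat_mult[symmetric] mult_exp_exp algebra_simps)
  qed
  moreover have "((\<lambda>k. exp (- \<kappa> * (of_int M + 1)) * exp (- \<kappa>) ^ k) has_sum exp (- \<kappa> * (of_int M + 1)) * (1 / (1 - exp (- \<kappa>)))) UNIV"
    by (intro has_sum_cmult_right has_sum_geometric) (use assms in auto)
  ultimately have 1: "(f has_sum exp (- \<kappa> * (of_int M + 1)) * (1 / (1 - exp (- \<kappa>)))) {..- M - 1}"
    by (intro has_sum_atMost_int) simp
  then have 2: "(f has_sum exp (- \<kappa> * (of_int M + 1)) * (1 / (1 - exp (- \<kappa>)))) (uminus ` {..- M - 1})"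
    by (subst has_sum_reindex) (auto simp: f_def comp_def)
  have U: "uminus ` {..- M - 1} = {M + 1..}" by (simp add: image_uminus_atMost add.commute)
  have D: "{..- M - 1} \<inter> {M + 1..} = {}" using assms(2) by auto
  from has_sum_Un_disjoint[OF 1 2[unfolded U] D]
  have "(f has_sum 2 * exp (- \<kappa> * (of_int M + 1)) / (1 - exp (- \<kappa>))) ({..- M - 1} \<union> {M + 1..})"
    by simp
  moreover have "{..- M - 1} \<union> {M + 1..} = {a. \<bar>a\<bar> > M}" using assms(2) by auto
  ultimately show ?thesis by (simp add: f_def)
qed

text \<open>With \<open>\<kappa> = 2 * pi * \<eta> / d\<close>, the truncation index solves
  \<open>exp (- \<kappa> * M) = (1 - exp (- \<kappa>)) * \<epsilon>\<close> up to rounding upwards.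
  The factor \<open>1 - exp (- \<kappa>)\<close> is meant to cancel the denominator of the geometric
  tail.\<close>

lemma trunc_M_bound:
  assumes d: "d > 0" and \<eta>: "\<eta> > 0" and \<epsilon>: "0 < \<epsilon>" "\<epsilon> < 1"
  shows "trunc_M d \<eta> \<epsilon> \<ge> 0"
    and "exp (- (2 * pi * \<eta> / d) * of_int (trunc_M d \<eta> \<epsilon>)) \<le> (1 - exp (- (2 * pi * \<eta> / d))) * \<epsilon>"
proof -
  define \<kappa> where "\<kappa> = 2 * pi * \<eta> / d"
  define w where "w = 1 - exp (- \<kappa>)"
  have \<kappa>: "\<kappa> > 0" using d \<eta> by (simp add: \<kappa>_def)
  have w: "0 < w" "w < 1" using \<kappa> by (auto simp: w_def)
  have M: "real_of_int (trunc_M d \<eta> \<epsilon>) \<ge> 1 / \<kappa> * ln (1 / w * (1 / \<epsilon>))"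
    unfolding trunc_M_def w_def \<kappa>_def by simp
  have "w * \<epsilon> < 1 * 1" using w \<epsilon> by (intro mult_strict_mono) auto
  then have "1 / w * (1 / \<epsilon>) \<ge> 1" using w \<epsilon> by (simp add: field_simps)
  then have "1 / \<kappa> * ln (1 / w * (1 / \<epsilon>)) \<ge> 0" using \<kappa> by (intro mult_nonneg_nonneg ln_ge_zero) auto
  then show "trunc_M d \<eta> \<epsilon> \<ge> 0" using M by linarith
  have "ln (1 / w * (1 / \<epsilon>)) \<le> \<kappa> * of_int (trunc_M d \<eta> \<epsilon>)" using M \<kappa> by (simp add: field_simps)
  moreover have "1 / w * (1 / \<epsilon>) > 0" using w \<epsilon> by simp
  ultimately have "1 / w * (1 / \<epsilon>) \<le> exp (\<kappa> * of_int (trunc_M d \<eta> \<epsilon>))"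
    by (metis exp_le_cancel_iff exp_ln)
  then have "exp (- \<kappa> * of_int (trunc_M d \<eta> \<epsilon>)) \<le> w * \<epsilon>"
    using w \<epsilon> by (simp add: exp_minus field_simps)
  then show "exp (- (2 * pi * \<eta> / d) * of_int (trunc_M d \<eta> \<epsilon>)) \<le> (1 - exp (- (2 * pi * \<eta> / d))) * \<epsilon>"
    by (simp add: \<kappa>_def w_def)
qed

text \<open>Absolute summability over the pairs permits summing over the rows first, which yields
  the closed form at each frequency.\<close>

lemma south_modes_limit:
  assumes d: "d > 0" and \<eta>: "\<eta> > 0" and Y: "\<bar>Y\<bar> \<le> \<eta>"
  shows "(south_coef d \<xi> \<eta> i j X Y has_sum south_modes d \<xi> \<eta> (row_limit d (mode_index i j)) X Y) (UNIV - {0})"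
proof -
  let ?T = "\<lambda>N a. row_limit d (mode_index i j) (X - of_int N * \<xi>) (Y - of_int N * \<eta>) a"
  have pairs: "(\<lambda>(N, a). ?T N a) summable_on ({..-2} \<times> (UNIV - {0}))"
    by (rule south_pairs_summable[OF d \<eta>]) (rule norm_row_limit_le[OF d \<eta> _ _ Y])
  have "south_modes d \<xi> \<eta> (row_limit d (mode_index i j)) X Y = (\<Sum>\<^sub>\<infinity>N\<in>{..-2}. \<Sum>\<^sub>\<infinity>a\<in>UNIV - {0}. ?T N a)"
    unfolding south_modes_def by (rule infsum_Sigma'_banach[OF pairs, symmetric])
  also have "\<dots> = (\<Sum>\<^sub>\<infinity>a\<in>UNIV - {0}. \<Sum>\<^sub>\<infinity>N\<in>{..-2}. ?T N a)"
    by (rule infsum_swap_banach[OF pairs])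
  also have "\<dots> = (\<Sum>\<^sub>\<infinity>a\<in>UNIV - {0}. south_coef d \<xi> \<eta> i j X Y a)"
    by (rule infsum_cong) (use infsumI[OF row_limit_has_sum[OF d \<eta>]] in auto)
  finally have eq: "south_modes d \<xi> \<eta> (row_limit d (mode_index i j)) X Y = infsum (south_coef d \<xi> \<eta> i j X Y) (UNIV - {0})" .
  have "south_coef d \<xi> \<eta> i j X Y summable_on (UNIV - {0})"
  proof (rule abs_summable_summable, rule summable_on_comparison_test)
    show "(\<lambda>a. south_const d \<eta> * exp (- (2 * pi * \<eta> / d) * \<bar>real_of_int a\<bar>)) summable_on (UNIV - {0})"
      by (rule summable_on_subset_banach[OF summable_on_cmult_right[OF summable_on_exp_neg_abs_int]]) (use d \<eta> in auto)
  qed (use norm_south_coef_le[OF d \<eta> _ Y] in auto)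
  then show ?thesis unfolding eq by (rule has_sum_infsum)
qed

text \<open>The factor 2 counts the tails of the positive and of the negative frequencies.\<close>

lemma south_modes_truncation:
  assumes d: "d > 0" and \<eta>: "\<eta> > 0" and Y: "\<bar>Y\<bar> \<le> \<eta>" and \<epsilon>: "0 < \<epsilon>" "\<epsilon> < 1"
  defines "M \<equiv> trunc_M d \<eta> \<epsilon>"
  shows "norm (south_modes d \<xi> \<eta> (row_limit d (mode_index i j)) X Y - (\<Sum>a\<in>{-M..M} - {0}. south_coef d \<xi> \<eta> i j X Y a)) \<le> 2 * south_const d \<eta> * \<epsilon>"
proof -
  define \<kappa> where "\<kappa> = 2 * pi * \<eta> / d"
  have \<kappa>: "\<kappa> > 0" using d \<eta> by (simp add: \<kappa>_def)
  have M: "M \<ge> 0" "exp (- \<kappa> * of_int M) \<le> (1 - exp (- \<kappa>)) * \<epsilon>"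
    using trunc_M_bound[OF d \<eta> \<epsilon>] by (simp_all add: M_def \<kappa>_def)
  let ?F = "south_coef d \<xi> \<eta> i j X Y"
  have all: "(?F has_sum south_modes d \<xi> \<eta> (row_limit d (mode_index i j)) X Y) (UNIV - {0})"
    by (rule south_modes_limit[OF d \<eta> Y])
  have sub: "?F summable_on {a. \<bar>a\<bar> > M}"
    by (rule summable_on_subset_banach[OF has_sum_imp_summable[OF all]]) (use M in auto)
  have "(?F has_sum (\<Sum>a\<in>{-M..M} - {0}. ?F a) + infsum ?F {a. \<bar>a\<bar> > M}) (({-M..M} - {0}) \<union> {a. \<bar>a\<bar> > M})"
    by (rule has_sum_Un_disjoint[OF has_sum_finite has_sum_infsum[OF sub]]) auto
  moreover have "({-M..M} - {0}) \<union> {a. \<bar>a\<bar> > M} = UNIV - {0}" using M by auto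
  ultimately have "south_modes d \<xi> \<eta> (row_limit d (mode_index i j)) X Y = (\<Sum>a\<in>{-M..M} - {0}. ?F a) + infsum ?F {a. \<bar>a\<bar> > M}"
    using has_sum_unique[OF all] by simp
  then have "norm (south_modes d \<xi> \<eta> (row_limit d (mode_index i j)) X Y - (\<Sum>a\<in>{-M..M} - {0}. ?F a)) = norm (infsum ?F {a. \<bar>a\<bar> > M})"
    by simp
  also have "\<dots> \<le> south_const d \<eta> * (2 * exp (- \<kappa> * (of_int M + 1)) / (1 - exp (- \<kappa>)))"
  proof (rule norm_infsum_le[OF has_sum_infsum[OF sub] has_sum_cmult_right[OF exp_neg_abs_tail[OF \<kappa> M(1)]]])
    show "norm (?F a) \<le> south_const d \<eta> * exp (- \<kappa> * \<bar>real_of_int a\<bar>)" if "a \<in> {a. \<bar>a\<bar> > M}" for a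
      using norm_south_coef_le[OF d \<eta> _ Y, of a \<xi> i j X] that M by (auto simp: \<kappa>_def)
  qed
  also have "\<dots> \<le> south_const d \<eta> * (2 * \<epsilon>)"
  proof (rule mult_left_mono)
    have w: "1 - exp (- \<kappa>) > 0" using \<kappa> by simp
    \<comment> \<open>The omitted frequencies begin at \<open>M + 1\<close>; the extra factor
      \<open>exp (- \<kappa>)\<close> is given away.\<close>
    have "exp (- \<kappa> * (of_int M + 1)) \<le> exp (- \<kappa> * of_int M)" using \<kappa> by simp
    also note M(2)
    finally show "2 * exp (- \<kappa> * (of_int M + 1)) / (1 - exp (- \<kappa>)) \<le> 2 * \<epsilon>"
      using w by (simp add: pos_divide_le_eq mult.commute)
    show "0 \<le> south_const d \<eta>" using south_const_pos[OF d \<eta>] by simp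
  qed
  finally show ?thesis by (simp add: mult_ac)
qed

section \<open>The zero mode and the block matrices\<close>

lemma tendsto_exp_difference_quotient:
  "((\<lambda>\<beta>. (exp (c * \<beta>) - 1) / \<beta>) \<longlongrightarrow> (c::real)) (at_right 0)"
proof -
  have "((\<lambda>\<beta>. exp (c * \<beta>)) has_real_derivative c) (at 0)"
    by (auto intro!: derivative_eq_intros)
  then have "((\<lambda>\<beta>. (exp (c * \<beta>) - 1) / \<beta>) \<longlongrightarrow> c) (at 0)" by (simp add: DERIV_def)
  then show ?thesis by (rule tendsto_within_subset) auto
qed

text \<open>The zero mode is of order \<open>1 / \<beta>\<^sup>2\<close>. Neutrality removes one power of \<open>1 / \<beta>\<close>, and the difference
  of two targets the other one.\<close>

lemma tendsto_south_zero:
  fixes q p :: "'a \<Rightarrow> real"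
  assumes d: "d > 0" and \<eta>: "\<eta> > 0" and q: "(\<Sum>j\<in>J. q j) = 0"
  shows "((\<lambda>\<beta>. \<Sum>j\<in>J. (south_zero d \<eta> \<beta> (y - p j) - south_zero d \<eta> \<beta> (y' - p j)) * q j)
     \<longlongrightarrow> - (1 / (2 * d * \<eta>)) * ((y - y') * (\<Sum>j\<in>J. p j * q j))) (at_right 0)"
proof -
  \<comment> \<open>A quotient with limit \<open>c\<close>. The term
    \<open>1 - exp (- (\<beta> * \<eta>))\<close> in the denominator, the difference of targets and
    the neutral sum over the sources are each \<beta> times such quotients, so that the two powers
    of \<beta> below cancel against two above.\<close>
  define E where "E c \<beta> = (exp (c * \<beta>) - 1) / \<beta>" for c \<beta> :: real
  have E: "(E c \<longlongrightarrow> c) (at_right 0)" for c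
    unfolding E_def by (rule tendsto_exp_difference_quotient)
  have "((\<lambda>\<beta>. exp (- 2 * (\<beta> * \<eta>)) / (2 * d * (- E (- \<eta>) \<beta>)) * (E (- y) \<beta> - E (- y') \<beta>) * (\<Sum>j\<in>J. E (p j) \<beta> * q j))
     \<longlongrightarrow> exp (- 2 * (0 * \<eta>)) / (2 * d * (- (- \<eta>))) * (- y - (- y')) * (\<Sum>j\<in>J. p j * q j)) (at_right 0)"
    by (intro tendsto_intros E) (use d \<eta> in auto)
  moreover have "exp (- 2 * (0 * \<eta>)) / (2 * d * (- (- \<eta>))) * (- y - (- y')) * (\<Sum>j\<in>J. p j * q j)
     = - (1 / (2 * d * \<eta>)) * ((y - y') * (\<Sum>j\<in>J. p j * q j))"
  proof -
    have "1 / c * (- y - (- y')) * S = - (1 / c) * ((y - y') * S)" for c S :: real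
      by (simp add: algebra_simps diff_divide_distrib)
    then show ?thesis by simp
  qed
  moreover have "\<forall>\<^sub>F \<beta> in at_right 0. exp (- 2 * (\<beta> * \<eta>)) / (2 * d * (- E (- \<eta>) \<beta>)) * (E (- y) \<beta> - E (- y') \<beta>) * (\<Sum>j\<in>J. E (p j) \<beta> * q j)
     = (\<Sum>j\<in>J. (south_zero d \<eta> \<beta> (y - p j) - south_zero d \<eta> \<beta> (y' - p j)) * q j)"
    using eventually_at_right_less[of "0::real"]
  proof eventually_elim
    case (elim \<beta>)
    define w where "w = 1 - exp (- (\<beta> * \<eta>))"
    have w: "w > 0" using elim \<eta> by (simp add: w_def)
    define K where "K = exp (- 2 * (\<beta> * \<eta>)) / (2 * d * \<beta> * w)"
    have "(\<Sum>j\<in>J. (south_zero d \<eta> \<beta> (y - p j) - south_zero d \<eta> \<beta> (y' - p j)) * q j)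
       = (\<Sum>j\<in>J. K * (exp (- y * \<beta>) - exp (- y' * \<beta>)) * (exp (p j * \<beta>) * q j))"
    proof (rule sum.cong[OF refl])
      fix j
      have E2: "exp (- (\<beta> * (z - p j))) = exp (- z * \<beta>) * exp (p j * \<beta>)" for z
        by (simp add: mult_exp_exp algebra_simps)
      show "(south_zero d \<eta> \<beta> (y - p j) - south_zero d \<eta> \<beta> (y' - p j)) * q j = K * (exp (- y * \<beta>) - exp (- y' * \<beta>)) * (exp (p j * \<beta>) * q j)"
        unfolding south_zero_def w_def[symmetric] K_def[symmetric] E2 by (simp add: algebra_simps)
    qed
    also have "\<dots> = K * (exp (- y * \<beta>) - exp (- y' * \<beta>)) * (\<Sum>j\<in>J. exp (p j * \<beta>) * q j)"
      by (rule sum_distrib_left[symmetric])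
    also have "(\<Sum>j\<in>J. exp (p j * \<beta>) * q j) = (\<Sum>j\<in>J. (exp (p j * \<beta>) - 1) * q j)"
      using q by (simp add: left_diff_distrib sum_subtractf)
    also have "\<dots> = \<beta> * (\<Sum>j\<in>J. E (p j) \<beta> * q j)"
      unfolding sum_distrib_left by (rule sum.cong) (use elim in \<open>auto simp: E_def\<close>)
    also have "exp (- y * \<beta>) - exp (- y' * \<beta>) = \<beta> * (E (- y) \<beta> - E (- y') \<beta>)"
    proof -
      have "\<beta> * E c \<beta> = exp (c * \<beta>) - 1" for c using elim by (simp add: E_def)
      then show ?thesis by (simp only: right_diff_distrib)
    qed
    also have "K = exp (- 2 * (\<beta> * \<eta>)) / (2 * d * \<beta> * (\<beta> * (- E (- \<eta>) \<beta>)))"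
      using elim by (simp add: K_def E_def w_def mult.commute)
    finally show ?case using elim by (simp add: mult_ac)
  qed
  ultimately show ?thesis using Lim_transform_eventually by fastforce
qed

section \<open>Entries of the block matrix product\<close>

lemma mat_mult_entry:
  fixes X :: "complex ^ 2 ^ 2"
  shows "(mat c ** X) $ i $ j = c * X $ i $ j" "(X ** mat c) $ i $ j = X $ i $ j * c"
  using exhaust_2[of i] exhaust_2[of j] by (auto simp: matrix_matrix_mult_def mat_def sum_2)

lemma block_mult_diag_right:
  assumes "finite I" "m \<in> I"
  shows "block_mult I L (block_diag D) l m = L l m ** D m"
proof -
  have "block_mult I L (block_diag D) l m = (\<Sum>k\<in>I. if k = m then L l m ** D m else 0)"
    unfolding block_mult_def block_diag_def by (rule sum.cong) (auto simp: matrix_matrix_mult_def vec_eq_iff)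
  then show ?thesis using assms by simp
qed

lemma block_mult_diag_left:
  assumes "finite I" "l \<in> I"
  shows "block_mult I (block_diag D) X l m = D l ** X l m"
proof -
  have "block_mult I (block_diag D) X l m = (\<Sum>k\<in>I. if k = l then D l ** X l m else 0)"
    unfolding block_mult_def block_diag_def by (rule sum.cong) (auto simp: matrix_matrix_mult_def vec_eq_iff)
  then show ?thesis using assms by simp
qed

text \<open>The blocks of L and R are multiples of the identity, so each product is a scalar sum
  over the frequencies. The terms with \<open>D_pts\<close> combine to \<open>- Db\<close> times the
  difference of the heights; for nonzero frequencies everything depends on differences of positions
  only, while the zero block keeps the product of the two heights.\<close>

lemma A_south_entry:
  assumes d: "d > 0" and M: "trunc_M d \<eta> \<epsilon> \<ge> 0" and l: "l \<in> {1..N_T}" and j: "j \<in> {1..N_S}"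
  defines "M \<equiv> trunc_M d \<eta> \<epsilon>"
  shows "A_south d \<xi> \<eta> \<epsilon> N_T N_S t s l j $ i $ k =
    (if i = 1 \<and> k = 1 then of_real (- (1 / (2 * d * \<eta>)) * (t l $ 2 * s j $ 2)) else 0) +
    (\<Sum>a\<in>{-M..M} - {0}. south_coef d \<xi> \<eta> i k (t l $ 1 - s j $ 1) (t l $ 2 - s j $ 2) a)"
proof -
  define I where "I = {-M..M}"
  define lam where "lam m = (if m = 0 then complex_of_real (t l $ 2)
     else exp (complex_of_real (- \<bar>alpha d m\<bar> * t l $ 2)) * exp (\<i> * complex_of_real (alpha d m * t l $ 1)))" for m
  define rh where "rh m = (if m = 0 then complex_of_real (s j $ 2)
     else exp (complex_of_real (\<bar>alpha d m\<bar> * s j $ 2)) * exp (- \<i> * complex_of_real (alpha d m * s j $ 1)))" for m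
  have L: "L_south d t l m = mat (lam m)" for m by (simp add: L_south_def lam_def)
  have R: "R_south d s m j = mat (rh m)" for m by (simp add: R_south_def rh_def)
  have LDR: "block_mult I (block_mult I (L_south d t) (block_diag D)) (R_south d s) l j $ i $ k
     = (\<Sum>m\<in>I. lam m * D m $ i $ k * rh m)" for D i k
  proof -
    have "block_mult I (block_mult I (L_south d t) (block_diag D)) (R_south d s) l j
       = (\<Sum>m\<in>I. (mat (lam m) ** D m) ** mat (rh m))"
      unfolding block_mult_def[of I "block_mult I (L_south d t) (block_diag D)"]
      by (rule sum.cong) (auto simp: block_mult_diag_right L R I_def)
    then show ?thesis by (simp add: mat_mult_entry)
  qed
  define Da where "Da m = Da_south d \<xi> \<eta> m m" for m
  define Db where "Db m = Db_south d \<xi> \<eta> m m" for m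
  have diag: "Da_south d \<xi> \<eta> = block_diag Da" "Db_south d \<xi> \<eta> = block_diag Db"
    unfolding Da_def Db_def by (simp_all add: Da_south_def Db_south_def block_diag_def fun_eq_iff)
  note D = Da_def Db_def Da_south_def Db_south_def block_diag_def Let_def
  have "A_south d \<xi> \<eta> \<epsilon> N_T N_S t s l j $ i $ k =
     (\<Sum>m\<in>I. lam m * Da m $ i $ k * rh m) - of_real (t l $ 2) * (\<Sum>m\<in>I. lam m * Db m $ i $ k * rh m)
       + (\<Sum>m\<in>I. lam m * Db m $ i $ k * rh m) * of_real (s j $ 2)"
    unfolding A_south_def Let_def M_def[symmetric] I_def[symmetric] diag D_pts_def
    using l j by (simp add: block_mult_diag_left block_mult_diag_right mat_mult_entry LDR)
  also have "\<dots> = (\<Sum>m\<in>I. lam m * rh m * (Da m $ i $ k - Db m $ i $ k * of_real (t l $ 2 - s j $ 2)))"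
    by (simp add: sum_distrib_left sum_distrib_right sum_subtractf[symmetric] sum.distrib[symmetric] algebra_simps)
  \<comment> \<open>The index 0 lies in the range of summation because
    \<open>M \<ge> 0\<close>.\<close>
  also have "\<dots> = lam 0 * rh 0 * (Da 0 $ i $ k - Db 0 $ i $ k * of_real (t l $ 2 - s j $ 2)) +
     (\<Sum>m\<in>I - {0}. lam m * rh m * (Da m $ i $ k - Db m $ i $ k * of_real (t l $ 2 - s j $ 2)))"
    by (rule sum.remove) (use M in \<open>auto simp: I_def M_def\<close>)
  also have "lam 0 * rh 0 * (Da 0 $ i $ k - Db 0 $ i $ k * of_real (t l $ 2 - s j $ 2))
     = (if i = 1 \<and> k = 1 then of_real (- (1 / (2 * d * \<eta>)) * (t l $ 2 * s j $ 2)) else 0)"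
    using exhaust_2[of i] exhaust_2[of k]
    by (auto simp: lam_def rh_def D scale_mat_def)
  also have "(\<Sum>m\<in>I - {0}. lam m * rh m * (Da m $ i $ k - Db m $ i $ k * of_real (t l $ 2 - s j $ 2)))
     = (\<Sum>m\<in>I - {0}. south_coef d \<xi> \<eta> i k (t l $ 1 - s j $ 1) (t l $ 2 - s j $ 2) m)"
  proof (rule sum.cong[OF refl])
    fix m assume "m \<in> I - {0}"
    then have m: "m \<noteq> 0" by simp
    define q where "q = exp (- Q_south d \<xi> \<eta> m)"
    define b where "b = B_mat m $ i $ k"
    define \<delta> :: complex where "\<delta> = (if i = k then of_real (1 / \<bar>alpha d m\<bar>) else 0)"
    have q2: "exp (- 2 * Q_south d \<xi> \<eta> m) = q\<^sup>2" by (simp add: q_def power2_eq_square mult_exp_exp)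
    have Dae: "Da m $ i $ k = of_real (1 / (4 * d)) * (q\<^sup>2 / (1 - q)) * (\<delta> - (2 - q) / (1 - q) * of_real \<eta> * b)"
      using m unfolding D q2 q_def[symmetric]
      by (simp add: scale_mat_def mat_def \<delta>_def b_def)
    have Dbe: "Db m $ i $ k = of_real (1 / (4 * d)) * (q\<^sup>2 / (1 - q)) * b"
      using m unfolding D q2 q_def[symmetric] by (simp add: scale_mat_def b_def)
    have lr: "lam m * rh m = of_real (exp (- (\<bar>alpha d m\<bar> * (t l $ 2 - s j $ 2)))) * cis (alpha d m * (t l $ 1 - s j $ 1))"
      using m by (simp add: lam_def rh_def cis_conv_exp exp_of_real[symmetric] mult_exp_exp algebra_simps)
    have alg: "E * (A * (q2 / w) * (u - z / w * h * b) - A * (q2 / w) * b * y) = A * E * (q2 / w * (u - b * y) - b * h * (q2 * z / w\<^sup>2))"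
      for E A q2 w u z h y :: complex by (simp add: algebra_simps power2_eq_square)
    show "lam m * rh m * (Da m $ i $ k - Db m $ i $ k * of_real (t l $ 2 - s j $ 2)) = south_coef d \<xi> \<eta> i k (t l $ 1 - s j $ 1) (t l $ 2 - s j $ 2) m"
      unfolding lr Dae Dbe alg south_coef_def Let_def q_def[symmetric] b_def[symmetric] \<delta>_def[symmetric] ..
  qed
  finally show ?thesis by (simp add: I_def)
qed

lemma unit_cell_height:
  assumes "\<eta> > 0" "p \<in> unit_cell d \<xi> \<eta>"
  shows "\<bar>p $ 2\<bar> \<le> \<eta> / 2"
proof -
  obtain x1 x2 where x: "p = x1 *\<^sub>R e1 d + x2 *\<^sub>R e2 \<xi> \<eta>" "x2 \<in> {-1/2..1/2}"
    using assms(2) unfolding unit_cell_def by blast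
  have "p $ 2 = x2 * \<eta>" by (simp add: x(1) e1_def e2_def)
  moreover have "\<bar>x2\<bar> * \<eta> \<le> 1 / 2 * \<eta>" using x(2) assms(1) by (intro mult_right_mono) auto
  ultimately show ?thesis using assms(1) by (simp add: abs_mult)
qed

theorem theorem8:
  fixes d \<xi> \<eta> :: real
  assumes "d > 0" and "\<eta> > 0" and "d \<ge> sqrt (\<xi>\<^sup>2 + \<eta>\<^sup>2)"
  shows "\<exists>C>0. \<forall>(\<epsilon>::real) (N_S::nat) (N_T::nat)
           (s :: nat \<Rightarrow> real ^ 2) (t :: nat \<Rightarrow> real ^ 2) (q :: nat \<Rightarrow> real ^ 2).
     0 < \<epsilon> \<longrightarrow> \<epsilon> < 1 \<longrightarrow>
     (\<forall>j\<in>{1..N_S}. s j \<in> unit_cell d \<xi> \<eta>) \<longrightarrow>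
     (\<forall>l\<in>{1..N_T}. t l \<in> unit_cell d \<xi> \<eta>) \<longrightarrow>
     (\<Sum>j\<in>{1..N_S}. q j) = 0 \<longrightarrow>
     (\<forall>l\<in>{1..N_T}. \<forall>l'\<in>{1..N_T}. \<exists>\<Delta> :: real ^ 2.
        ((\<lambda>\<beta>. \<Sum>j\<in>{1..N_S}. (K2_south d \<xi> \<eta> \<beta> (t l) (s j) - K2_south d \<xi> \<eta> \<beta> (t l') (s j)) *v q j)
           \<longlongrightarrow> \<Delta>) (at_right 0) \<and>
        (let Aq = block_apply {1..N_S} (A_south d \<xi> \<eta> \<epsilon> N_T N_S t s) (\<lambda>j. complex_vec (q j))
         in \<forall>i::2. cmod (complex_of_real (\<Delta> $ i) - (Aq l $ i - Aq l' $ i))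
                      \<le> C * \<epsilon> * (\<Sum>j\<in>{1..N_S}. \<bar>q j $ 1\<bar> + \<bar>q j $ 2\<bar>)))"
proof (rule exI[where x = "4 * south_const d \<eta>"], intro conjI allI impI ballI)
  note d = \<open>d > 0\<close> and \<eta> = \<open>\<eta> > 0\<close>
  \<comment> \<open>The constant 4 is 2 for the two tails of frequencies times 2 for the two
    targets.\<close>
  show "4 * south_const d \<eta> > 0" using south_const_pos[OF d \<eta>] by simp
  fix \<epsilon> :: real and N_S N_T :: nat and s t q :: "nat \<Rightarrow> real ^ 2" and l l' :: nat
  assume \<epsilon>: "0 < \<epsilon>" "\<epsilon> < 1"
    and s: "\<forall>j\<in>{1..N_S}. s j \<in> unit_cell d \<xi> \<eta>" and t: "\<forall>l\<in>{1..N_T}. t l \<in> unit_cell d \<xi> \<eta>"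
    and q: "(\<Sum>j\<in>{1..N_S}. q j) = 0" and l: "l \<in> {1..N_T}" and l': "l' \<in> {1..N_T}"
  define J where "J = {1..N_S}"
  define c where "c = south_const d \<eta>"
  define X where "X l j = t l $ 1 - s j $ 1" for l j
  define Y where "Y l j = t l $ 2 - s j $ 2" for l j
  define M where "M = trunc_M d \<eta> \<epsilon>"
  have M0: "trunc_M d \<eta> \<epsilon> \<ge> 0" by (rule trunc_M_bound(1)[OF d \<eta> \<epsilon>])
  have Y: "\<bar>Y l j\<bar> \<le> \<eta>" if "j \<in> J" "l \<in> {1..N_T}" for l j
    using unit_cell_height[OF \<eta>, of "s j" d \<xi>] unit_cell_height[OF \<eta>, of "t l" d \<xi>] s t that
    by (fastforce simp: Y_def J_def)
  define AM where "AM = A_south d \<xi> \<eta> \<epsilon> N_T N_S t s"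
  define sumq where "sumq F = (\<Sum>j\<in>J. \<Sum>k\<in>UNIV. F j k * complex_of_real (q j $ k))" for F
  define S where "S \<beta> l j i k = south_modes d \<xi> \<eta> (row_term d (mode_index i k) \<beta>) (X l j) (Y l j)" for \<beta> l j i k
  define SL where "SL l j i k = south_modes d \<xi> \<eta> (row_limit d (mode_index i k)) (X l j) (Y l j)" for l j i k
  define SF where "SF l j i k = (\<Sum>a\<in>{-M..M} - {0}. south_coef d \<xi> \<eta> i k (X l j) (Y l j) a)" for l j i k
  define V where "V \<beta> = (\<Sum>j\<in>J. (K2_south d \<xi> \<eta> \<beta> (t l) (s j) - K2_south d \<xi> \<eta> \<beta> (t l') (s j)) *v q j)" for \<beta>
  \<comment> \<open>The limit of the zero mode, present only in the first component.\<close>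
  define z where "z = - (1 / (2 * d * \<eta>)) * ((t l $ 2 - t l' $ 2) * (\<Sum>j\<in>J. s j $ 2 * q j $ 1))"
  define Z where "Z \<beta> = (\<Sum>j\<in>J. (south_zero d \<eta> \<beta> (Y l j) - south_zero d \<eta> \<beta> (Y l' j)) * q j $ 1)" for \<beta>
  define lim where "lim i = (if i = 1 then complex_of_real z else 0)
      + sumq (\<lambda>j k. SL l j i k - SL l' j i k)" for i :: 2
  have VS: "complex_of_real (V \<beta> $ i) = (if i = 1 then of_real (Z \<beta>) else 0)
      + sumq (\<lambda>j k. S \<beta> l j i k - S \<beta> l' j i k)" if \<beta>: "\<beta> > 0" for \<beta> i
  proof -
    have "complex_of_real (V \<beta> $ i) = (\<Sum>j\<in>J. \<Sum>k\<in>UNIV.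
        (of_real (K2_south d \<xi> \<eta> \<beta> (t l) (s j) $ i $ k) - of_real (K2_south d \<xi> \<eta> \<beta> (t l') (s j) $ i $ k)) * of_real (q j $ k))"
      by (simp add: V_def matrix_vector_mult_def)
    also have "\<dots> = (\<Sum>j\<in>J. (if i = 1 then of_real ((south_zero d \<eta> \<beta> (Y l j) - south_zero d \<eta> \<beta> (Y l' j)) * q j $ 1) else 0)
       + (\<Sum>k\<in>UNIV. (S \<beta> l j i k - S \<beta> l' j i k) * of_real (q j $ k)))"
    proof (rule sum.cong[OF refl])
      fix j assume j: "j \<in> J"
      have K: "complex_of_real (K2_south d \<xi> \<eta> \<beta> (t l) (s j) $ i $ k) = (if i = 1 \<and> k = 1 then of_real (south_zero d \<eta> \<beta> (Y l j)) else 0) + S \<beta> l j i k"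
        if "l \<in> {1..N_T}" for l k
        using K2_south_modes[OF d \<eta> \<beta> Y[OF j that, unfolded Y_def], of \<xi> i k] by (simp add: S_def X_def Y_def)
      show "(\<Sum>k\<in>UNIV. (of_real (K2_south d \<xi> \<eta> \<beta> (t l) (s j) $ i $ k) - of_real (K2_south d \<xi> \<eta> \<beta> (t l') (s j) $ i $ k)) * of_real (q j $ k))
         = (if i = 1 then of_real ((south_zero d \<eta> \<beta> (Y l j) - south_zero d \<eta> \<beta> (Y l' j)) * q j $ 1) else 0)
       + (\<Sum>k\<in>UNIV. (S \<beta> l j i k - S \<beta> l' j i k) * of_real (q j $ k))"
        unfolding K[OF l] K[OF l'] sum_2 by (simp add: algebra_simps)
    qed
    finally show ?thesis by (simp add: sum.distrib Z_def sumq_def)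
  qed
  have lim: "((\<lambda>\<beta>. complex_of_real (V \<beta> $ i)) \<longlongrightarrow> lim i) (at_right 0)" for i
  proof (rule Lim_transform_eventually)
    have q1: "(\<Sum>j\<in>J. q j $ 1) = 0"
      using q by (simp add: J_def flip: sum_component)
    have "(Z \<longlongrightarrow> z) (at_right 0)"
      unfolding Z_def z_def Y_def by (rule tendsto_south_zero[OF d \<eta> q1])
    moreover have "((\<lambda>\<beta>. S \<beta> l j i k) \<longlongrightarrow> SL l j i k) (at_right 0)" if "j \<in> J" "l \<in> {1..N_T}" for l j k
      unfolding S_def SL_def by (rule tendsto_south_modes[OF d \<eta> Y[OF that]])
    ultimately show "((\<lambda>\<beta>. (if i = 1 then complex_of_real (Z \<beta>) else 0)
      + sumq (\<lambda>j k. S \<beta> l j i k - S \<beta> l' j i k)) \<longlongrightarrow> lim i) (at_right 0)"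
      unfolding lim_def sumq_def using l l' by (cases "i = 1") (auto intro!: tendsto_intros)
    show "\<forall>\<^sub>F \<beta> in at_right 0. (if i = 1 then complex_of_real (Z \<beta>) else 0)
      + sumq (\<lambda>j k. S \<beta> l j i k - S \<beta> l' j i k) = of_real (V \<beta> $ i)"
      using eventually_at_right_less[of "0::real"] by eventually_elim (simp add: VS)
  qed
  define \<Delta> :: "real ^ 2" where "\<Delta> = (\<chi> i. Re (lim i))"
  have V\<Delta>: "(V \<longlongrightarrow> \<Delta>) (at_right 0)"
    by (rule vec_tendstoI) (use tendsto_Re[OF lim] in \<open>simp add: \<Delta>_def\<close>)
  \<comment> \<open>A limit of real numbers is real, which lets the complex limit be read back as
    the vector \<Delta>.\<close>
  have "Im (lim i) = 0" for i
  proof -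
    have "((\<lambda>\<beta>::real. 0) \<longlongrightarrow> Im (lim i)) (at_right 0)"
      using tendsto_Im[OF lim[of i]] by simp
    from tendsto_unique[OF _ this tendsto_const] show ?thesis by simp
  qed
  then have \<Delta>: "complex_of_real (\<Delta> $ i) = lim i" for i
    by (simp add: \<Delta>_def complex_eq_iff)
  define Aq where "Aq = block_apply J (AM) (\<lambda>j. complex_vec (q j))"
  have A: "Aq l $ i = (if i = 1 then complex_of_real (- (1 / (2 * d * \<eta>)) * (t l $ 2 * (\<Sum>j\<in>J. s j $ 2 * q j $ 1))) else 0)
      + sumq (\<lambda>j k. SF l j i k)" if "l \<in> {1..N_T}" for l i
  proof -
    have "Aq l $ i = (\<Sum>j\<in>J. \<Sum>k\<in>UNIV. AM l j $ i $ k * of_real (q j $ k))"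
      by (simp add: Aq_def block_apply_def complex_vec_def matrix_vector_mult_def)
    also have "\<dots> = (\<Sum>j\<in>J. (if i = 1 then complex_of_real (- (1 / (2 * d * \<eta>)) * (t l $ 2 * s j $ 2)) * of_real (q j $ 1) else 0)
       + (\<Sum>k\<in>UNIV. SF l j i k * of_real (q j $ k)))"
    proof (rule sum.cong[OF refl])
      fix j assume "j \<in> J"
      then have "AM l j $ i $ k
        = (if i = 1 \<and> k = 1 then complex_of_real (- (1 / (2 * d * \<eta>)) * (t l $ 2 * s j $ 2)) else 0) + SF l j i k" for k
        using A_south_entry[OF d M0 that, of j N_S \<xi> t s i k] by (simp add: SF_def X_def Y_def M_def J_def AM_def)
      then show "(\<Sum>k\<in>UNIV. AM l j $ i $ k * of_real (q j $ k))
        = (if i = 1 then complex_of_real (- (1 / (2 * d * \<eta>)) * (t l $ 2 * s j $ 2)) * of_real (q j $ 1) else 0)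
       + (\<Sum>k\<in>UNIV. SF l j i k * of_real (q j $ k))"
        by (simp add: sum_2 distrib_right)
    qed
    finally show ?thesis by (simp add: sumq_def sum.distrib sum_distrib_left mult_ac sum_negf sum_divide_distrib)
  qed
  have bound: "cmod (complex_of_real (\<Delta> $ i) - (Aq l $ i - Aq l' $ i)) \<le> 4 * c * \<epsilon> * (\<Sum>j\<in>J. \<bar>q j $ 1\<bar> + \<bar>q j $ 2\<bar>)" for i
  proof -
    \<comment> \<open>The zero block of the matrix reproduces \<open>z\<close> exactly, so only the
      truncated frequencies contribute to the error.\<close>
    have "complex_of_real (\<Delta> $ i) - (Aq l $ i - Aq l' $ i)
       = sumq (\<lambda>j k. SL l j i k - SL l' j i k)
       - (sumq (\<lambda>j k. SF l j i k) - sumq (\<lambda>j k. SF l' j i k))"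
      unfolding \<Delta> lim_def A[OF l] A[OF l'] z_def by (simp add: algebra_simps diff_divide_distrib)
    also have "\<dots> = sumq (\<lambda>j k. (SL l j i k - SF l j i k) - (SL l' j i k - SF l' j i k))"
      by (simp add: sumq_def sum_subtractf[symmetric] algebra_simps)
    also have "cmod \<dots> \<le> (\<Sum>j\<in>J. \<Sum>k\<in>UNIV. 4 * c * \<epsilon> * \<bar>q j $ k\<bar>)"
      unfolding sumq_def
    proof (intro order_trans[OF norm_sum] sum_mono)
      fix j k assume j: "j \<in> J"
      have e: "cmod (SL l j i k - SF l j i k) \<le> 2 * c * \<epsilon>" if "l \<in> {1..N_T}" for l
        unfolding SL_def SF_def c_def M_def by (rule south_modes_truncation[OF d \<eta> Y[OF j that] \<epsilon>])
      have "cmod ((SL l j i k - SF l j i k) - (SL l' j i k - SF l' j i k)) \<le> 4 * c * \<epsilon>"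
        using norm_triangle_ineq4[of "SL l j i k - SF l j i k" "SL l' j i k - SF l' j i k"] e[OF l] e[OF l'] by linarith
      then show "cmod (((SL l j i k - SF l j i k) - (SL l' j i k - SF l' j i k)) * of_real (q j $ k)) \<le> 4 * c * \<epsilon> * \<bar>q j $ k\<bar>"
        unfolding norm_mult norm_of_real by (rule mult_right_mono) simp
    qed
    also have "\<dots> = 4 * c * \<epsilon> * (\<Sum>j\<in>J. \<bar>q j $ 1\<bar> + \<bar>q j $ 2\<bar>)"
      by (simp add: sum_2 sum_distrib_left distrib_left)
    finally show ?thesis .
  qed
  show "\<exists>\<Delta> :: real ^ 2.
        ((\<lambda>\<beta>. \<Sum>j\<in>{1..N_S}. (K2_south d \<xi> \<eta> \<beta> (t l) (s j) - K2_south d \<xi> \<eta> \<beta> (t l') (s j)) *v q j)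
           \<longlongrightarrow> \<Delta>) (at_right 0) \<and>
        (let Aq = block_apply {1..N_S} (A_south d \<xi> \<eta> \<epsilon> N_T N_S t s) (\<lambda>j. complex_vec (q j))
         in \<forall>i::2. cmod (complex_of_real (\<Delta> $ i) - (Aq l $ i - Aq l' $ i))
                      \<le> 4 * south_const d \<eta> * \<epsilon> * (\<Sum>j\<in>{1..N_S}. \<bar>q j $ 1\<bar> + \<bar>q j $ 2\<bar>))"
    unfolding Let_def
    using V\<Delta> bound unfolding V_def[abs_def] Aq_def AM_def J_def c_def by blast
qed

end
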